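(* Let $\mathsf k$ be a field of characteristic zero and let $W$ be a pseudo-reflection group acting linearly on $\mathsf k[x_1,\dots,x_n]$. Then the Noncommutative Noether's Problem has a positive solution for $W$, that is, $F_n(\mathsf k)^W\cong F_n(\mathsf k)$ as $\mathsf k$-algebras.
   Context: A pseudo-reflection on a finite-dimensional vector space $V$ is a linear automorphism $g\ne \mathrm{id}$ of finite order whose fixed space is a hyperplane; a pseudo-reflection group is a finite subgroup of $GL(V)$ generated by pseudo-reflections. Here $W\subset GL(V)$ with $\dim V=n$, acting on the polynomial algebra $\mathsf k[x_1,\dots,x_n]=\mathcal O(V)$ in the induced (linear) way. $A_n(\mathsf k)$ is the $n$-th Weyl algebra, generated by $x_1,\dots,x_n,\partial_1,\dots,\partial_n$ with $\partial_i x_j-x_j\partial_i=\delta_{ij}$, $x_ix_j=x_jx_i$, $\partial_i\partial_j=\partial_j\partial_i$, i.e. the ring of differential operators on $\mathsf k[x_1,\dots,x_n]$; the action extends to it by $g*d=g\circ d\circ g^{-1}$ and to its skew field of fractions $F_n(\mathsf k)$. The Noncommutative Noether's Problem asks whether $F_n(\mathsf k)^W\cong F_m(L)$ for some $m$ and some purely transcendental extension $L$ of $\mathsf k$; it is known that this forces $m=n$ and $L=\mathsf k$, so a positive solution means $F_n(\mathsf k)^W\cong F_n(\mathsf k)$. *)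

theory Defs
  imports
    "HOL-Analysis.Cartesian_Space"
    "HOL-Library.Poly_Mapping"
    "HOL-Algebra.Generated_Groups"
    "HOL-Algebra.QuotRing"
    "HOL-Algebra.Module"
begin

definition GL :: "('k::field ^ 'n::finite \<Rightarrow> 'k ^ 'n) monoid" where
  "GL = \<lparr>carrier = {g. Vector_Spaces.linear (*s) (*s) g \<and> bij g}, mult = (\<circ>), one = id\<rparr>"

definition pseudo_reflection :: "('k::field ^ 'n::finite \<Rightarrow> 'k ^ 'n) \<Rightarrow> bool" where
  "pseudo_reflection g \<longleftrightarrow>
     g \<in> carrier GL \<and> g \<noteq> id \<and> (\<exists>m>0. g ^^ m = id) \<and> vec.dim {v. g v = v} + 1 = CARD('n)"

definition pseudo_reflection_group :: "('k::field ^ 'n::finite \<Rightarrow> 'k ^ 'n) set \<Rightarrow> bool" where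
  "pseudo_reflection_group W \<longleftrightarrow>
     subgroup W GL \<and> finite W \<and> (\<exists>S \<subseteq> Collect pseudo_reflection. W = generate GL S)"

text \<open>Monomials are exponent vectors; multiplication on \<^typ>\<open>('n \<Rightarrow>\<^sub>0 nat) \<Rightarrow>\<^sub>0 'k\<close> is convolution, so this
  type is the polynomial algebra in the variables indexed by \<open>'n\<close>.\<close>

type_synonym ('n, 'k) mpoly = "('n \<Rightarrow>\<^sub>0 nat) \<Rightarrow>\<^sub>0 'k"

type_synonym ('n, 'k) operator = "('n, 'k) mpoly \<Rightarrow> ('n, 'k) mpoly"

definition Const :: "'k::comm_ring_1 \<Rightarrow> ('n, 'k) mpoly" where
  "Const c = Poly_Mapping.single 0 c"

definition Var :: "'n \<Rightarrow> ('n, 'k::comm_ring_1) mpoly" where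
  "Var i = Poly_Mapping.single (Poly_Mapping.single i 1) 1"

definition pd :: "'n \<Rightarrow> ('n, 'k::comm_ring_1) mpoly \<Rightarrow> ('n, 'k) mpoly" where
  "pd i f = (\<Sum>m\<in>Poly_Mapping.keys f.
     Poly_Mapping.single (m - Poly_Mapping.single i 1)
       (of_nat (Poly_Mapping.lookup m i) * Poly_Mapping.lookup f m))"

definition subst_poly ::
  "('n::finite \<Rightarrow> ('n, 'k::comm_ring_1) mpoly) \<Rightarrow> ('n, 'k) mpoly \<Rightarrow> ('n, 'k) mpoly" where
  "subst_poly s f = (\<Sum>m\<in>Poly_Mapping.keys f.
     Const (Poly_Mapping.lookup f m) * (\<Prod>i\<in>UNIV. s i ^ Poly_Mapping.lookup m i))"

text \<open>The action on polynomial functions is \<open>(g \<cdot> f) v = f (g\<inverse> v)\<close>. Thus the coordinate function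
  \<open>Var i\<close> is sent to the linear form whose coefficient at \<open>Var j\<close> is the \<open>i\<close>-th coordinate of
  \<open>g\<inverse> e\<^sub>j\<close>.\<close>

definition poly_act :: "('k::field ^ 'n::finite \<Rightarrow> 'k ^ 'n) \<Rightarrow> ('n, 'k) mpoly \<Rightarrow> ('n, 'k) mpoly" where
  "poly_act g = subst_poly (\<lambda>i. \<Sum>j\<in>UNIV. Const (inv_into UNIV g (axis j 1) $ i) * Var j)"

lemma pd_superset:
  assumes "finite A" "Poly_Mapping.keys f \<subseteq> A"
  shows "pd i f = (\<Sum>m\<in>A. Poly_Mapping.single (m - Poly_Mapping.single i 1)
       (of_nat (Poly_Mapping.lookup m i) * Poly_Mapping.lookup f m))"
  unfolding pd_def using assms
  by (intro sum.mono_neutral_left) (auto simp: in_keys_iff)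

lemma pd_add: "pd i (f + g) = pd i f + pd i g"
proof -
  let ?A = "Poly_Mapping.keys f \<union> Poly_Mapping.keys g"
  have "finite ?A" by simp
  moreover have "Poly_Mapping.keys (f + g) \<subseteq> ?A" by (rule Poly_Mapping.keys_add)
  ultimately show ?thesis
    by (simp add: pd_superset[of ?A] lookup_add distrib_left single_add sum.distrib)
qed

lemma pd_single: "pd i (Poly_Mapping.single m c) =
  Poly_Mapping.single (m - Poly_Mapping.single i 1) (of_nat (Poly_Mapping.lookup m i) * c)"
  by (subst pd_superset[of "{m}"]) auto

lemma weyl_relation: fixes f :: "('a, 'b::comm_ring_1) mpoly" shows
  "pd i (Var j * f) - Var j * pd i f = (if i = j then f else 0)"
proof -
  have S: "pd i (Var j * Poly_Mapping.single m c) - Var j * pd i (Poly_Mapping.single m c) = (if i = j then Poly_Mapping.single m c else 0)" (is ?case) for m and c :: 'b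
  proof -
  have sh: "Poly_Mapping.single j (Suc 0) + m - Poly_Mapping.single i (Suc 0) = 
     Poly_Mapping.single j (Suc 0) + (m - Poly_Mapping.single i (Suc 0))" if "i \<noteq> j \<or> Poly_Mapping.lookup m i > 0"
    using that by (intro poly_mapping_eqI) (auto simp: lookup_add lookup_minus lookup_single when_def)
  show ?case
  proof (cases "i = j")
    case True
    then show ?thesis
      by (cases "Poly_Mapping.lookup m i = 0")
       (use sh in \<open>auto simp: Var_def pd_single mult_single lookup_add lookup_single distrib_right single_add
       poly_mapping_eq_iff fun_eq_iff lookup_minus\<close>)
  next
    case False
    then show ?thesis using sh by (auto simp: Var_def pd_single mult_single lookup_add lookup_single)
  qed
  qed
  show ?thesis
  proof (induction f rule: update_induct)
    case const
    then show ?case by (auto simp: pd_def)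
  next
    case (update f a b)
    have u: "Poly_Mapping.update a b f = f + Poly_Mapping.single a b"
      using update(1) by (intro poly_mapping_eqI) (auto simp: lookup_update lookup_add lookup_single in_keys_iff when_def)
    show ?case unfolding u using update(3) S[of a b] by (auto simp: pd_add distrib_left algebra_simps split: if_splits)
  qed
qed

text \<open>In characteristic zero the Weyl algebra is the algebra of differential operators on the
  polynomial algebra, that is, the algebra of operators generated by the multiplications by the
  variables and the partial derivatives. Algebras over a field type are represented by module
  records, of which only the ring part and the scalar multiplication are used.\<close>

inductive_set weyl_carrier :: "('n, 'k::field_char_0) operator set" where
  var: "(\<lambda>f. Var i * f) \<in> weyl_carrier"
| pd: "pd i \<in> weyl_carrier"
| scalar: "(\<lambda>f. Const c * f) \<in> weyl_carrier"
| add: "d \<in> weyl_carrier \<Longrightarrow> e \<in> weyl_carrier \<Longrightarrow> (\<lambda>f. d f + e f) \<in> weyl_carrier"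
| comp: "d \<in> weyl_carrier \<Longrightarrow> e \<in> weyl_carrier \<Longrightarrow> d \<circ> e \<in> weyl_carrier"

definition weyl_algebra ::
  "('k::field_char_0, ('n, 'k) operator) module" where
  "weyl_algebra = \<lparr>carrier = weyl_carrier, mult = (\<circ>), one = id,
     zero = (\<lambda>_. 0), add = (\<lambda>d e f. d f + e f), smult = (\<lambda>c d f. Const c * d f)\<rparr>"

definition weyl_act ::
  "('k::field ^ 'n::finite \<Rightarrow> 'k ^ 'n) \<Rightarrow> ('n, 'k) operator \<Rightarrow> ('n, 'k) operator" where
  "weyl_act g d = poly_act g \<circ> d \<circ> poly_act (inv_into UNIV g)"

text \<open>A pair \<open>(a, b)\<close> with \<open>b\<close> nonzero stands for the right fraction \<open>a b\<inverse>\<close>. Two pairs are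
  related if they agree after expansion to a common denominator. Since every two denominators
  have a nonzero common right multiple in an Ore domain, the sets defining \<open>add\<close>, \<open>mult\<close> and
  \<open>smult\<close> below are then single equivalence classes:
  \<open>a b\<inverse> + c d\<inverse> = (a u + c v) (b u)\<inverse>\<close> if \<open>b u = d v \<noteq> 0\<close>, and
  \<open>a b\<inverse> c d\<inverse> = (a u) (d v)\<inverse>\<close> if \<open>b u = c v\<close> and \<open>v \<noteq> 0\<close>.\<close>

definition frac_pairs :: "('k, 'a) module \<Rightarrow> ('a \<times> 'a) set" where
  "frac_pairs A = carrier A \<times> (carrier A - {\<zero>\<^bsub>A\<^esub>})"

definition frac_rel :: "('k, 'a) module \<Rightarrow> (('a \<times> 'a) \<times> ('a \<times> 'a)) set" where
  "frac_rel A = {((a, b), (c, d)). (a, b) \<in> frac_pairs A \<and> (c, d) \<in> frac_pairs A \<and>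
     (\<exists>u\<in>carrier A. \<exists>v\<in>carrier A.
        b \<otimes>\<^bsub>A\<^esub> u = d \<otimes>\<^bsub>A\<^esub> v \<and> b \<otimes>\<^bsub>A\<^esub> u \<noteq> \<zero>\<^bsub>A\<^esub> \<and> a \<otimes>\<^bsub>A\<^esub> u = c \<otimes>\<^bsub>A\<^esub> v)}"

definition skew_fraction_field :: "('k, 'a) module \<Rightarrow> ('k, ('a \<times> 'a) set) module" where
  "skew_fraction_field A = \<lparr>
     carrier = frac_pairs A // frac_rel A,
     mult = (\<lambda>X Y. {z. \<exists>a b c d u v. (a, b) \<in> X \<and> (c, d) \<in> Y \<and> u \<in> carrier A \<and> v \<in> carrier A \<and>
        b \<otimes>\<^bsub>A\<^esub> u = c \<otimes>\<^bsub>A\<^esub> v \<and> v \<noteq> \<zero>\<^bsub>A\<^esub> \<and>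
        ((a \<otimes>\<^bsub>A\<^esub> u, d \<otimes>\<^bsub>A\<^esub> v), z) \<in> frac_rel A}),
     one = frac_rel A `` {(\<one>\<^bsub>A\<^esub>, \<one>\<^bsub>A\<^esub>)},
     zero = frac_rel A `` {(\<zero>\<^bsub>A\<^esub>, \<one>\<^bsub>A\<^esub>)},
     add = (\<lambda>X Y. {z. \<exists>a b c d u v. (a, b) \<in> X \<and> (c, d) \<in> Y \<and> u \<in> carrier A \<and> v \<in> carrier A \<and>
        b \<otimes>\<^bsub>A\<^esub> u = d \<otimes>\<^bsub>A\<^esub> v \<and> b \<otimes>\<^bsub>A\<^esub> u \<noteq> \<zero>\<^bsub>A\<^esub> \<and>
        ((a \<otimes>\<^bsub>A\<^esub> u \<oplus>\<^bsub>A\<^esub> c \<otimes>\<^bsub>A\<^esub> v, b \<otimes>\<^bsub>A\<^esub> u), z) \<in> frac_rel A}),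
     smult = (\<lambda>k X. {z. \<exists>a b. (a, b) \<in> X \<and> ((k \<odot>\<^bsub>A\<^esub> a, b), z) \<in> frac_rel A})\<rparr>"

type_synonym ('n, 'k) operator_frac = "(('n, 'k) operator \<times> ('n, 'k) operator) set"

definition weyl_field :: "('k::field_char_0, ('n, 'k) operator_frac) module" where
  "weyl_field = skew_fraction_field weyl_algebra"

text \<open>The image of the class of \<open>(a, b)\<close> under the induced map of pairs is the class of
  \<open>(g * a, g * b)\<close>, because \<open>g\<close> acts by an automorphism of the Weyl algebra.\<close>

definition weyl_field_act ::
  "('k::field ^ 'n::finite \<Rightarrow> 'k ^ 'n)
     \<Rightarrow> ('n, 'k) operator_frac \<Rightarrow> ('n, 'k) operator_frac" where
  "weyl_field_act g X = map_prod (weyl_act g) (weyl_act g) ` X"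

definition weyl_field_invariants ::
  "('k::field_char_0 ^ 'n::finite \<Rightarrow> 'k ^ 'n) set
     \<Rightarrow> ('k, ('n, 'k) operator_frac) module" where
  "weyl_field_invariants W =
     weyl_field\<lparr>carrier := {X \<in> carrier weyl_field. \<forall>g\<in>W. weyl_field_act g X = X}\<rparr>"

definition algebra_isomorphic :: "('k, 'a) module \<Rightarrow> ('k, 'b) module \<Rightarrow> bool" where
  "algebra_isomorphic A B \<longleftrightarrow>
     (\<exists>h \<in> ring_iso A B. \<forall>k. \<forall>x\<in>carrier A. h (k \<odot>\<^bsub>A\<^esub> x) = k \<odot>\<^bsub>B\<^esub> h x)"

end

theory Submission
  imports Defs
begin

text \<open>
  Let \<open>K = k(x)\<close>, which sits inside the skew field \<open>F\<close> of fractions of the Weyl algebra. By Chevalley's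
  argument the invariant polynomials of a reflection group \<open>W\<close> are generated by \<open>n\<close> homogeneous
  invariants \<open>f\<^sub>1, \<dots>, f\<^sub>n\<close> whose gradients form a basis of \<open>K\<^sup>n\<close>. The dual vector fields
  \<open>D\<^sub>1, \<dots>, D\<^sub>n\<close> with coefficients in \<open>K\<close> are characterised by \<open>[D\<^sub>i, f\<^sub>j] = \<delta>\<^sub>i\<^sub>j\<close>, so they
  commute and are fixed by \<open>W\<close>. Hence \<open>x\<^sub>i \<mapsto> f\<^sub>i\<close>, \<open>\<partial>\<^sub>i \<mapsto> D\<^sub>i\<close> extends to an embedding of \<open>F\<close>
  into the invariants \<open>F\<^sup>W\<close>. It is onto: every differential operator is a left \<open>K\<close>-combination of
  elements of the image, so averaging over \<open>W\<close> puts invariant operators into the image, and every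
  invariant fraction is a quotient of two invariant operators.
\<close>

text \<open>The Weyl algebra is given by operators, not by a presentation, so the embedding is built
  as a graph generated by the two systems of generators. That the Weyl relations alone make this
  graph single-valued and injective rests on an Euler operator written purely with generators and
  commutators, which separates degrees in characteristic zero. The Ore condition, without which
  there are no fractions, follows from the polynomial growth of the word-length filtration. The
  basis property of the gradients has two halves. Independence comes from Chevalley's divided
  differences; it also bounds the size of an irredundant family of invariants, so that a largest one
  exists and generates. Spanning comes from the power sums of the conjugates of a polynomial, in
  place of the Galois theory of \<open>K\<close> over its invariants. The obstacle for invariant
  fractions is that numerator and denominator of \<open>P Q^-1\<close> need not be invariant: an
  invariant nonzero right multiple \<open>Q u\<close> is found as a trace, nonzero by independence
  of characters with noncommuting coefficients, and \<open>P u\<close> is then invariant by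
  itself.\<close>

abbreviation "lookup \<equiv> Poly_Mapping.lookup"
abbreviation "single \<equiv> Poly_Mapping.single"
abbreviation "keys \<equiv> Poly_Mapping.keys"

section \<open>Right Ore domains and their skew fields of fractions\<close>

text \<open>Requiring only \<open>u\<close> to be nonzero admits \<open>a = 0\<close> and serves two
  purposes: common denominators, and numerators moved into the right ideal of
  \<open>b\<close>.\<close>

class ore_domain = ring_1_no_zero_divisors +
  assumes right_ore: "b \<noteq> 0 \<Longrightarrow> \<exists>u v. u \<noteq> 0 \<and> a * u = b * v"

definition frac_eq :: "'a::ore_domain \<times> 'a \<Rightarrow> 'a \<times> 'a \<Rightarrow> bool" where
  "frac_eq x y \<longleftrightarrow> snd x \<noteq> 0 \<and> snd y \<noteq> 0 \<and>
     (\<exists>u v. snd x * u = snd y * v \<and> snd x * u \<noteq> 0 \<and> fst x * u = fst y * v)"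

lemma frac_eq_trans:
  assumes "frac_eq x y" "frac_eq y z" shows "frac_eq x z"
proof -
  obtain u v where 1: "snd x * u = snd y * v" "snd x * u \<noteq> 0" "fst x * u = fst y * v"
    and nz: "snd x \<noteq> 0" "snd y \<noteq> 0" "snd z \<noteq> 0"
    using assms unfolding frac_eq_def by blast
  obtain p q where 2: "snd y * p = snd z * q" "snd y * p \<noteq> 0" "fst y * p = fst z * q"
    using assms unfolding frac_eq_def by blast
  have "p \<noteq> 0" "v \<noteq> 0" using 1 2 by auto
  \<comment> \<open>The middle fraction is expanded once by \<open>v\<close> and once by
    \<open>p\<close>; an Ore multiple of these two multipliers aligns all three fractions.\<close>
  then obtain r s where rs: "r \<noteq> 0" "v * r = p * s" using right_ore[of p v] by blast
  have "snd x * (u * r) = snd z * (q * s)"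
    by (metis 1(1) 2(1) rs(2) mult.assoc)
  moreover have "fst x * (u * r) = fst z * (q * s)"
    by (metis 1(3) 2(3) rs(2) mult.assoc)
  moreover have "snd x * (u * r) \<noteq> 0" using 1(2) rs(1) by auto
  ultimately show ?thesis unfolding frac_eq_def using nz by blast
qed

\<comment> \<open>Partial, since a pair with zero denominator is not even related to itself;
  \<open>fr\<close> therefore sends such pairs to a default.\<close>
quotient_type (overloaded) 'a ofrac = "'a::ore_domain \<times> 'a" / partial: frac_eq
proof (rule part_equivpI)
  show "\<exists>x. frac_eq (x :: 'a \<times> 'a) x"
    by (rule exI[of _ "(0, 1)"]) (auto simp: frac_eq_def intro: exI[of _ 1])
  show "symp (frac_eq :: 'a \<times> 'a \<Rightarrow> _)"
    by (rule sympI) (unfold frac_eq_def, metis)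
  show "transp (frac_eq :: 'a \<times> 'a \<Rightarrow> _)"
    by (rule transpI) (rule frac_eq_trans)
qed

lift_definition fr :: "'a::ore_domain \<Rightarrow> 'a \<Rightarrow> 'a ofrac" is "\<lambda>a b. if b = 0 then (0, 1) else (a, b)"
  by (auto simp: frac_eq_def intro: exI[of _ 1])

lemma fr_eq_iff:
  assumes "b \<noteq> 0" "d \<noteq> 0"
  shows "fr a b = fr c d \<longleftrightarrow> (\<exists>u v. b * u = d * v \<and> b * u \<noteq> 0 \<and> a * u = c * v)"
  using assms by transfer (simp add: frac_eq_def)

lemma fr_eqE:
  assumes "fr a b = fr c d" "b \<noteq> 0" "d \<noteq> 0"
  obtains u v where "b * u = d * v" "u \<noteq> 0" "v \<noteq> 0" "a * u = c * v"
  using assms(1) unfolding fr_eq_iff[OF assms(2,3)] by (metis that mult_zero_right)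

lemma fr_eqI:
  assumes "b \<noteq> 0" "d \<noteq> 0" "u \<noteq> 0" "b * u = d * v" "a * u = c * v"
  shows "fr a b = fr c d"
proof (subst fr_eq_iff)
  show "\<exists>u v. b * u = d * v \<and> b * u \<noteq> 0 \<and> a * u = c * v"
    using assms no_zero_divisors[of b u] by blast
qed (use assms in simp_all)

lemma fr_cases:
  obtains a b where "b \<noteq> 0" "x = fr a b"
proof -
  have "\<exists>a b. b \<noteq> 0 \<and> x = fr a b"
  proof (transfer, goal_cases)
    case (1 x)
    show ?case
      by (rule exI[of _ "fst x"], rule exI[of _ "snd x"]) (use 1 in \<open>auto simp: frac_eq_def\<close>)
  qed
  then show ?thesis using that by blast
qed

lemma fr_cancel: "b \<noteq> 0 \<Longrightarrow> u \<noteq> 0 \<Longrightarrow> fr (a * u) (b * u) = fr a b"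
  using fr_eqI[of "b * u" b 1 u "a * u" a] by simp

lemma fr_0: "b \<noteq> 0 \<Longrightarrow> fr 0 b = fr 0 1"
  using fr_cancel[of 1 b 0] by simp

lemma fr_eq_fr_0_iff [simp]: "b \<noteq> 0 \<Longrightarrow> fr a b = fr 0 1 \<longleftrightarrow> a = 0"
  by (subst fr_eq_iff) (auto intro: exI[of _ 1])

text \<open>The Ore condition applied to numerators. With the second factor in this form a product
  is a mere cancellation, \<open>a b^-1 (b u) d^-1 = (a u) d^-1\<close>.\<close>

lemma fr_numerator_multiple:
  assumes "b \<noteq> 0"
  obtains u d where "d \<noteq> 0" "y = fr (b * u) d"
proof -
  obtain c d where cd: "d \<noteq> 0" "y = fr c d" by (rule fr_cases)
  obtain v u where "v \<noteq> 0" "c * v = b * u" using right_ore[OF assms, of c] by blast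
  then show ?thesis using that[of "d * v" u] cd fr_cancel[of d v c] by auto
qed

lemma fr_common_denominator:
  obtains a b c where "b \<noteq> 0" "x = fr a b" "y = fr c b"
proof -
  obtain a b where ab: "b \<noteq> 0" "x = fr a b" by (rule fr_cases)
  obtain c d where cd: "d \<noteq> 0" "y = fr c d" by (rule fr_cases)
  obtain u v where uv: "u \<noteq> 0" "b * u = d * v" using right_ore[OF cd(1), of b] by blast
  then have "v \<noteq> 0" using ab by auto
  then show ?thesis
    using that[of "b * u" "a * u" "c * v"] uv ab cd fr_cancel[of b u a] fr_cancel[of d v c] by auto
qed

lemma fr_mult_well_defined:
  assumes nz: "b \<noteq> 0" "d \<noteq> 0" "b' \<noteq> 0" "d' \<noteq> 0"
    and x: "fr a b = fr a' b'" and y: "fr (b * u) d = fr (b' * u') d'"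
  shows "fr (a * u) d = fr (a' * u') d'"
proof -
  obtain s t where st: "b * s = b' * t" "s \<noteq> 0" "a * s = a' * t"
    using x nz by (auto elim: fr_eqE)
  obtain p q where pq: "d * p = d' * q" "p \<noteq> 0" "b * u * p = b' * u' * q"
    using y nz by (auto elim: fr_eqE)
  from \<open>s \<noteq> 0\<close> obtain r r' where r: "r \<noteq> 0" "u * p * r = s * r'" using right_ore[of s "u * p"] by blast
  have "b' * (u' * q * r) = b * (u * p * r)" by (metis pq(3) mult.assoc)
  also have "\<dots> = b' * (t * r')" by (metis r(2) st(1) mult.assoc)
  finally have *: "u' * q * r = t * r'" using nz by simp
  have "a * u * (p * r) = a' * u' * (q * r)"
    by (metis * r(2) st(3) mult.assoc)
  moreover have "d * (p * r) = d' * (q * r)" by (metis pq(1) mult.assoc)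
  moreover have "p * r \<noteq> 0" using pq r by auto
  ultimately show ?thesis using nz by (intro fr_eqI)
qed

lemma fr_add_well_defined:
  assumes nz: "b \<noteq> 0" "b' \<noteq> 0"
    and x: "fr a b = fr a' b'" and y: "fr c b = fr c' b'"
  shows "fr (a + c) b = fr (a' + c') b'"
proof -
  obtain s t where st: "b * s = b' * t" "s \<noteq> 0" "a * s = a' * t"
    using x nz by (auto elim: fr_eqE)
  obtain p q where pq: "b * p = b' * q" "p \<noteq> 0" "c * p = c' * q"
    using y nz by (auto elim: fr_eqE)
  from \<open>p \<noteq> 0\<close> obtain r r' where r: "r \<noteq> 0" "s * r = p * r'" using right_ore[of p s] by blast
  have "b' * (t * r) = b' * (q * r')" by (metis st(1) pq(1) r(2) mult.assoc)
  then have *: "t * r = q * r'" using nz by simp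
  have "b * (s * r) = b' * (t * r)" by (metis st(1) mult.assoc)
  moreover have "a * (s * r) = a' * (t * r)" by (metis st(3) mult.assoc)
  moreover have "c * (s * r) = c' * (t * r)" by (metis * r(2) pq(3) mult.assoc)
  moreover have "s * r \<noteq> 0" using st r by auto
  ultimately show ?thesis using nz by (intro fr_eqI[of _ _ "s * r" "t * r"]) (simp_all add: distrib_right)
qed

instantiation ofrac :: (ore_domain) division_ring
begin

definition zero_ofrac :: "'a ofrac" where "0 = fr 0 1"

definition one_ofrac :: "'a ofrac" where "1 = fr 1 1"

text \<open>Sum and product are given by description over all admissible representatives at once;
  the two well-definedness lemmas above supply uniqueness, so no Ore multiple has to be
  chosen.\<close>

definition plus_ofrac :: "'a ofrac \<Rightarrow> 'a ofrac \<Rightarrow> 'a ofrac" where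
  "x + y = (THE z. \<exists>a b c. b \<noteq> 0 \<and> x = fr a b \<and> y = fr c b \<and> z = fr (a + c) b)"

definition times_ofrac :: "'a ofrac \<Rightarrow> 'a ofrac \<Rightarrow> 'a ofrac" where
  "x * y = (THE z. \<exists>a b u d. b \<noteq> 0 \<and> d \<noteq> 0 \<and> x = fr a b \<and> y = fr (b * u) d \<and> z = fr (a * u) d)"

lift_definition uminus_ofrac :: "'a ofrac \<Rightarrow> 'a ofrac" is "\<lambda>(a, b). (- a, b)"
  by (auto simp: frac_eq_def) blast

lift_definition inverse_ofrac :: "'a ofrac \<Rightarrow> 'a ofrac" is
  "\<lambda>(a, b). if a = 0 then (0, 1) else (b, a)"
proof goal_cases
  case (1 x y)
  obtain a b c d where [simp]: "x = (a, b)" "y = (c, d)" by force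
  obtain u v where *: "b \<noteq> 0" "d \<noteq> 0" "b * u = d * v" "b * u \<noteq> 0" "a * u = c * v"
    using 1 unfolding frac_eq_def by (metis \<open>x = (a, b)\<close> \<open>y = (c, d)\<close> fst_conv snd_conv)
  then have "u \<noteq> 0" "v \<noteq> 0" by (metis mult_zero_right)+
  then have "a = 0 \<longleftrightarrow> c = 0" using * by (metis mult_eq_0_iff)
  then show ?case using * \<open>u \<noteq> 0\<close> by (auto simp: frac_eq_def intro: exI[of _ 1])
qed

definition minus_ofrac :: "'a ofrac \<Rightarrow> 'a ofrac \<Rightarrow> 'a ofrac" where "x - y = x + - (y :: 'a ofrac)"

definition divide_ofrac :: "'a ofrac \<Rightarrow> 'a ofrac \<Rightarrow> 'a ofrac" where "x div y = x * inverse (y :: 'a ofrac)"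

lemma fr_add: "b \<noteq> 0 \<Longrightarrow> fr a b + fr c b = fr (a + c) b"
  unfolding plus_ofrac_def by (rule the_equality) (blast, metis fr_add_well_defined)

lemma fr_mult: "b \<noteq> 0 \<Longrightarrow> d \<noteq> 0 \<Longrightarrow> fr a b * fr (b * u) d = fr (a * u) d"
  unfolding times_ofrac_def
  by (rule the_equality) (blast, metis fr_mult_well_defined)

lemma fr_uminus: "b \<noteq> 0 \<Longrightarrow> - fr a b = fr (- a) b"
  by transfer (auto simp: frac_eq_def intro: exI[of _ 1])

lemma fr_inverse: "b \<noteq> 0 \<Longrightarrow> a \<noteq> 0 \<Longrightarrow> inverse (fr a b) = fr b a"
  by transfer (auto simp: frac_eq_def intro: exI[of _ 1])

instance
proof
  fix x y z :: "'a ofrac"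
  obtain a b where x: "b \<noteq> 0" "x = fr a b" by (rule fr_cases)
  have common: "\<exists>b a c e. b \<noteq> 0 \<and> x = fr a b \<and> y = fr c b \<and> z = fr e b" for x y z :: "'a ofrac"
  proof -
    obtain b a c where 1: "b \<noteq> 0" "x = fr a b" "y = fr c b" by (rule fr_common_denominator)
    obtain e f where 2: "f \<noteq> 0" "z = fr e f" by (rule fr_cases)
    obtain u v where uv: "u \<noteq> 0" "b * u = f * v" using right_ore[OF 2(1), of b] by blast
    then have "v \<noteq> 0" using 1 by auto
    then show ?thesis
      using uv 1 2 fr_cancel[of b u a] fr_cancel[of b u c] fr_cancel[of f v e]
      by (intro exI[of _ "b * u"] exI[of _ "a * u"] exI[of _ "c * u"] exI[of _ "e * v"]) auto
  qed
  show "x + y + z = x + (y + z)"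
    using common[of x y z] by (auto simp: fr_add add.assoc)
  show "x + y = y + x"
    using common[of x y z] by (auto simp: fr_add add.commute)
  show "0 + x = x" using x fr_add[of b 0 a] fr_0[of b] by (simp add: zero_ofrac_def)
  show "- x + x = 0" using x by (simp add: fr_uminus fr_add zero_ofrac_def)
  show "x - y = x + - y" by (simp add: minus_ofrac_def)
  show "x div y = x * inverse y" by (simp add: divide_ofrac_def)
  show "(0::'a ofrac) \<noteq> 1" unfolding zero_ofrac_def one_ofrac_def by (metis fr_eq_fr_0_iff zero_neq_one)
  show "inverse (0::'a ofrac) = 0" unfolding zero_ofrac_def
    by transfer (auto simp: frac_eq_def intro: exI[of _ 1])
  show "1 * x = x" using x fr_mult[of 1 b 1 a] by (simp add: one_ofrac_def)
  show "x * 1 = x" using x fr_mult[of b b a 1] fr_cancel[of 1 b 1] by (simp add: one_ofrac_def)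
  show "x * y * z = x * (y * z)"
  proof -
    obtain u d where y: "d \<noteq> 0" "y = fr (b * u) d" by (rule fr_numerator_multiple[OF x(1)])
    obtain w e where z: "e \<noteq> 0" "z = fr (d * w) e" by (rule fr_numerator_multiple[OF y(1)])
    show ?thesis using x y z
      by (simp add: fr_mult) (metis fr_mult mult.assoc)
  qed
  show "x * (y + z) = x * y + x * z"
  proof -
    obtain e c c' where yz: "e \<noteq> 0" "y = fr c e" "z = fr c' e" by (rule fr_common_denominator)
    obtain v u where v: "v \<noteq> 0" "c * v = b * u" using right_ore[OF x(1), of c] by blast
    obtain w u' where w: "w \<noteq> 0" "c' * v * w = b * u'" using right_ore[OF x(1), of "c' * v"] by blast
    have "y = fr (b * (u * w)) (e * v * w)" "z = fr (b * u') (e * v * w)"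
      using yz v w fr_cancel[of e "v * w" c] fr_cancel[of e "v * w" c']
      by (simp_all flip: mult.assoc)
    then show ?thesis using x yz(1) v(1) w(1)
      by (simp add: fr_add fr_mult flip: distrib_left)
  qed
  show "(x + y) * z = x * z + y * z"
  proof -
    obtain b a c where xy: "b \<noteq> 0" "x = fr a b" "y = fr c b" by (rule fr_common_denominator)
    obtain u d where z: "d \<noteq> 0" "z = fr (b * u) d" by (rule fr_numerator_multiple[OF xy(1)])
    show ?thesis using xy z by (simp add: fr_add fr_mult distrib_right)
  qed
  show "x \<noteq> 0 \<Longrightarrow> inverse x * x = 1"
    using x fr_mult[of a b b 1] fr_cancel[of 1 b 1] fr_0[of b]
    by (cases "a = 0") (auto simp: fr_inverse zero_ofrac_def one_ofrac_def)
  show "x \<noteq> 0 \<Longrightarrow> x * inverse x = 1"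
    using x fr_mult[of b a a 1] fr_cancel[of 1 a 1] fr_0[of b]
    by (cases "a = 0") (auto simp: fr_inverse zero_ofrac_def one_ofrac_def)
qed

end

lemma fr_eq_divide: "b \<noteq> 0 \<Longrightarrow> fr a b = fr a 1 / fr b 1"
  using fr_mult[of 1 b a 1] by (simp add: divide_ofrac_def fr_inverse)

section \<open>Ring homomorphisms and their extension to fractions\<close>

locale unital_ring_hom =
  fixes \<phi> :: "'a::ring_1 \<Rightarrow> 'b::ring_1"
  assumes hom_add: "\<phi> (x + y) = \<phi> x + \<phi> y"
    and hom_mult: "\<phi> (x * y) = \<phi> x * \<phi> y"
    and hom_1: "\<phi> 1 = 1"
begin

lemma hom_0: "\<phi> 0 = 0" using hom_add[of 0 0] by simp

lemma hom_uminus: "\<phi> (- x) = - \<phi> x"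
  using hom_add[of x "- x"] by (simp add: hom_0 eq_neg_iff_add_eq_0 add.commute)

lemma hom_diff: "\<phi> (x - y) = \<phi> x - \<phi> y"
  using hom_add[of x "- y"] by (simp add: hom_uminus)

lemma hom_sum: "\<phi> (sum f A) = (\<Sum>x\<in>A. \<phi> (f x))"
  by (induction A rule: infinite_finite_induct) (auto simp: hom_0 hom_add)

lemma hom_power: "\<phi> (x ^ n) = \<phi> x ^ n"
  by (induction n) (auto simp: hom_1 hom_mult)

lemma hom_of_nat: "\<phi> (of_nat n) = of_nat n"
  by (induction n) (auto simp: hom_0 hom_add hom_1)

end

lemma unital_ring_hom_fr: "unital_ring_hom (\<lambda>a::'a::ore_domain. fr a 1)"
proof
  show "fr (x + y) 1 = fr x 1 + fr y 1" for x y :: 'a by (simp add: fr_add)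
  show "fr (x * y) 1 = fr x 1 * fr y 1" for x y :: 'a using fr_mult[of 1 1 x y] by simp
qed (simp add: one_ofrac_def)

interpretation fr: unital_ring_hom "\<lambda>a::'a::ore_domain. fr a 1"
  by (rule unital_ring_hom_fr)

lemma division_ring_hom_inverse:
  fixes \<phi> :: "'a::division_ring \<Rightarrow> 'b::division_ring"
  assumes "unital_ring_hom \<phi>"
  shows "\<phi> (inverse x) = inverse (\<phi> x)" "\<phi> x = 0 \<longleftrightarrow> x = 0" "inj \<phi>" "\<phi> (x / y) = \<phi> x / \<phi> y"
proof -
  interpret unital_ring_hom \<phi> by fact
  have 1: "\<phi> (inverse x) * \<phi> x = 1" if "x \<noteq> 0" for x
    using that hom_mult[of "inverse x" x] hom_1 by simp
  show 2: "\<phi> x = 0 \<longleftrightarrow> x = 0" for x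
    using 1[of x] hom_0 by (metis mult_zero_right zero_neq_one)
  show 3: "\<phi> (inverse x) = inverse (\<phi> x)" for x
  proof (cases "x = 0")
    case False
    then have "inverse (\<phi> (inverse x)) = \<phi> x" using 1 by (intro inverse_unique)
    then show ?thesis by (metis 2 False nonzero_imp_inverse_nonzero nonzero_inverse_inverse_eq)
  qed (simp add: hom_0)
  show "inj \<phi>" by (rule injI) (metis 2 hom_diff right_minus_eq)
  show "\<phi> (x / y) = \<phi> x / \<phi> y" by (simp add: divide_inverse hom_mult 3)
qed

text \<open>The universal property of the localisation at the nonzero elements. Injectivity of
  \<phi>, assumed for the facts below, keeps the images of denominators invertible.\<close>

definition ofrac_lift :: "('a::ore_domain \<Rightarrow> 'b::division_ring) \<Rightarrow> 'a ofrac \<Rightarrow> 'b" where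
  "ofrac_lift \<phi> x = (THE z. \<exists>a b. b \<noteq> 0 \<and> x = fr a b \<and> z = \<phi> a / \<phi> b)"

context
  fixes \<phi> :: "'a::ore_domain \<Rightarrow> 'b::division_ring"
  assumes hom: "unital_ring_hom \<phi>" and inj: "inj \<phi>"
begin

interpretation unital_ring_hom \<phi> by (rule hom)

private lemma hom_eq_0: "\<phi> x = 0 \<longleftrightarrow> x = 0"
  using inj hom_0 by (metis injD)

private lemma hom_fraction_eq: "d \<noteq> 0 \<Longrightarrow> v \<noteq> 0 \<Longrightarrow> \<phi> c / \<phi> d = \<phi> (c * v) / \<phi> (d * v)"
  by (simp add: hom_mult hom_eq_0 divide_inverse nonzero_inverse_mult_distrib mult.assoc)
     (simp add: hom_eq_0 flip: mult.assoc)

lemma ofrac_lift_fr: "b \<noteq> 0 \<Longrightarrow> ofrac_lift \<phi> (fr a b) = \<phi> a / \<phi> b"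
  unfolding ofrac_lift_def
proof (rule the_equality)
  fix z assume b: "b \<noteq> 0" and "\<exists>c d. d \<noteq> 0 \<and> fr a b = fr c d \<and> z = \<phi> c / \<phi> d"
  then obtain c d where cd: "d \<noteq> 0" "fr a b = fr c d" "z = \<phi> c / \<phi> d" by blast
  then obtain u v where uv: "b * u = d * v" "u \<noteq> 0" "v \<noteq> 0" "a * u = c * v"
    using b by (auto elim: fr_eqE)
  then show "z = \<phi> a / \<phi> b" using cd uv b hom_fraction_eq[of d v c] hom_fraction_eq[of b u a] by simp
qed blast

lemma ofrac_lift_hom: "unital_ring_hom (ofrac_lift \<phi>)"
proof
  fix x y :: "'a ofrac"
  obtain b a c where 1: "b \<noteq> 0" "x = fr a b" "y = fr c b" by (rule fr_common_denominator)
  then show "ofrac_lift \<phi> (x + y) = ofrac_lift \<phi> x + ofrac_lift \<phi> y"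
    by (simp add: fr_add ofrac_lift_fr hom_add add_divide_distrib)
  obtain u d where 2: "d \<noteq> 0" "y = fr (b * u) d" by (rule fr_numerator_multiple[OF 1(1)])
  show "ofrac_lift \<phi> (x * y) = ofrac_lift \<phi> x * ofrac_lift \<phi> y"
    using 1(1,2) 2
    by (simp add: fr_mult ofrac_lift_fr hom_mult divide_inverse mult.assoc)
       (simp add: hom_eq_0 flip: mult.assoc)
  show "ofrac_lift \<phi> 1 = 1" by (simp add: one_ofrac_def ofrac_lift_fr hom_1)
qed

end

section \<open>Derivations and polynomials\<close>

locale derivation =
  fixes D :: "'a::ring_1 \<Rightarrow> 'a"
  assumes D_add: "D (x + y) = D x + D y"
    and D_mult: "D (x * y) = D x * y + x * D y"
begin

lemma D_0: "D 0 = 0" using D_add[of 0 0] by simp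

lemma D_1: "D 1 = 0" using D_mult[of 1 1] by simp

lemma D_uminus: "D (- x) = - D x"
  using D_add[of x "- x"] by (simp add: D_0 eq_neg_iff_add_eq_0 add.commute)

lemma D_sum: "D (sum f A) = (\<Sum>x\<in>A. D (f x))"
  by (induction A rule: infinite_finite_induct) (auto simp: D_0 D_add)

lemma funpow_D_add: "(D ^^ n) (x + y) = (D ^^ n) x + (D ^^ n) y"
  by (induction n) (auto simp: D_add)

lemma funpow_D_0: "(D ^^ n) 0 = 0"
  by (induction n) (auto simp: D_0)

lemma funpow_D_eq_0_mono: "(D ^^ n) x = 0 \<Longrightarrow> n \<le> m \<Longrightarrow> (D ^^ m) x = 0"
  by (metis funpow_D_0 funpow_add le_add_diff_inverse2 o_apply)

lemma funpow_D_mult_eq_0: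
  "(D ^^ m) x = 0 \<Longrightarrow> (D ^^ n) y = 0 \<Longrightarrow> (D ^^ (m + n)) (x * y) = 0"
proof (induction "m + n" arbitrary: m n x y)
  case (Suc k)
  show ?case
  proof (cases "m = 0 \<or> n = 0")
    case True
    then have "x * y = 0" using Suc.prems by auto
    then show ?thesis by (simp add: funpow_D_0)
  next
    case False
    then obtain m' n' where mn: "m = Suc m'" "n = Suc n'" by (meson not0_implies_Suc)
    have k: "k = m' + n" "k = m + n'" using Suc.hyps(2) mn by auto
    have "(D ^^ m') (D x) = 0" "(D ^^ n') (D y) = 0"
      using Suc.prems mn by (auto simp: funpow_Suc_right simp del: funpow.simps)
    then have "(D ^^ k) (D x * y) = 0" "(D ^^ k) (x * D y) = 0"
      using Suc.hyps(1)[OF k(1) _ Suc.prems(2)] Suc.hyps(1)[OF k(2) Suc.prems(1)] k by auto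
    then show ?thesis
      by (simp flip: Suc.hyps(2) add: funpow_Suc_right D_mult funpow_D_add del: funpow.simps)
  qed
qed auto

text \<open>Leibniz rule in top order: only the term with \<open>m\<close> derivatives on
  \<open>x\<close> and \<open>n\<close> on \<open>y\<close> survives. The number \<open>c\<close> is
  a binomial coefficient, built up by Pascal's rule in the induction.\<close>

lemma funpow_D_mult_top:
  assumes "(D ^^ Suc m) x = 0" "(D ^^ Suc n) y = 0"
  shows "\<exists>c>0. (D ^^ (m + n)) (x * y) = of_nat c * ((D ^^ m) x * (D ^^ n) y)"
  using assms
proof (induction "m + n" arbitrary: m n x y)
  case 0
  then show ?case by (auto intro: exI[of _ 1])
next
  case (Suc k)
  have left: "\<exists>c>0. (D ^^ k) (D x * y) = of_nat c * ((D ^^ m) x * (D ^^ n) y)" if pos: "m > 0"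
  proof -
    obtain m' where "m = Suc m'" using pos by (auto simp: gr0_conv_Suc)
    then have k: "k = m' + n" and x: "(D ^^ m') (D x) = (D ^^ m) x" "(D ^^ Suc m') (D x) = 0"
      using Suc.hyps(2) Suc.prems by (simp_all add: funpow_Suc_right del: funpow.simps)
    show ?thesis using Suc.hyps(1)[OF k x(2) Suc.prems(2)] unfolding x k .
  qed
  have right: "\<exists>c>0. (D ^^ k) (x * D y) = of_nat c * ((D ^^ m) x * (D ^^ n) y)" if pos: "n > 0"
  proof -
    obtain n' where "n = Suc n'" using pos by (auto simp: gr0_conv_Suc)
    then have k: "k = m + n'" and y: "(D ^^ n') (D y) = (D ^^ n) y" "(D ^^ Suc n') (D y) = 0"
      using Suc.hyps(2) Suc.prems by (simp_all add: funpow_Suc_right del: funpow.simps)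
    show ?thesis using Suc.hyps(1)[OF k Suc.prems(1) y(2)] unfolding y k .
  qed
  have eq: "(D ^^ (m + n)) (x * y) = (D ^^ k) (D x * y) + (D ^^ k) (x * D y)"
    using Suc.hyps(2) by (simp flip: Suc.hyps(2) add: funpow_Suc_right D_mult funpow_D_add del: funpow.simps)
  consider "m > 0" "n > 0" | "m = 0" "n > 0" | "m > 0" "n = 0" using Suc.hyps(2) by fastforce
  then show ?case
  proof cases
    case 1
    then obtain c d where "c > 0" "(D ^^ k) (D x * y) = of_nat c * ((D ^^ m) x * (D ^^ n) y)"
      "d > 0" "(D ^^ k) (x * D y) = of_nat d * ((D ^^ m) x * (D ^^ n) y)"
      using left right by blast
    then show ?thesis unfolding eq by (intro exI[of _ "c + d"]) (simp add: distrib_right)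
  next
    case 2
    then have "D x = 0" using Suc.prems by simp
    then show ?thesis unfolding eq using right 2 by (simp add: funpow_D_0)
  next
    case 3
    then have "D y = 0" using Suc.prems by simp
    then show ?thesis unfolding eq using left 3 by (simp add: funpow_D_0)
  qed
qed

lemma exists_last_funpow:
  assumes "x \<noteq> 0" "(D ^^ n) x = 0"
  shows "\<exists>m. (D ^^ m) x \<noteq> 0 \<and> (D ^^ Suc m) x = 0"
proof -
  obtain m where "m < (LEAST n. (D ^^ n) x = 0)" "(D ^^ Suc m) x = 0"
    using assms by (metis (mono_tags, lifting) LeastI funpow_0 lessI not0_implies_Suc)
  then show ?thesis using not_less_Least by blast
qed

end

text \<open>The last nonzero iterates of two factors under a locally nilpotent derivation lie in its kernel,
  and if their product is nonzero, so is the product of the factors. Doing this for one derivation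
  after the other leads into the common kernel.\<close>

lemma no_zero_divisors_by_derivations:
  fixes D :: "'i \<Rightarrow> 'a::ring_1 \<Rightarrow> 'a" and x y :: 'a
  assumes I: "finite I"
    and der: "\<And>i. i \<in> I \<Longrightarrow> derivation (D i)"
    and comm: "\<And>i j x. i \<in> I \<Longrightarrow> j \<in> I \<Longrightarrow> D i (D j x) = D j (D i x)"
    and nil: "\<And>i x. i \<in> I \<Longrightarrow> \<exists>n. (D i ^^ n) x = 0"
    and char: "\<And>n x. of_nat n * x = (0::'a) \<Longrightarrow> n > 0 \<Longrightarrow> x = 0"
    and base: "\<And>x y. x \<noteq> 0 \<Longrightarrow> y \<noteq> 0 \<Longrightarrow> (\<And>i. i \<in> I \<Longrightarrow> D i x = 0 \<and> D i y = 0) \<Longrightarrow> x * y \<noteq> 0"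
    and nz: "x \<noteq> 0" "y \<noteq> 0"
  shows "x * y \<noteq> 0"
proof -
  \<comment> \<open>\<open>J\<close> holds the derivations that may still move \<open>x\<close> or
    \<open>y\<close>; empty \<open>J\<close> is the case of the common kernel.\<close>
  have "x * y \<noteq> 0" if "finite J" "J \<subseteq> I" "x \<noteq> 0" "y \<noteq> 0" "\<And>j. j \<in> I - J \<Longrightarrow> D j x = 0 \<and> D j y = 0"
    for J x y
    using that
  proof (induction J arbitrary: x y rule: finite_induct)
    case empty
    then show ?case using base by blast
  next
    case (insert i J)
    then have i: "i \<in> I" by auto
    interpret derivation "D i" using der i by blast
    obtain m where m: "(D i ^^ m) x \<noteq> 0" "(D i ^^ Suc m) x = 0"
      using exists_last_funpow insert.prems nil[OF i] by metis
    obtain n where n: "(D i ^^ n) y \<noteq> 0" "(D i ^^ Suc n) y = 0"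
      using exists_last_funpow insert.prems nil[OF i] by metis
    \<comment> \<open>Commutation keeps the derivations outside \<open>J\<close> zero on the
      iterates.\<close>
    have pres: "D j ((D i ^^ k) z) = 0" if "D j z = 0" "j \<in> I" for j k z
      using that by (induction k) (auto simp: comm[OF _ i] D_0)
    have "(D i ^^ m) x * (D i ^^ n) y \<noteq> 0"
    proof (rule insert.IH)
      show "D j ((D i ^^ m) x) = 0 \<and> D j ((D i ^^ n) y) = 0" if "j \<in> I - J" for j
        using that insert.prems pres m n by (cases "j = i") auto
    qed (use insert m n in auto)
    moreover obtain c where "c > 0" "(D i ^^ (m + n)) (x * y) = of_nat c * ((D i ^^ m) x * (D i ^^ n) y)"
      using funpow_D_mult_top m n by blast
    ultimately have "(D i ^^ (m + n)) (x * y) \<noteq> 0" using char by fastforce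
    then show ?case using funpow_D_0 by fastforce
  qed
  from this[of I x y] I nz show ?thesis by auto
qed

section \<open>Monomial degrees, induction principles and partial derivatives\<close>

definition mdeg :: "('n::finite \<Rightarrow>\<^sub>0 nat) \<Rightarrow> nat" where
  "mdeg m = (\<Sum>i\<in>UNIV. lookup m i)"

lemma mdeg_0 [simp]: "mdeg 0 = 0"
  by (simp add: mdeg_def)

lemma mdeg_add: "mdeg (m + n) = mdeg m + mdeg n"
  by (simp add: mdeg_def lookup_add sum.distrib)

lemma mdeg_single [simp]: "mdeg (single i c) = c"
  by (simp add: mdeg_def lookup_single when_def)

lemma mdeg_eq_0_iff: "mdeg m = 0 \<longleftrightarrow> m = 0"
  by (auto simp: mdeg_def poly_mapping_eq_iff fun_eq_iff)

lemma monomial_split: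
  fixes m :: "'n \<Rightarrow>\<^sub>0 nat"
  assumes "lookup m i > 0"
  obtains m' where "m = single i 1 + m'"
proof
  show "m = single i 1 + (m - single i 1)"
    using assms by (intro poly_mapping_eqI) (auto simp: lookup_add lookup_minus lookup_single when_def)
qed

lemma monomial_split_Suc:
  assumes "Suc d = mdeg m"
  obtains i m' where "m = single i 1 + m'" "d = mdeg m'"
proof -
  have "m \<noteq> 0" using assms by auto
  then obtain i where "lookup m i > 0"
    by (metis gr_zeroI lookup_zero poly_mapping_eqI)
  then obtain m' where "m = single i 1 + m'" by (rule monomial_split)
  then show ?thesis using assms by (intro that) (simp_all add: mdeg_add)
qed

lemma mpoly_single_induct [case_names single add]:
  fixes f :: "('n, 'k::comm_ring_1) mpoly"
  assumes "\<And>m c. P (single m c)" "\<And>f g. P f \<Longrightarrow> P g \<Longrightarrow> P (f + g)"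
  shows "P f"
proof (induction f rule: update_induct)
  case const
  show ?case using assms(1)[of 0 0] by simp
next
  case (update f a b)
  have "Poly_Mapping.update a b f = f + single a b"
    using update(1) by (intro poly_mapping_eqI) (auto simp: lookup_update lookup_add lookup_single in_keys_iff when_def)
  then show ?case using update assms by metis
qed

lemma Const_0 [simp]: "Const 0 = 0" by (simp add: Const_def)
lemma Const_1 [simp]: "Const 1 = 1" by (simp add: Const_def)
lemma Const_add: "Const (a + b) = Const a + Const b" by (simp add: Const_def single_add)
lemma Const_mult: "Const (a * b) = Const a * Const b" by (simp add: Const_def mult_single)
lemma Const_uminus: "Const (- a) = - Const a" by (simp add: Const_def single_uminus)
lemma Const_eq_iff [simp]: "Const a = Const b \<longleftrightarrow> a = b" unfolding Const_def by (metis lookup_single_eq)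

lemma Const_sum: "Const (sum f A) = (\<Sum>x\<in>A. Const (f x))"
  by (induction A rule: infinite_finite_induct) (auto simp: Const_add)

lemma Const_of_nat: "Const (of_nat n) = of_nat n"
  by (induction n) (auto simp: Const_add)

lemma Const_eq_0_iff [simp]: "Const a = 0 \<longleftrightarrow> a = 0"
  using Const_eq_iff[of a 0] by (simp del: Const_eq_iff)

lemma lookup_Const_mult: "lookup (Const c * f) m = c * lookup f m"
  unfolding Const_def by (simp flip: mult_map_scale_conv_mult add: Poly_Mapping.map.rep_eq when_def)

lemma Var_mult_single:
  "Var i * single m c = single (single i 1 + m) c"
  by (simp add: Var_def mult_single)

lemma mpoly_induct [case_names Const Var add]:
  fixes f :: "('n::finite, 'k::comm_ring_1) mpoly"
  assumes "\<And>c. P (Const c)" "\<And>i f. P f \<Longrightarrow> P (Var i * f)" "\<And>f g. P f \<Longrightarrow> P g \<Longrightarrow> P (f + g)"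
  shows "P f"
proof -
  have "P (single m c)" for m c
  proof (induction "mdeg m" arbitrary: m)
    case 0
    then have "m = 0" by (simp add: mdeg_eq_0_iff)
    then show ?case using assms(1)[of c] by (simp add: Const_def)
  next
    case (Suc d)
    then obtain i m' where m': "m = single i 1 + m'" "d = mdeg m'"
      by (blast elim: monomial_split_Suc)
    then show ?case using Suc.hyps(1) assms(2) Var_mult_single by metis
  qed
  then show ?thesis by (rule mpoly_single_induct) (rule assms(3))
qed

lemma mpoly_induct_mult [case_names Const Var add mult]:
  fixes f :: "('n::finite, 'k::comm_ring_1) mpoly"
  assumes "\<And>c. P (Const c)" "\<And>i. P (Var i)" "\<And>f g. P f \<Longrightarrow> P g \<Longrightarrow> P (f + g)"
    "\<And>f g. P f \<Longrightarrow> P g \<Longrightarrow> P (f * g)"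
  shows "P f"
  by (induction f rule: mpoly_induct) (use assms in auto)

lemma pd_Const [simp]: "pd i (Const c) = 0"
  by (simp add: Const_def pd_single)

lemma pd_Var_mult: "pd i (Var j * f) = (if i = j then f else 0) + Var j * pd i f"
  using weyl_relation[of i j f] by (simp add: algebra_simps split: if_splits)

lemma pd_0 [simp]: "pd i 0 = 0"
  using pd_Const[of i 0] by (simp del: pd_Const)

lemma pd_1 [simp]: "pd i 1 = 0"
  using pd_Const[of i 1] by (simp del: pd_Const)

lemma pd_Var: "pd i (Var j) = (if i = j then 1 else 0)"
  using pd_Var_mult[of i j 1] by simp

lemma pd_Const_mult: "pd i (Const c * f) = Const c * pd i f"
  for f :: "('n::finite, 'k::comm_ring_1) mpoly"
proof (induction f rule: mpoly_induct)
  case (Const a)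
  show ?case by (simp flip: Const_mult)
next
  case (Var j f)
  then show ?case by (simp add: mult.left_commute[of "Const c"] pd_Var_mult distrib_left)
qed (auto simp: distrib_left pd_add)

lemma pd_mult: "pd i (f * g) = pd i f * g + f * pd i g"
  for f :: "('n::finite, 'k::comm_ring_1) mpoly"
proof (induction f rule: mpoly_induct)
  case (Var j f)
  then show ?case by (simp add: mult.assoc pd_Var_mult distrib_left distrib_right add_ac)
qed (auto simp: pd_Const_mult pd_add distrib_right add_ac)

interpretation pd: derivation "pd i" for i :: "'n::finite"
  by unfold_locales (auto simp: pd_add pd_mult)

lemma pd_commute: "pd i (pd j f) = pd j (pd i f)"
  for f :: "('n::finite, 'k::comm_ring_1) mpoly"
  by (induction f rule: mpoly_induct) (auto simp: pd_Var_mult pd_add)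

lemma pd_nilpotent: "\<exists>n. (pd i ^^ n) f = 0"
  for f :: "('n::finite, 'k::comm_ring_1) mpoly"
proof (induction f rule: mpoly_induct_mult)
  case (Const c)
  show ?case by (rule exI[of _ 1]) simp
next
  case (Var j)
  show ?case by (rule exI[of _ 2]) (simp add: numeral_2_eq_2 pd_Var)
next
  case (add f g)
  then obtain m n where mn: "(pd i ^^ m) f = 0" "(pd i ^^ n) g = 0" by blast
  show ?case
    using pd.funpow_D_eq_0_mono[OF mn(1), of "max m n"] pd.funpow_D_eq_0_mono[OF mn(2), of "max m n"]
    by (intro exI[of _ "max m n"]) (simp add: pd.funpow_D_add)
next
  case (mult f g)
  then show ?case using pd.funpow_D_mult_eq_0 by blast
qed

lemma lookup_pd:
  "lookup (pd i f) m = of_nat (Suc (lookup m i)) *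
    lookup f (m + single i 1)"
proof -
  have single: "lookup (pd i (single a c)) m =
    of_nat (Suc (lookup m i)) * lookup (single a c) (m + single i 1)" for a c
  proof (cases "lookup a i = 0")
    case True
    then have "a \<noteq> m + single i 1" by (auto simp: lookup_add)
    then show ?thesis using True by (simp add: pd_single lookup_single)
  next
    case False
    then obtain a' where "a = single i 1 + a'" by (auto elim: monomial_split)
    then show ?thesis by (auto simp: pd_single lookup_single lookup_add when_def add.commute)
  qed
  show ?thesis
    by (induction f rule: mpoly_single_induct) (simp_all only: single pd_add lookup_add distrib_left)
qed

text \<open>Characteristic zero enters here: a partial derivative shows a nonconstant coefficient of
  \<open>f\<close> only up to a positive integer factor.\<close>

lemma Const_of_pd_eq_0:
  fixes f :: "('n::finite, 'k::field_char_0) mpoly"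
  assumes "\<And>i. pd i f = 0"
  shows "f = Const (lookup f 0)"
proof (rule poly_mapping_eqI)
  fix m
  show "lookup f m = lookup (Const (lookup f 0)) m"
  proof (cases "m = 0")
    case False
    then obtain i where "lookup m i > 0"
      by (metis gr_zeroI lookup_zero poly_mapping_eqI)
    then obtain m' where m': "m = single i 1 + m'" by (rule monomial_split)
    have "of_nat (Suc (lookup m' i)) * lookup f m = 0"
      using lookup_pd[of i f m'] assms[of i] by (simp add: m' add.commute)
    then have "lookup f m = 0" by (metis mult_eq_0_iff of_nat_eq_0_iff nat.distinct(1))
    then show ?thesis using False by (simp add: Const_def lookup_single)
  qed (simp add: Const_def)
qed

text \<open>The partial derivatives are commuting, locally nilpotent derivations whose common kernel
  consists of the constants, so the derivation criterion reduces the claim to the field of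
  scalars.\<close>

lemma mpoly_mult_eq_0_iff [simp]:
  fixes f g :: "('n::finite, 'k::field_char_0) mpoly"
  shows "f * g = 0 \<longleftrightarrow> f = 0 \<or> g = 0"
proof -
  have "f * g \<noteq> 0" if "f \<noteq> 0" "g \<noteq> 0"
  proof (rule no_zero_divisors_by_derivations[of UNIV pd])
    show "x * y \<noteq> 0" if "x \<noteq> 0" "y \<noteq> 0" "\<And>i. i \<in> UNIV \<Longrightarrow> pd i x = 0 \<and> pd i y = 0"
      for x y :: "('n, 'k) mpoly"
    proof -
      have "x = Const (lookup x 0)" "y = Const (lookup y 0)"
        using that(3) by (auto intro: Const_of_pd_eq_0)
      then obtain a b where "x = Const a" "y = Const b" by blast
      then show ?thesis using that by (simp flip: Const_mult)
    qed
    show "x = 0" if "of_nat n * x = 0" "n > 0" for n and x :: "('n, 'k) mpoly"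
    proof (rule poly_mapping_eqI)
      fix m
      have "of_nat n * lookup x m = 0"
        using that(1) lookup_Const_mult[of "of_nat n" x m] by (simp add: Const_of_nat)
      then show "lookup x m = lookup 0 m" using that(2) by simp
    qed
  qed (use that pd_nilpotent pd_commute pd.derivation_axioms in auto)
  then show ?thesis by auto
qed

lemma mpoly_prod_eq_0_iff:
  fixes f :: "'i \<Rightarrow> ('n::finite, 'k::field_char_0) mpoly"
  shows "finite A \<Longrightarrow> prod f A = 0 \<longleftrightarrow> (\<exists>x\<in>A. f x = 0)"
  by (induction A rule: finite_induct) auto

section \<open>The Weyl algebra as a domain\<close>

lemma weyl_carrier_add:
  "d \<in> weyl_carrier \<Longrightarrow> d (f + g) = d f + d g"
  by (induction d arbitrary: f g rule: weyl_carrier.induct) (auto simp: pd_add algebra_simps)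

lemma weyl_carrier_Const_mult:
  fixes d :: "('n::finite, 'k::field_char_0) operator"
  shows "d \<in> weyl_carrier \<Longrightarrow> d (Const c * f) = Const c * d f"
  by (induction d arbitrary: f rule: weyl_carrier.induct)
    (auto simp: pd_Const_mult distrib_left mult.left_commute)

lemma mult_in_weyl_carrier:
  fixes p :: "('n::finite, 'k::field_char_0) mpoly"
  shows "(\<lambda>f. p * f) \<in> weyl_carrier"
proof (induction p rule: mpoly_induct_mult)
  case (mult f g)
  have "(\<lambda>h. f * g * h) = (\<lambda>h. f * h) \<circ> (\<lambda>h. g * h)" by (auto simp: mult.assoc)
  then show ?case using mult weyl_carrier.comp by metis
next
  case (add f g)
  then show ?case using weyl_carrier.add[of "\<lambda>h. f * h" "\<lambda>h. g * h"] by (simp add: distrib_right)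
qed (auto intro: weyl_carrier.intros)

text \<open>A type of its own makes the ring classes, and through them \<open>ofrac\<close>,
  applicable; \<open>Rep_weyl\<close> gives back the operator for arguments by evaluation.\<close>

typedef (overloaded) ('n, 'k) weyl = "weyl_carrier :: ('n::finite, 'k::field_char_0) operator set"
  using weyl_carrier.scalar by blast

setup_lifting type_definition_weyl
lifting_forget poly_mapping.lifting

lift_definition wm :: "('n::finite, 'k::field_char_0) mpoly \<Rightarrow> ('n, 'k) weyl" is "\<lambda>p f. p * f"
  by (rule mult_in_weyl_carrier)

lift_definition wd :: "'n::finite \<Rightarrow> ('n, 'k::field_char_0) weyl" is pd
  by (rule weyl_carrier.pd)

instantiation weyl :: (finite, field_char_0) ring_1
begin

lift_definition zero_weyl :: "('a, 'b) weyl" is "\<lambda>_. 0"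
  using mult_in_weyl_carrier[of 0] unfolding mult_zero_left .

lift_definition one_weyl :: "('a, 'b) weyl" is id
  using mult_in_weyl_carrier[of 1] unfolding mult_1_left id_def .

lift_definition plus_weyl :: "('a, 'b) weyl \<Rightarrow> ('a, 'b) weyl \<Rightarrow> ('a, 'b) weyl" is "\<lambda>d e f. d f + e f"
  by (rule weyl_carrier.add)

lift_definition times_weyl :: "('a, 'b) weyl \<Rightarrow> ('a, 'b) weyl \<Rightarrow> ('a, 'b) weyl" is "\<lambda>d e. d \<circ> e"
  by (rule weyl_carrier.comp)

lift_definition uminus_weyl :: "('a, 'b) weyl \<Rightarrow> ('a, 'b) weyl" is "\<lambda>d f. - d f"
proof -
  fix d :: "('a, 'b) operator" assume "d \<in> weyl_carrier"
  from weyl_carrier.comp[OF weyl_carrier.scalar[of "-1"] this]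
  show "(\<lambda>f. - d f) \<in> weyl_carrier" by (simp add: o_def Const_uminus)
qed

definition minus_weyl :: "('a, 'b) weyl \<Rightarrow> ('a, 'b) weyl \<Rightarrow> ('a, 'b) weyl" where
  "a - b = a + - (b :: ('a, 'b) weyl)"

instance
proof
  fix a b c :: "('a, 'b) weyl"
  show "a + b + c = a + (b + c)" "a + b = b + a" "0 + a = a" "- a + a = 0" "1 * a = a" "a * 1 = a"
    "(a + b) * c = a * c + b * c" "a * b * c = a * (b * c)"
    by (transfer, auto simp: algebra_simps)+
  show "a * (b + c) = a * b + a * c"
    by transfer (auto simp: weyl_carrier_add)
  show "(0 :: ('a, 'b) weyl) \<noteq> 1"
  proof
    assume "(0 :: ('a, 'b) weyl) = 1"
    then have "Rep_weyl (0 :: ('a, 'b) weyl) 1 = Rep_weyl 1 1" by simp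
    then show False by (simp add: zero_weyl.rep_eq one_weyl.rep_eq)
  qed
qed (auto simp: minus_weyl_def)

end

lemma weyl_diff_eq: "Rep_weyl (a - b) f = Rep_weyl a f - Rep_weyl b f"
  by (simp only: minus_weyl_def plus_weyl.rep_eq uminus_weyl.rep_eq) simp

lemma wm_add: "wm (p + q) = wm p + wm q"
  by transfer (auto simp: algebra_simps)

lemma wm_mult: "wm (p * q) = wm p * wm q"
  by transfer (auto simp: algebra_simps)

lemma wm_1 [simp]: "wm 1 = 1"
  by transfer auto

interpretation wm: unital_ring_hom wm
  by unfold_locales (auto simp: wm_add wm_mult)

lemma wm_eq_iff [simp]: "wm p = wm q \<longleftrightarrow> p = q"
  by transfer (auto simp: fun_eq_iff dest: spec[of _ 1])

lemma wm_eq_0_iff [simp]: "wm p = 0 \<longleftrightarrow> p = 0"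
  using wm_eq_iff[of p 0] by (simp add: wm.hom_0 del: wm_eq_iff)

abbreviation wc :: "'k \<Rightarrow> ('n::finite, 'k::field_char_0) weyl" where "wc c \<equiv> wm (Const c)"

abbreviation wv :: "'n \<Rightarrow> ('n::finite, 'k::field_char_0) weyl" where "wv i \<equiv> wm (Var i)"

lemma wc_central: "wc c * a = a * wc c"
  by transfer (auto simp: weyl_carrier_Const_mult)

lemma weyl_induct [case_names var pd scalar add mult]:
  fixes a :: "('n::finite, 'k::field_char_0) weyl"
  assumes "\<And>i. P (wv i)" "\<And>i. P (wd i)" "\<And>c. P (wc c)"
    "\<And>a b. P a \<Longrightarrow> P b \<Longrightarrow> P (a + b)" "\<And>a b. P a \<Longrightarrow> P b \<Longrightarrow> P (a * b)"
  shows "P a"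
proof -
  have "P (Abs_weyl d)" if "d \<in> weyl_carrier" for d
    using that
  proof (induction d rule: weyl_carrier.induct)
    case (add d e)
    then show ?case using assms(4)[of "Abs_weyl d" "Abs_weyl e"]
      by (simp add: plus_weyl_def Abs_weyl_inverse)
  next
    case (comp d e)
    then show ?case using assms(5)[of "Abs_weyl d" "Abs_weyl e"]
      by (simp add: times_weyl_def Abs_weyl_inverse o_def)
  qed (use assms in \<open>simp_all add: wm_def wd_def\<close>)
  from this[of "Rep_weyl a"] show ?thesis by (simp add: Rep_weyl Rep_weyl_inverse)
qed

lemma wd_wm: "wd i * wm p - wm p * wd i = wm (pd i p)"
proof -
  have "Rep_weyl (wd i * wm p - wm p * wd i) f = Rep_weyl (wm (pd i p)) f" for f
    by (simp add: weyl_diff_eq times_weyl.rep_eq wm.rep_eq wd.rep_eq pd_mult)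
  then show ?thesis by (auto simp flip: Rep_weyl_inject)
qed

lemma wd_commute: "wd i * wd j = wd j * wd i"
  by transfer (auto simp: pd_commute)

section \<open>Commutators and the absence of zero divisors\<close>

definition ad :: "'a::ring_1 \<Rightarrow> 'a \<Rightarrow> 'a" where "ad x a = x * a - a * x"

lemma derivation_ad: "derivation (ad x)"
  by unfold_locales (auto simp: ad_def algebra_simps)

interpretation ad: derivation "ad x" for x
  by (rule derivation_ad)

lemma ad_uminus: "ad x a = - ad a x"
  by (simp add: ad_def)

lemma ad_wd_wm: "ad (wd i) (wm p) = wm (pd i p)"
  by (simp add: ad_def wd_wm)

lemma ad_wm_wd: "ad (wm p) (wd i) = - wm (pd i p)"
  by (simp add: ad_uminus[of "wm p"] ad_wd_wm)

lemma ad_wm_wm [simp]: "ad (wm p) (wm q) = 0"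
  by (simp add: ad_def mult.commute flip: wm_mult)

lemma ad_wd_wd [simp]: "ad (wd i) (wd j) = 0"
  by (simp add: ad_def wd_commute)

lemma ad_wc [simp]: "ad a (wc c) = 0"
  by (simp add: ad_def wc_central)

lemma ad_jacobi: "ad x (ad y a) = ad (ad x y) a + ad y (ad x a)"
  by (simp add: ad_def algebra_simps)

fun weyl_gen :: "'n + 'n \<Rightarrow> ('n::finite, 'k::field_char_0) weyl" where
  "weyl_gen (Inl i) = wv i"
| "weyl_gen (Inr i) = wd i"

text \<open>Scalar commutators are the source of two hypotheses of the derivation criterion: by
  Jacobi the maps \<open>ad\<close> of the generators commute, and each of them kills every
  generator in two steps.\<close>

lemma ad_weyl_gen_gen: "\<exists>c. ad (weyl_gen s) (weyl_gen t) = wc c"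
proof (cases s; cases t)
  fix i j assume st: "s = Inl i" "t = Inr j"
  show ?thesis unfolding st weyl_gen.simps ad_wm_wd
    by (rule exI[of _ "if i = j then -1 else 0"]) (simp add: pd_Var Const_uminus wm.hom_uminus wm.hom_0)
next
  fix i j assume st: "s = Inr i" "t = Inl j"
  show ?thesis unfolding st weyl_gen.simps ad_wd_wm
    by (rule exI[of _ "if i = j then 1 else 0"]) (simp add: pd_Var wm.hom_0)
qed (auto intro: exI[of _ 0] simp: wm.hom_0)

lemma ad_weyl_gen_nilpotent: "\<exists>n. (ad (weyl_gen s) ^^ n) a = 0"
proof -
  have gen: "\<exists>n. (ad (weyl_gen s) ^^ n) (weyl_gen t :: ('a, 'b) weyl) = 0" for t
  proof -
    obtain c where "ad (weyl_gen s) (weyl_gen t) = (wc c :: ('a, 'b) weyl)" using ad_weyl_gen_gen by blast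
    then show ?thesis by (intro exI[of _ 2]) (simp add: numeral_2_eq_2)
  qed
  show ?thesis
  proof (induction a rule: weyl_induct)
    case (var i)
    show ?case using gen[of "Inl i"] by simp
  next
    case (pd i)
    show ?case using gen[of "Inr i"] by simp
  next
    case (scalar c)
    show ?case by (rule exI[of _ 1]) simp
  next
    case (add a b)
    then obtain m n where mn: "(ad (weyl_gen s) ^^ m) a = 0" "(ad (weyl_gen s) ^^ n) b = 0" by blast
    show ?case
      using ad.funpow_D_eq_0_mono[OF mn(1), of "max m n"] ad.funpow_D_eq_0_mono[OF mn(2), of "max m n"]
      by (intro exI[of _ "max m n"]) (simp add: ad.funpow_D_add)
  next
    case (mult a b)
    then show ?case using ad.funpow_D_mult_eq_0 by blast
  qed
qed

text \<open>Commuting with all variables makes the operator linear over the polynomials, hence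
  multiplication by its value at 1.\<close>

lemma weyl_centralizer_vars:
  assumes "\<And>i. ad (wv i) a = 0"
  shows "a = wm (Rep_weyl a 1)"
proof -
  have rep: "Rep_weyl a f = f * Rep_weyl a 1" for f
  proof (induction f rule: mpoly_induct)
    case (Const c)
    show ?case using weyl_carrier_Const_mult[OF Rep_weyl, of a c 1] by simp
  next
    case (Var i f)
    have "wv i * a = a * wv i" using assms[of i] by (simp add: ad_def)
    then have "Rep_weyl (wv i * a) f = Rep_weyl (a * wv i) f" by simp
    then show ?case using Var by (simp add: times_weyl.rep_eq wm.rep_eq mult.assoc)
  next
    case (add f g)
    then show ?case by (simp add: weyl_carrier_add[OF Rep_weyl] distrib_right)
  qed
  have "Rep_weyl a = Rep_weyl (wm (Rep_weyl a 1))"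
  proof
    show "Rep_weyl a f = Rep_weyl (wm (Rep_weyl a 1)) f" for f
      unfolding wm.rep_eq using rep[of f] by (simp only: mult.commute)
  qed
  then show ?thesis by (simp add: Rep_weyl_inject)
qed

lemma weyl_center:
  assumes "\<And>s. ad (weyl_gen s) a = 0"
  shows "\<exists>c. a = wc c"
proof -
  define p where "p = Rep_weyl a 1"
  have a: "a = wm p"
    unfolding p_def by (rule weyl_centralizer_vars) (use assms[of "Inl _"] in simp)
  have "wm (pd i p) = wm 0" for i
    using assms[of "Inr i"] ad_wd_wm[of i p] by (simp add: a wm.hom_0)
  then have "p = Const (lookup p 0)" by (intro Const_of_pd_eq_0) simp
  then show ?thesis using a by metis
qed

lemma wm_of_nat: "wc (of_nat n) = of_nat n"
  by (simp add: Const_of_nat wm.hom_of_nat)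

lemma weyl_of_nat_mult_eq_0:
  fixes x :: "('n::finite, 'k::field_char_0) weyl"
  assumes "of_nat n * x = 0" "n > 0" shows "x = 0"
proof -
  have "x = wc (1 / of_nat n) * (wc (of_nat n) * x)"
    using assms(2) by (simp flip: mult.assoc wm_mult Const_mult)
  then show ?thesis using assms(1) by (simp add: wm_of_nat)
qed

instance weyl :: (finite, field_char_0) ring_1_no_zero_divisors
proof
  fix a b :: "('a, 'b) weyl"
  assume ab: "a \<noteq> 0" "b \<noteq> 0"
  show "a * b \<noteq> 0"
  \<comment> \<open>The common kernel of these inner derivations is the centre, which consists of
    scalars.\<close>
  proof (rule no_zero_divisors_by_derivations[of UNIV "\<lambda>s. ad (weyl_gen s)"])
    show "ad (weyl_gen s) (ad (weyl_gen t) x) = ad (weyl_gen t) (ad (weyl_gen s) x)"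
      for s t and x :: "('a, 'b) weyl"
    proof -
      obtain c where "ad (weyl_gen s) (weyl_gen t) = (wc c :: ('a, 'b) weyl)" using ad_weyl_gen_gen by blast
      then show ?thesis
        using ad_jacobi[of "weyl_gen s" "weyl_gen t" x] by (simp add: ad_uminus[of "wc c"])
    qed
    show "x * y \<noteq> 0" if nz: "x \<noteq> 0" "y \<noteq> 0"
      and c: "\<And>s. s \<in> UNIV \<Longrightarrow> ad (weyl_gen s) x = 0 \<and> ad (weyl_gen s) y = 0"
      for x y :: "('a, 'b) weyl"
    proof -
      obtain c d where "x = wc c" "y = wc d" using weyl_center[of x] weyl_center[of y] c by auto
      then show ?thesis using nz by (simp flip: wm_mult)
    qed
  qed (use ab in \<open>auto simp: derivation_ad ad_weyl_gen_nilpotent weyl_of_nat_mult_eq_0\<close>)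
qed

section \<open>The Weyl relations determine the Weyl algebra\<close>

lemma of_nat_left_commute: "of_nat n * (x * y) = x * (of_nat n * y)" for x y :: "'a::semiring_1"
  by (metis mult.assoc mult_of_nat_commute)

text \<open>Candidates for the images of scalars, variables and derivatives in an arbitrary ring.
  Three instances occur: the standard generators, their Fourier transform, and the basic invariants
  with their dual vector fields.\<close>

locale weyl_system =
  fixes \<kappa> :: "'k::field_char_0 \<Rightarrow> 'a::ring_1" and p q :: "'n::finite \<Rightarrow> 'a"
  assumes scalar_hom: "unital_ring_hom \<kappa>"
    and scalar_central: "\<kappa> c * a = a * \<kappa> c"
    and p_commute: "p i * p j = p j * p i"
    and q_commute: "q i * q j = q j * q i"
    and qp: "ad (q i) (p j) = (if i = j then 1 else 0)"
begin

interpretation \<kappa>: unital_ring_hom \<kappa> by (rule scalar_hom)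

lemma scalar_eq_0_iff: "\<kappa> c = 0 \<longleftrightarrow> c = 0"
proof
  assume 0: "\<kappa> c = 0"
  show "c = 0"
  proof (rule ccontr)
    assume "c \<noteq> 0"
    then have "1 = \<kappa> c * \<kappa> (inverse c)" by (simp add: \<kappa>.hom_1 flip: \<kappa>.hom_mult)
    then show False using 0 by simp
  qed
qed (simp add: \<kappa>.hom_0)

lemma ad_scalar: "ad a (\<kappa> c) = 0"
  by (simp add: ad_def scalar_central)

lemma ad_q_p_mult: "ad (q i) (p j * a) = (if i = j then a else 0) + p j * ad (q i) a"
  by (simp add: ad.D_mult qp)

lemma ad_q_q_mult: "ad (q i) (q j * a) = q j * ad (q i) a"
  by (simp add: ad.D_mult) (simp add: ad_def q_commute)

lemma ad_p_p_mult: "ad (p i) (p j * a) = p j * ad (p i) a"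
  by (simp add: ad.D_mult) (simp add: ad_def p_commute)

lemma ad_p_q_mult: "ad (p i) (q j * a) = q j * ad (p i) a - (if i = j then a else 0)"
  by (simp add: ad.D_mult ad_uminus[of "p i" "q j"] qp)

text \<open>On a normally ordered monomial, all \<open>p\<close> left of all \<open>q\<close>, this
  is multiplication by the total degree: \<open>p i * ad (q i) a\<close> counts the exponent of
  \<open>p i\<close>, and \<open>- ad (p i) a * q i\<close> that of \<open>q i\<close>. Being
  written with generators and commutators only, it can be compared across two systems.\<close>

definition euler :: "'a \<Rightarrow> 'a" where
  "euler a = (\<Sum>i\<in>UNIV. p i * ad (q i) a - ad (p i) a * q i)"

lemma euler_add: "euler (a + b) = euler a + euler b"
  by (simp add: euler_def ad.D_add algebra_simps sum.distrib sum_subtractf)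

lemma euler_scalar: "euler (\<kappa> c) = 0"
  by (simp add: euler_def ad_scalar)

lemma euler_p: "euler (p j * a) = p j * a + p j * euler a"
proof -
  have "p i * ad (q i) (p j * a) - ad (p i) (p j * a) * q i =
      (if i = j then p j * a else 0) + p j * (p i * ad (q i) a - ad (p i) a * q i)" for i
    by (auto simp: ad_q_p_mult ad_p_p_mult algebra_simps) (simp_all add: p_commute[of j] flip: mult.assoc)
  then show ?thesis by (simp add: euler_def sum.distrib sum_distrib_left)
qed

text \<open>A \<open>q\<close> attached on the left violates the normal order, which costs twice a
  commutator. That commutator has lower filtration degree, so the correction does no harm.\<close>

lemma euler_q: "euler (q j * a) = q j * a + q j * euler a - (ad (q j) a + ad (q j) a)"
proof -
  have qp': "p i * q j = q j * p i - (if j = i then 1 else 0)" for i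
    using qp[of j i] by (simp add: ad_def algebra_simps split: if_splits)
  have "p i * ad (q i) (q j * a) - ad (p i) (q j * a) * q i =
      (if i = j then a * q j - ad (q j) a else 0) + q j * (p i * ad (q i) a - ad (p i) a * q i)" for i
  proof -
    have "p i * (q j * ad (q i) a) = q j * (p i * ad (q i) a) - (if j = i then ad (q i) a else 0)"
      by (simp add: qp' left_diff_distrib flip: mult.assoc)
    then show ?thesis by (auto simp: ad_q_q_mult ad_p_q_mult algebra_simps)
  qed
  then have "euler (q j * a) = a * q j - ad (q j) a + q j * euler a"
    by (simp add: euler_def sum.distrib sum_distrib_left)
  also have "a * q j = q j * a - ad (q j) a" by (simp add: ad_def)
  finally show ?thesis by simp
qed

end

text \<open>The graph of the homomorphism between the algebras generated by two systems of Weyl generators,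
  with the filtration by word length.\<close>

inductive weyl_rel :: "('k \<Rightarrow> 'a) \<Rightarrow> ('n \<Rightarrow> 'a) \<Rightarrow> ('n \<Rightarrow> 'a) \<Rightarrow> ('k \<Rightarrow> 'b) \<Rightarrow> ('n \<Rightarrow> 'b) \<Rightarrow> ('n \<Rightarrow> 'b)
    \<Rightarrow> nat \<Rightarrow> 'a::ring_1 \<Rightarrow> 'b::ring_1 \<Rightarrow> bool"
  for \<kappa> p q \<kappa>' p' q' where
  scalar: "weyl_rel \<kappa> p q \<kappa>' p' q' n (\<kappa> c) (\<kappa>' c)"
| add: "weyl_rel \<kappa> p q \<kappa>' p' q' n a b \<Longrightarrow> weyl_rel \<kappa> p q \<kappa>' p' q' n a' b' \<Longrightarrow>
    weyl_rel \<kappa> p q \<kappa>' p' q' n (a + a') (b + b')"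
| p: "weyl_rel \<kappa> p q \<kappa>' p' q' n a b \<Longrightarrow> weyl_rel \<kappa> p q \<kappa>' p' q' (Suc n) (p i * a) (p' i * b)"
| q: "weyl_rel \<kappa> p q \<kappa>' p' q' n a b \<Longrightarrow> weyl_rel \<kappa> p q \<kappa>' p' q' (Suc n) (q i * a) (q' i * b)"

lemma weyl_rel_sym: "weyl_rel \<kappa> p q \<kappa>' p' q' n a b \<Longrightarrow> weyl_rel \<kappa>' p' q' \<kappa> p q n b a"
  by (induction rule: weyl_rel.induct) (auto intro: weyl_rel.intros)

lemma weyl_rel_Suc: "weyl_rel \<kappa> p q \<kappa>' p' q' n a b \<Longrightarrow> weyl_rel \<kappa> p q \<kappa>' p' q' (Suc n) a b"
  by (induction rule: weyl_rel.induct) (auto intro: weyl_rel.intros)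

lemma weyl_rel_mono: "weyl_rel \<kappa> p q \<kappa>' p' q' m a b \<Longrightarrow> m \<le> n \<Longrightarrow> weyl_rel \<kappa> p q \<kappa>' p' q' n a b"
  by (induction n rule: nat_induct) (auto simp: le_Suc_eq intro: weyl_rel_Suc)

locale weyl_system_pair = A: weyl_system \<kappa> p q + B: weyl_system \<kappa>' p' q'
  for \<kappa> :: "'k::field_char_0 \<Rightarrow> 'a::ring_1" and p q :: "'n::finite \<Rightarrow> 'a"
    and \<kappa>' :: "'k \<Rightarrow> 'b::ring_1" and p' q' :: "'n \<Rightarrow> 'b"
begin

interpretation \<kappa>: unital_ring_hom \<kappa> by (rule A.scalar_hom)
interpretation \<kappa>': unital_ring_hom \<kappa>' by (rule B.scalar_hom)

abbreviation "rel \<equiv> weyl_rel \<kappa> p q \<kappa>' p' q'"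

text \<open>Commutators with generators lower the degree; the case 0 stands in for degree -1, where
  only the zero pair lives.\<close>

definition rel_below :: "nat \<Rightarrow> 'a \<Rightarrow> 'b \<Rightarrow> bool" where
  "rel_below n a b \<longleftrightarrow> (case n of 0 \<Rightarrow> a = 0 \<and> b = 0 | Suc m \<Rightarrow> rel m a b)"

lemma rel_0: "rel n 0 0"
  using weyl_rel.scalar[of \<kappa> p q \<kappa>' p' q' n 0] by (simp add: \<kappa>.hom_0 \<kappa>'.hom_0)

lemma rel_scale: "rel n a b \<Longrightarrow> rel n (\<kappa> c * a) (\<kappa>' c * b)"
proof (induction rule: weyl_rel.induct)
  case (scalar n d)
  show ?case using weyl_rel.scalar[of \<kappa> p q \<kappa>' p' q' n "c * d"] by (simp add: \<kappa>.hom_mult \<kappa>'.hom_mult)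
next
  case (p n a b i)
  have "\<kappa> c * (p i * a) = p i * (\<kappa> c * a)" "\<kappa>' c * (p' i * b) = p' i * (\<kappa>' c * b)"
    by (metis A.scalar_central B.scalar_central mult.assoc)+
  then show ?case using p weyl_rel.p by metis
next
  case (q n a b i)
  have "\<kappa> c * (q i * a) = q i * (\<kappa> c * a)" "\<kappa>' c * (q' i * b) = q' i * (\<kappa>' c * b)"
    by (metis A.scalar_central B.scalar_central mult.assoc)+
  then show ?case using q weyl_rel.q by metis
qed (auto simp: distrib_left intro: weyl_rel.intros)

lemma rel_uminus: "rel n a b \<Longrightarrow> rel n (- a) (- b)"
  using rel_scale[of n a b "-1"] by (simp add: \<kappa>.hom_uminus \<kappa>'.hom_uminus \<kappa>.hom_1 \<kappa>'.hom_1)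

lemma rel_mult: "rel m a b \<Longrightarrow> rel n a' b' \<Longrightarrow> rel (m + n) (a * a') (b * b')"
proof (induction rule: weyl_rel.induct)
  case (scalar m c)
  then show ?case using weyl_rel_mono[OF rel_scale, of n a' b' "m + n" c] by simp
next
  case (add m a b a2 b2)
  then show ?case by (auto simp: distrib_right intro: weyl_rel.intros)
qed (auto simp: mult.assoc intro: weyl_rel.intros)

lemma rel_below_rel: "rel_below n a b \<Longrightarrow> rel n a b"
  by (cases n) (auto simp: rel_below_def rel_0 weyl_rel_Suc)

lemma rel_below_0: "rel_below n 0 0"
  by (cases n) (auto simp: rel_below_def rel_0)

lemma rel_below_add: "rel_below n a b \<Longrightarrow> rel_below n a' b' \<Longrightarrow> rel_below n (a + a') (b + b')"
  by (cases n) (auto simp: rel_below_def intro: weyl_rel.add)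

lemma rel_below_uminus: "rel_below n a b \<Longrightarrow> rel_below n (- a) (- b)"
  by (cases n) (auto simp: rel_below_def intro: rel_uminus)

lemma rel_below_Suc: "rel n a b \<Longrightarrow> rel_below (Suc n) a b"
  by (simp add: rel_below_def)

lemma rel_below_p: "rel_below n a b \<Longrightarrow> rel_below (Suc n) (p i * a) (p' i * b)"
  by (cases n) (auto simp: rel_below_def rel_0 intro: weyl_rel.p)

lemma rel_below_q: "rel_below n a b \<Longrightarrow> rel_below (Suc n) (q i * a) (q' i * b)"
  by (cases n) (auto simp: rel_below_def rel_0 intro: weyl_rel.q)

lemma rel_below_ad_q: "rel n a b \<Longrightarrow> rel_below n (ad (q i) a) (ad (q' i) b)"
  by (induction rule: weyl_rel.induct)
    (auto simp: A.ad_scalar B.ad_scalar ad.D_add A.ad_q_p_mult B.ad_q_p_mult A.ad_q_q_mult B.ad_q_q_mult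
      intro: rel_below_0 rel_below_add rel_below_p rel_below_q rel_below_Suc)

lemma rel_below_ad_p: "rel n a b \<Longrightarrow> rel_below n (ad (p i) a) (ad (p' i) b)"
proof (induction rule: weyl_rel.induct)
  case (q n a b j)
  then have "rel_below (Suc n) (q j * ad (p i) a + - a) (q' j * ad (p' i) b + - b)"
    by (intro rel_below_add rel_below_q rel_below_uminus rel_below_Suc)
  then show ?case using q by (auto simp: A.ad_p_q_mult B.ad_p_q_mult intro: rel_below_q)
qed (auto simp: A.ad_scalar B.ad_scalar ad.D_add A.ad_p_p_mult B.ad_p_p_mult
      intro: rel_below_0 rel_below_add rel_below_p)

text \<open>The lower-order remainders on the two sides come from the same words, so they remain
  related, one degree lower. This is the descent step for \<open>rel_0_left\<close>.\<close>

lemma rel_below_euler: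
  "rel n a b \<Longrightarrow> rel_below n (A.euler a - of_nat n * a) (B.euler b - of_nat n * b)"
proof (induction rule: weyl_rel.induct)
  case (scalar n c)
  define d where "d = - of_nat n * c"
  have "A.euler (\<kappa> c) - of_nat n * \<kappa> c = \<kappa> d" "B.euler (\<kappa>' c) - of_nat n * \<kappa>' c = \<kappa>' d"
    by (simp_all add: d_def A.euler_scalar B.euler_scalar \<kappa>.hom_mult \<kappa>.hom_uminus \<kappa>.hom_of_nat
        \<kappa>'.hom_mult \<kappa>'.hom_uminus \<kappa>'.hom_of_nat)
  moreover have "rel_below n (\<kappa> d) (\<kappa>' d)"
    by (cases n) (simp_all add: rel_below_def weyl_rel.scalar d_def \<kappa>.hom_0 \<kappa>'.hom_0)
  ultimately show ?case by simp
next
  case (add n a b a' b')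
  then show ?case
    using rel_below_add[OF add.IH] by (simp add: A.euler_add B.euler_add algebra_simps)
next
  case (p n a b i)
  have "A.euler (p i * a) - of_nat (Suc n) * (p i * a) = p i * (A.euler a - of_nat n * a)"
    "B.euler (p' i * b) - of_nat (Suc n) * (p' i * b) = p' i * (B.euler b - of_nat n * b)"
    using of_nat_left_commute[of n "p i" a] of_nat_left_commute[of n "p' i" b]
    by (simp_all add: A.euler_p B.euler_p distrib_right right_diff_distrib)
  then show ?case using rel_below_p[OF p.IH] by simp
next
  case (q n a b i)
  have "A.euler (q i * a) - of_nat (Suc n) * (q i * a) =
      q i * (A.euler a - of_nat n * a) + - (ad (q i) a + ad (q i) a)"
    "B.euler (q' i * b) - of_nat (Suc n) * (q' i * b) =
      q' i * (B.euler b - of_nat n * b) + - (ad (q' i) b + ad (q' i) b)"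
    using of_nat_left_commute[of n "q i" a] of_nat_left_commute[of n "q' i" b]
    by (simp_all add: A.euler_q B.euler_q distrib_right right_diff_distrib)
  moreover have "rel_below (Suc n) (- (ad (q i) a + ad (q i) a)) (- (ad (q' i) b + ad (q' i) b))"
    using rel_below_ad_q[OF q.hyps]
    by (intro rel_below_uminus rel_below_add rel_below_Suc rel_below_rel)
  ultimately show ?case using rel_below_add[OF rel_below_q[OF q.IH]] by presburger
qed

lemma rel_0_scalar: "rel n a b \<Longrightarrow> n = 0 \<Longrightarrow> \<exists>c. a = \<kappa> c \<and> b = \<kappa>' c"
  by (induction rule: weyl_rel.induct) (auto simp flip: \<kappa>.hom_add \<kappa>'.hom_add)

text \<open>The Euler operator acts on elements of filtration degree \<open>n\<close> as \<open>n\<close> modulo lower degree,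
  so an element all of whose commutators with the generators vanish drops to lower degree.\<close>

lemma rel_0_left: "rel n 0 b \<Longrightarrow> b = 0"
proof (induction n arbitrary: b)
  case 0
  then show ?case using rel_0_scalar A.scalar_eq_0_iff \<kappa>'.hom_0 by metis
next
  case (Suc m)
  have "ad (q' i) b = 0" for i
    using rel_below_ad_q[OF Suc.prems, of i] Suc.IH by (simp add: rel_below_def ad.D_0)
  moreover have "ad (p' i) b = 0" for i
    using rel_below_ad_p[OF Suc.prems, of i] Suc.IH by (simp add: rel_below_def ad.D_0)
  ultimately have "B.euler b = 0" by (simp add: B.euler_def)
  moreover have "A.euler 0 = 0" by (simp add: A.euler_def ad.D_0)
  \<comment> \<open>Both Euler operators vanish here, so only \<open>- (m + 1) * b\<close> is left,
    now in degree \<open>m\<close>; characteristic zero then removes the factor.\<close>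
  ultimately have "rel m 0 (- (of_nat (Suc m) * b))"
    using rel_below_euler[OF Suc.prems] by (simp add: rel_below_def del: of_nat_Suc)
  then have 0: "of_nat (Suc m) * b = 0" using Suc.IH by (metis neg_equal_0_iff_equal)
  have "b = \<kappa>' (1 / of_nat (Suc m)) * (\<kappa>' (of_nat (Suc m)) * b)"
    by (simp flip: mult.assoc \<kappa>'.hom_mult del: of_nat_Suc add: \<kappa>'.hom_1)
  then show ?case by (simp add: \<kappa>'.hom_of_nat 0 del: of_nat_Suc)
qed

lemma rel_unique:
  assumes "rel m a b" "rel n a b'" shows "b = b'"
proof -
  have "rel (max m n) a b" "rel (max m n) (- a) (- b')"
    using assms by (auto intro: weyl_rel_mono rel_uminus)
  then have "rel (max m n) (a + - a) (b + - b')" by (rule weyl_rel.add)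
  then show ?thesis using rel_0_left by fastforce
qed

end

lemma unital_ring_hom_wc: "unital_ring_hom wc"
  by unfold_locales (auto simp: Const_add Const_mult wm_add wm_mult)

lemma wm_commute: "wm p * wm q = wm q * wm p"
  by (simp flip: wm_mult add: mult.commute)

interpretation weyl: weyl_system wc wv wd
  by (rule weyl_system.intro)
    (auto simp: unital_ring_hom_wc wc_central wm_commute wd_commute ad_wd_wm pd_Var wm.hom_0)

text \<open>Read off from the graph between the standard generators and the target system. If the
  target satisfies the Weyl relations, the graph is total because the generators generate, and
  single-valued by \<open>rel_unique\<close>.\<close>

definition weyl_lift :: "('k \<Rightarrow> 'b) \<Rightarrow> ('n \<Rightarrow> 'b) \<Rightarrow> ('n \<Rightarrow> 'b) \<Rightarrow> ('n::finite, 'k::field_char_0) weyl \<Rightarrow> 'b::ring_1" where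
  "weyl_lift \<kappa> p q a = (THE b. \<exists>n. weyl_rel wc wv wd \<kappa> p q n a b)"

context weyl_system
begin

interpretation weyl_system_pair wc wv wd \<kappa> p q ..
interpretation \<kappa>: unital_ring_hom \<kappa> by (rule scalar_hom)

lemma weyl_rel_1: "weyl_rel wc wv wd \<kappa> p q n 1 1"
  using weyl_rel.scalar[of wc wv wd \<kappa> p q n 1] by (simp add: \<kappa>.hom_1)

lemma weyl_rel_total: "\<exists>n b. weyl_rel wc wv wd \<kappa> p q n a b"
proof (induction a rule: weyl_induct)
  case (var i)
  show ?case using weyl_rel.p[OF weyl_rel_1, where i = i] by auto
next
  case (pd i)
  show ?case using weyl_rel.q[OF weyl_rel_1, where i = i] by auto
next
  case (add a b)
  then obtain m n c d where "weyl_rel wc wv wd \<kappa> p q m a c" "weyl_rel wc wv wd \<kappa> p q n b d" by blast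
  then have "weyl_rel wc wv wd \<kappa> p q (max m n) (a + b) (c + d)"
    by (intro weyl_rel.add) (auto intro: weyl_rel_mono)
  then show ?case by blast
next
  case (mult a b)
  then show ?case using rel_mult by blast
next
  case (scalar c)
  show ?case by (intro exI) (rule weyl_rel.scalar)
qed

lemma weyl_lift_rel: "weyl_rel wc wv wd \<kappa> p q n a b \<Longrightarrow> weyl_lift \<kappa> p q a = b"
  unfolding weyl_lift_def by (rule the_equality) (auto intro: rel_unique)

lemma weyl_lift_gens:
  "weyl_lift \<kappa> p q (wc c) = \<kappa> c" "weyl_lift \<kappa> p q (wv i) = p i" "weyl_lift \<kappa> p q (wd i) = q i"
  using weyl_lift_rel[OF weyl_rel.scalar] weyl_lift_rel[OF weyl_rel.p[OF weyl_rel_1, where i = i]]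
    weyl_lift_rel[OF weyl_rel.q[OF weyl_rel_1, where i = i]] by auto

lemma weyl_lift_hom: "unital_ring_hom (weyl_lift \<kappa> p q)"
proof
  fix a b
  obtain m n c d where *: "weyl_rel wc wv wd \<kappa> p q m a c" "weyl_rel wc wv wd \<kappa> p q n b d"
    using weyl_rel_total by meson
  then have "weyl_rel wc wv wd \<kappa> p q (max m n) (a + b) (c + d)"
    by (intro weyl_rel.add) (auto intro: weyl_rel_mono)
  then show "weyl_lift \<kappa> p q (a + b) = weyl_lift \<kappa> p q a + weyl_lift \<kappa> p q b"
    using * by (simp add: weyl_lift_rel)
  show "weyl_lift \<kappa> p q (a * b) = weyl_lift \<kappa> p q a * weyl_lift \<kappa> p q b"
    using * rel_mult[OF *] by (simp add: weyl_lift_rel)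
qed (rule weyl_lift_rel[OF weyl_rel_1])

text \<open>The graph is symmetric in its two systems, so a vanishing component forces the other to
  vanish in either direction. This takes the place of the simplicity of the Weyl algebra.\<close>

lemma weyl_lift_inj: "inj (weyl_lift \<kappa> p q)"
proof -
  interpret swap: weyl_system_pair \<kappa> p q wc wv wd ..
  interpret unital_ring_hom "weyl_lift \<kappa> p q" by (rule weyl_lift_hom)
  have 0: "a = 0" if "weyl_lift \<kappa> p q a = 0" for a
    using weyl_rel_total[of a] that swap.rel_0_left weyl_rel_sym weyl_lift_rel by metis
  show ?thesis
  proof (rule injI)
    fix a b assume "weyl_lift \<kappa> p q a = weyl_lift \<kappa> p q b"
    then show "a = b" using 0[of "a - b"] by (simp add: hom_diff)
  qed
qed

end

section \<open>The Ore condition for the Weyl algebra\<close>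

lemma weyl_system_fourier: "weyl_system wc wd (\<lambda>i. - wv i)"
  by (rule weyl_system.intro)
    (auto simp: unital_ring_hom_wc wc_central wm_commute wd_commute ad_uminus[of "- wv _"] ad.D_uminus
      ad_wd_wm pd_Var wm.hom_0)

text \<open>Turns a polynomial in the variables into the same polynomial in the derivatives; thus
  \<open>fourier (wm (single \<beta> 1))\<close> is the derivative monomial with exponent
  \<beta>.\<close>

definition fourier :: "('n::finite, 'k::field_char_0) weyl \<Rightarrow> ('n, 'k) weyl" where
  "fourier = weyl_lift wc wd (\<lambda>i. - wv i)"

interpretation fourier: unital_ring_hom fourier
  unfolding fourier_def by (rule weyl_system.weyl_lift_hom[OF weyl_system_fourier])

lemma fourier_gens: "fourier (wc c) = wc c" "fourier (wv i) = wd i"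
  unfolding fourier_def by (rule weyl_system.weyl_lift_gens[OF weyl_system_fourier])+

interpretation weyl_vs: vector_space "\<lambda>c a. wc c * a"
  by unfold_locales (auto simp: distrib_left distrib_right Const_add Const_mult wm_add wm_mult mult.assoc)

text \<open>The two exponents are bounded separately, so that a box counts them; the crude bound is
  still polynomial in \<open>n\<close>, which is what the growth argument asks for.\<close>

definition normal_monomials :: "nat \<Rightarrow> ('n::finite, 'k::field_char_0) weyl set" where
  "normal_monomials n = (\<lambda>(\<alpha>, \<beta>). wm (single \<alpha> 1) * fourier (wm (single \<beta> 1))) `
     ({\<alpha>. mdeg \<alpha> \<le> n} \<times> {\<beta>. mdeg \<beta> \<le> n})"

lemma finite_card_mdeg_le:
  "finite {\<alpha>::'n::finite \<Rightarrow>\<^sub>0 nat. mdeg \<alpha> \<le> n} \<and>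
   card {\<alpha>::'n \<Rightarrow>\<^sub>0 nat. mdeg \<alpha> \<le> n} \<le> (n + 1) ^ CARD('n)"
proof -
  let ?A = "{\<alpha>::'n \<Rightarrow>\<^sub>0 nat. mdeg \<alpha> \<le> n}" and ?B = "PiE UNIV (\<lambda>_::'n. {..n})"
  have "inj_on lookup ?A" by (simp add: inj_on_def lookup_inject)
  moreover have "lookup ` ?A \<subseteq> ?B"
  proof -
    have "lookup \<alpha> i \<le> mdeg \<alpha>" for \<alpha> :: "'n \<Rightarrow>\<^sub>0 nat" and i
      unfolding mdeg_def by (rule member_le_sum) auto
    then show ?thesis by (auto intro: order_trans)
  qed
  moreover have "finite ?B" "card ?B = (n + 1) ^ CARD('n)" by (auto simp: card_PiE finite_PiE)
  ultimately show ?thesis by (metis card_inj_on_le inj_on_finite)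
qed

lemma normal_monomials_bound:
  "finite (normal_monomials n :: ('n::finite, 'k::field_char_0) weyl set) \<and>
   card (normal_monomials n :: ('n, 'k) weyl set) \<le> (n + 1) ^ (2 * CARD('n))"
proof -
  let ?A = "{\<alpha>::'n \<Rightarrow>\<^sub>0 nat. mdeg \<alpha> \<le> n}"
  have "card (normal_monomials n :: ('n, 'k) weyl set) \<le> card (?A \<times> ?A)"
    unfolding normal_monomials_def using finite_card_mdeg_le by (intro card_image_le) blast
  also have "\<dots> \<le> (n + 1) ^ CARD('n) * (n + 1) ^ CARD('n)"
    using finite_card_mdeg_le[of n] by (auto simp: card_cartesian_product intro: mult_le_mono)
  finally show ?thesis using finite_card_mdeg_le
    by (auto simp: normal_monomials_def power_add mult_2)
qed

lemma normal_monomials_base: "mdeg \<alpha> \<le> n \<Longrightarrow> mdeg \<beta> \<le> n \<Longrightarrow>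
  wm (single \<alpha> c) * fourier (wm (single \<beta> d)) \<in> weyl_vs.span (normal_monomials n)"
proof -
  assume le: "mdeg \<alpha> \<le> n" "mdeg \<beta> \<le> n"
  have c: "single \<alpha> c = Const c * single \<alpha> 1" for \<alpha> c
    by (simp add: Const_def mult_single)
  have "wm (single \<alpha> 1) * fourier (wm (single \<beta> 1)) \<in> normal_monomials n"
    using le by (force simp: normal_monomials_def)
  then have "wc (c * d) * (wm (single \<alpha> 1) * fourier (wm (single \<beta> 1)))
      \<in> weyl_vs.span (normal_monomials n)"
    by (intro weyl_vs.span_scale weyl_vs.span_base)
  also have "wc (c * d) * (wm (single \<alpha> 1) * fourier (wm (single \<beta> 1))) =
      wm (single \<alpha> c) * fourier (wm (single \<beta> d))"
    unfolding c[of \<alpha> c] c[of \<beta> d] wm_mult Const_mult fourier.hom_mult fourier_gens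
    using wc_central[of d "wm (single \<alpha> 1)"] by (simp only: mult.assoc) (simp only: mult.assoc[symmetric])
  finally show ?thesis .
qed

lemma span_normal_monomials_mult:
  assumes gen: "\<And>\<alpha> \<beta>. mdeg \<alpha> \<le> n \<Longrightarrow> mdeg \<beta> \<le> n \<Longrightarrow>
    g * (wm (single \<alpha> 1) * fourier (wm (single \<beta> 1)))
      \<in> weyl_vs.span (normal_monomials (Suc n))"
    and x: "x \<in> weyl_vs.span (normal_monomials n)"
  shows "g * x \<in> weyl_vs.span (normal_monomials (Suc n))"
  using x
proof (induction rule: weyl_vs.span_induct_alt)
  case base
  then show ?case by (simp add: weyl_vs.span_zero)
next
  case (step c y z)
  obtain \<alpha> \<beta> where "mdeg \<alpha> \<le> n" "mdeg \<beta> \<le> n"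
    "y = wm (single \<alpha> 1) * fourier (wm (single \<beta> 1))"
    using step(1) by (auto simp: normal_monomials_def)
  then have "g * y \<in> weyl_vs.span (normal_monomials (Suc n))" using gen by simp
  then have "wc c * (g * y) + g * z \<in> weyl_vs.span (normal_monomials (Suc n))"
    using step(2) by (intro weyl_vs.span_add weyl_vs.span_scale)
  also have "wc c * (g * y) + g * z = g * (wc c * y + z)"
    by (simp only: distrib_left mult.assoc[symmetric] wc_central[of c g])
  finally show ?case .
qed

text \<open>The graph of the standard system with itself is the diagonal, so its degree index is the
  filtration of the Weyl algebra by word length.\<close>

abbreviation weyl_le :: "nat \<Rightarrow> ('n::finite, 'k::field_char_0) weyl \<Rightarrow> bool" where
  "weyl_le n a \<equiv> weyl_rel wc wv wd wc wv wd n a a"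

interpretation weyl_diag: weyl_system_pair wc wv wd wc wv wd ..

lemma weyl_rel_diag: "weyl_rel wc wv wd wc wv wd n a b \<Longrightarrow> a = b"
  by (induction rule: weyl_rel.induct) auto

lemma weyl_le_exists: "\<exists>n. weyl_le n a"
  using weyl.weyl_rel_total weyl_rel_diag by metis

lemma weyl_le_span:
  fixes a b :: "('n::finite, 'k::field_char_0) weyl"
  shows "weyl_rel wc wv wd wc wv wd n a b \<Longrightarrow> a \<in> weyl_vs.span (normal_monomials n)"
proof (induction rule: weyl_rel.induct)
  case (scalar n c)
  show ?case using normal_monomials_base[of 0 n 0 c 1] by (simp add: Const_def fourier.hom_1)
next
  case (add n a b a' b')
  then show ?case by (intro weyl_vs.span_add)
next
  case (p n a b i)
  show ?case
  proof (rule span_normal_monomials_mult[OF _ p.IH])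
    fix \<alpha> \<beta> :: "'n \<Rightarrow>\<^sub>0 nat" assume "mdeg \<alpha> \<le> n" "mdeg \<beta> \<le> n"
    then show "wv i * (wm (single \<alpha> 1) * fourier (wm (single \<beta> 1)))
      \<in> weyl_vs.span (normal_monomials (Suc n))"
      using normal_monomials_base[of "single i 1 + \<alpha>" "Suc n" \<beta> 1 1]
      by (simp add: mdeg_add Var_mult_single flip: wm_mult mult.assoc)
  qed
next
  case (q n a b i)
  show ?case
  proof (rule span_normal_monomials_mult[OF _ q.IH])
    fix \<alpha> \<beta> :: "'n \<Rightarrow>\<^sub>0 nat" assume le: "mdeg \<alpha> \<le> n" "mdeg \<beta> \<le> n"
    let ?a = "single \<alpha> (1 :: 'k)" and ?b = "single \<beta> (1 :: 'k)"
    have "fourier (wm (single (single i 1 + \<beta>) (1 :: 'k))) = wd i * fourier (wm ?b)"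
      by (simp only: Var_mult_single[symmetric] wm_mult fourier.hom_mult fourier_gens)
    \<comment> \<open>Restoring the normal order: the derivative passes the polynomial at the cost
      of a term whose exponent has not grown.\<close>
    moreover have "wd i * wm ?a = wm ?a * wd i + wm (pd i ?a)" using wd_wm[of i ?a] by (simp add: algebra_simps)
    ultimately have "wd i * (wm ?a * fourier (wm ?b)) =
        wm ?a * fourier (wm (single (single i 1 + \<beta>) (1 :: 'k))) + wm (pd i ?a) * fourier (wm ?b)"
      by (simp only: distrib_right mult.assoc[symmetric])
    moreover have "wm ?a * fourier (wm (single (single i 1 + \<beta>) (1 :: 'k))) \<in> weyl_vs.span (normal_monomials (Suc n))"
      using le by (intro normal_monomials_base) (auto simp: mdeg_add)
    moreover have "mdeg (\<alpha> - single i 1) \<le> mdeg \<alpha>"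
      unfolding mdeg_def by (intro sum_mono) (simp add: lookup_minus)
    then have "wm (pd i ?a) * fourier (wm ?b) \<in> weyl_vs.span (normal_monomials (Suc n))"
      unfolding pd_single using le by (intro normal_monomials_base) auto
    ultimately show "wd i * (wm ?a * fourier (wm ?b)) \<in> weyl_vs.span (normal_monomials (Suc n))"
      using weyl_vs.span_add by metis
  qed
qed

lemma polynomial_less_exponential: "\<exists>j::nat. (m * j + 1) ^ K < 2 ^ j"
proof -
  have quad: "3 * s * s < 4 ^ s" if "s \<ge> 1" for s :: nat
    using that
  proof (induction s rule: nat_induct_at_least)
    case (Suc s)
    have "3 * Suc s * Suc s \<le> 3 * (2 * s) * (2 * s)" using Suc by (intro mult_le_mono) auto
    also have "\<dots> < 4 * 4 ^ s" using Suc by simp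
    finally show ?case by simp
  qed auto
  \<comment> \<open>The witness will be \<open>j = 4 ^ s\<close>. Then
    \<open>m * j + 1 \<le> 2 ^ (m + 2 * s)\<close>, and it remains to compare exponents:
    \<open>(m + 2 * s) * K \<le> 3 * s * s < 4 ^ s = j\<close>.\<close>
  define s where "s = m + K + 1"
  have "m + 1 \<le> 2 ^ m" by (induction m) auto
  have "m * 2 ^ (2 * s) + 1 \<le> (m + 1) * 2 ^ (2 * s)" by (simp add: add_mult_distrib)
  also have "\<dots> \<le> 2 ^ m * 2 ^ (2 * s)" using \<open>m + 1 \<le> 2 ^ m\<close> by (intro mult_le_mono) auto
  also have "\<dots> = 2 ^ (m + 2 * s)" by (simp add: power_add)
  finally have "m * 2 ^ (2 * s) + 1 \<le> 2 ^ (m + 2 * s)" .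
  then have 1: "(m * 2 ^ (2 * s) + 1) ^ K \<le> 2 ^ ((m + 2 * s) * K)"
    by (metis power_mono power_mult zero_le)
  have "(m + 2 * s) * K \<le> 3 * s * s" by (intro mult_le_mono) (auto simp: s_def)
  moreover have "3 * s * s < 4 ^ s" by (rule quad) (simp add: s_def)
  ultimately have "(m + 2 * s) * K < 4 ^ s" by (rule le_less_trans)
  then have "(m + 2 * s) * K < 2 ^ (2 * s)" by (simp add: power_mult)
  then have "(2::nat) ^ ((m + 2 * s) * K) < 2 ^ (2 ^ (2 * s))" by (intro power_strict_increasing) auto
  with 1 show ?thesis by (intro exI[of _ "2 ^ (2 * s)"]) (rule le_less_trans)
qed

text \<open>If \<open>a A\<close> and \<open>b A\<close> meet only in zero, then \<open>a B \<union> b B\<close> is independent for every independent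
  set \<open>B\<close>, so the filtration of the Weyl algebra grows exponentially, against the polynomial bound
  given by the normally ordered monomials.\<close>

lemma weyl_right_ore:
  fixes a b :: "('n::finite, 'k::field_char_0) weyl"
  assumes b: "b \<noteq> 0"
  shows "\<exists>u v. u \<noteq> 0 \<and> a * u = b * v"
proof (rule ccontr)
  assume neg: "\<not> ?thesis"
  have a: "a \<noteq> 0"
  proof
    assume "a = 0"
    then have "a * 1 = b * 0" by simp
    then show False using neg zero_neq_one by metis
  qed
  have disj: "u = 0 \<and> v = 0" if "a * u = b * v" for u v
  proof -
    have "u = 0" using neg that by blast
    then show ?thesis using that b by simp
  qed
  obtain m1 where m1: "weyl_le m1 a" using weyl_le_exists[of a] by blast
  obtain m2 where m2: "weyl_le m2 b" using weyl_le_exists[of b] by blast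
  define m where "m = max m1 m2"
  have m: "weyl_le m a" "weyl_le m b" using m1 m2 by (auto simp: m_def intro: weyl_rel_mono)
  \<comment> \<open>The set produced for \<open>j\<close> consists of all words of length
    \<open>j\<close> in \<open>a\<close> and \<open>b\<close>.\<close>
  have "\<exists>B :: ('n, 'k) weyl set. finite B \<and> weyl_vs.independent B \<and> card B = 2 ^ j \<and> (\<forall>x\<in>B. weyl_le (m * j) x)" for j
  proof (induction j)
    case 0
    have "weyl_vs.independent {1 :: ('n, 'k) weyl}" using weyl_vs.dependent_single[of 1] by simp
    moreover have "weyl_le 0 (1 :: ('n, 'k) weyl)" by (rule weyl.weyl_rel_1)
    ultimately show ?case by (intro exI[of _ "{1}"]) auto
  next
    case (Suc j)
    then obtain B :: "('n, 'k) weyl set" where B: "finite B" "weyl_vs.independent B" "card B = 2 ^ j" "\<forall>x\<in>B. weyl_le (m * j) x"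
      by blast
    define f where "f = (\<lambda>x. a * x)"
    define g where "g = (\<lambda>x. b * x)"
    have inj: "inj_on f B" "inj_on g B" using a b by (auto simp: inj_on_def f_def g_def)
    have "0 \<notin> B" using B(2) weyl_vs.dependent_zero by blast
    then have dis: "f ` B \<inter> g ` B = {}" using disj by (auto simp: f_def g_def)
    have "weyl_vs.independent (f ` B \<union> g ` B)"
    proof (rule weyl_vs.independent_if_scalars_zero)
      fix h x assume sum: "(\<Sum>x\<in>f ` B \<union> g ` B. wc (h x) * x) = 0" and x: "x \<in> f ` B \<union> g ` B"
      have "(\<Sum>x\<in>f ` B \<union> g ` B. wc (h x) * x) = (\<Sum>x\<in>f ` B. wc (h x) * x) + (\<Sum>x\<in>g ` B. wc (h x) * x)"
        using B(1) dis by (intro sum.union_disjoint) auto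
      also have "\<dots> = (\<Sum>x\<in>B. wc (h (f x)) * f x) + (\<Sum>x\<in>B. wc (h (g x)) * g x)"
        using inj by (simp add: sum.reindex)
      also have "\<dots> = a * (\<Sum>x\<in>B. wc (h (f x)) * x) + b * (\<Sum>x\<in>B. wc (h (g x)) * x)"
        unfolding sum_distrib_left f_def g_def
        by (intro arg_cong2[where f = "(+)"] sum.cong refl) (metis mult.assoc wc_central)+
      finally have "a * (\<Sum>x\<in>B. wc (h (f x)) * x) = b * - (\<Sum>x\<in>B. wc (h (g x)) * x)"
        using sum by (simp add: eq_neg_iff_add_eq_0)
      then have "(\<Sum>x\<in>B. wc (h (f x)) * x) = 0" "(\<Sum>x\<in>B. wc (h (g x)) * x) = 0"
        using disj by fastforce+
      then have "\<forall>x\<in>B. h (f x) = 0" "\<forall>x\<in>B. h (g x) = 0"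
        using weyl_vs.independentD[OF B(2,1) subset_refl, of "\<lambda>x. h (f x)"]
          weyl_vs.independentD[OF B(2,1) subset_refl, of "\<lambda>x. h (g x)"] by blast+
      then show "h x = 0" using x by blast
    qed (use B in auto)
    moreover have "card (f ` B \<union> g ` B) = 2 ^ Suc j"
      using B(1,3) dis inj by (simp add: card_Un_disjoint card_image)
    moreover have "\<forall>x\<in>f ` B \<union> g ` B. weyl_le (m * Suc j) x"
    proof
      fix x assume "x \<in> f ` B \<union> g ` B"
      then obtain y where y: "y \<in> B" and "x = a * y \<or> x = b * y" by (auto simp: f_def g_def)
      then show "weyl_le (m * Suc j) x"
        using weyl_diag.rel_mult[OF m(1) bspec[OF B(4) y]] weyl_diag.rel_mult[OF m(2) bspec[OF B(4) y]]
        unfolding mult_Suc_right by metis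
    qed
    moreover have "finite (f ` B \<union> g ` B)" using B(1) by simp
    ultimately show ?case by metis
  qed
  moreover obtain j where j: "(m * j + 1) ^ (2 * CARD('n)) < 2 ^ j"
    using polynomial_less_exponential by blast
  ultimately obtain B :: "('n, 'k) weyl set" where B: "finite B" "weyl_vs.independent B" "card B = 2 ^ j"
    "\<forall>x\<in>B. weyl_le (m * j) x" by meson
  have "B \<subseteq> weyl_vs.span (normal_monomials (m * j))" using B(4) weyl_le_span by blast
  then have "card B \<le> card (normal_monomials (m * j) :: ('n, 'k) weyl set)"
    using weyl_vs.independent_span_bound[OF _ B(2)] normal_monomials_bound by blast
  then show False using B(3) j normal_monomials_bound[where 'n = 'n and 'k = 'k, of "m * j"] by linarith
qed

instance weyl :: (finite, field_char_0) ore_domain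
  by standard (rule weyl_right_ore)

section \<open>Linear substitutions and graded pieces\<close>

text \<open>Artin's argument for independence of characters. The coefficients stand on the left and
  may fail to commute with the values, because they are later taken from the Weyl algebra;
  \<open>mul\<close> will be multiplication of polynomials or addition of exponents.\<close>

lemma dedekind_independence:
  fixes ch :: "'i \<Rightarrow> 'm \<Rightarrow> 'r::ring_1" and mul :: "'m \<Rightarrow> 'm \<Rightarrow> 'm" and u :: 'm
  assumes nzd: "\<And>x y :: 'r. x * y = 0 \<Longrightarrow> x = 0 \<or> y = 0"
    and "finite I"
    and "\<And>i m m'. i \<in> I \<Longrightarrow> ch i (mul m m') = ch i m * ch i m'" "\<And>i. i \<in> I \<Longrightarrow> ch i u = 1"
    and "\<And>i j m m'. i \<in> I \<Longrightarrow> j \<in> I \<Longrightarrow> ch i m * ch j m' = ch j m' * ch i m"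
    and "\<And>i j. i \<in> I \<Longrightarrow> j \<in> I \<Longrightarrow> i \<noteq> j \<Longrightarrow> \<exists>m. ch i m \<noteq> ch j m"
    and "\<And>m. (\<Sum>i\<in>I. c i * ch i m) = 0"
  shows "\<forall>i\<in>I. c i = 0"
  using assms(2-)
proof (induction I arbitrary: c rule: finite_induct)
  case (insert j I)
  have c: "c i = 0" if i: "i \<in> I" for i
  proof -
    obtain m' where m': "ch i m' \<noteq> ch j m'"
      using insert.prems(4)[of i j] i insert.hyps(2) by blast
    \<comment> \<open>The relation at \<open>mul m' m\<close> minus the relation at \<open>m\<close>
      times \<open>ch j m'\<close> loses the summand of \<open>j\<close>.\<close>
    have "\<forall>i\<in>I. c i * (ch i m' - ch j m') = 0"
    proof (rule insert.IH)
      fix m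
      have "(\<Sum>i\<in>I. c i * (ch i m' - ch j m') * ch i m) =
          (\<Sum>i\<in>insert j I. c i * (ch i m' - ch j m') * ch i m)"
        using insert.hyps by simp
      also have "\<dots> = (\<Sum>i\<in>insert j I. c i * ch i (mul m' m) - c i * ch i m * ch j m')"
      proof (rule sum.cong)
        fix i assume i: "i \<in> insert j I"
        have "ch j m' * ch i m = ch i m * ch j m'" using insert.prems(3) i by blast
        then show "c i * (ch i m' - ch j m') * ch i m = c i * ch i (mul m' m) - c i * ch i m * ch j m'"
          using insert.prems(1)[OF i] by (simp add: left_diff_distrib right_diff_distrib mult.assoc)
      qed simp
      also have "\<dots> = 0"
        using insert.prems(5) by (simp only: sum_subtractf sum_distrib_right[symmetric]) simp
      finally show "(\<Sum>i\<in>I. c i * (ch i m' - ch j m') * ch i m) = 0" .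
    qed (use insert.prems in auto)
    then show ?thesis using i m' nzd by fastforce
  qed
  have "(\<Sum>i\<in>insert j I. c i * ch i u) = 0" by (rule insert.prems)
  then have "c j * ch j u = 0" using insert.hyps c by simp
  then show ?case using c insert.prems(2) by simp
qed simp

lemma mpoly_expand: "f = (\<Sum>m\<in>keys f. single m (lookup f m))"
proof (rule poly_mapping_eqI)
  fix m
  have "(\<Sum>x\<in>keys f. lookup f x when x = m) =
      (\<Sum>x\<in>keys f. if x = m then lookup f x else 0)"
    by (intro sum.cong) (auto simp: when_def)
  then show "lookup f m =
      lookup (\<Sum>m\<in>keys f. single m (lookup f m)) m"
    by (auto simp: lookup_sum lookup_single sum.delta in_keys_iff)
qed

lemma subst_poly_superset:
  assumes "finite A" "keys f \<subseteq> A"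
  shows "subst_poly s f = (\<Sum>m\<in>A. Const (lookup f m) * (\<Prod>i\<in>UNIV. s i ^ lookup m i))"
  unfolding subst_poly_def using assms by (intro sum.mono_neutral_left) (auto simp: in_keys_iff)

lemma subst_poly_add: "subst_poly s (f + g) = subst_poly s f + subst_poly s g"
proof -
  let ?A = "keys f \<union> keys g"
  have "finite ?A" "keys (f + g) \<subseteq> ?A" by (simp_all add: Poly_Mapping.keys_add)
  then show ?thesis
    by (simp add: subst_poly_superset[of ?A] lookup_add Const_add distrib_right sum.distrib)
qed

lemma subst_poly_single:
  "subst_poly s (single m c) = Const c * (\<Prod>i\<in>UNIV. s i ^ lookup m i)"
  by (subst subst_poly_superset[of "{m}"]) auto

lemma subst_poly_Const: "subst_poly s (Const c) = Const c"
  unfolding Const_def[of c] subst_poly_single by (simp add: Const_def)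

lemma subst_poly_Var_mult: "subst_poly s (Var i * f) = s i * subst_poly s f"
proof -
  have single: "subst_poly s (Var i * single m c) = s i * subst_poly s (single m c)" for m c
  proof -
    have "(\<Prod>j\<in>UNIV. s j ^ lookup (single i 1) j) =
        (\<Prod>j\<in>UNIV. if j = i then s j else 1)"
      by (intro prod.cong) (auto simp: lookup_single)
    then show ?thesis
      by (simp add: Var_mult_single subst_poly_single lookup_add power_add prod.distrib mult.left_commute)
  qed
  have "subst_poly s (Var i * (\<Sum>m\<in>A. single m (lookup f m))) =
      s i * subst_poly s (\<Sum>m\<in>A. single m (lookup f m))" for A
    by (induction A rule: infinite_finite_induct)
      (use subst_poly_Const[of s 0] in \<open>auto simp: distrib_left subst_poly_add single\<close>)
  then show ?thesis using mpoly_expand[of f] by metis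
qed

locale poly_endo =
  fixes \<sigma> :: "('n::finite, 'k::field_char_0) mpoly \<Rightarrow> ('n, 'k) mpoly"
  assumes endo_add: "\<sigma> (f + g) = \<sigma> f + \<sigma> g"
    and endo_mult: "\<sigma> (f * g) = \<sigma> f * \<sigma> g"
    and endo_Const: "\<sigma> (Const c) = Const c"
begin

sublocale unital_ring_hom \<sigma>
  using endo_Const[of 1] by unfold_locales (auto simp: endo_add endo_mult)

end

lemma poly_endo_eqI:
  assumes "poly_endo \<sigma>" "poly_endo \<tau>" "\<And>i. \<sigma> (Var i) = \<tau> (Var i)"
  shows "\<sigma> = \<tau>"
proof
  interpret \<sigma>: poly_endo \<sigma> by fact
  interpret \<tau>: poly_endo \<tau> by fact
  show "\<sigma> f = \<tau> f" for f
    by (induction f rule: mpoly_induct)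
      (auto simp: \<sigma>.endo_add \<tau>.endo_add \<sigma>.endo_mult \<tau>.endo_mult \<sigma>.endo_Const \<tau>.endo_Const assms(3))
qed

lemma poly_endo_comp: "poly_endo \<sigma> \<Longrightarrow> poly_endo \<tau> \<Longrightarrow> poly_endo (\<sigma> \<circ> \<tau>)"
  by (simp add: poly_endo_def)

lemma poly_endo_id: "poly_endo id"
  by (simp add: poly_endo_def)

lemma poly_endo_subst_poly: "poly_endo (subst_poly s)"
proof
  show "subst_poly s (f * g) = subst_poly s f * subst_poly s g" for f g :: "('a, 'b) mpoly"
  proof (induction f rule: mpoly_induct)
    case (Const c)
    show ?case
      by (induction g rule: mpoly_induct)
        (simp_all add: subst_poly_Const subst_poly_add distrib_left mult.left_commute[of "Const c"]
          subst_poly_Var_mult flip: Const_mult)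
  qed (auto simp: subst_poly_Var_mult mult.assoc distrib_right subst_poly_add)
qed (auto simp: subst_poly_add subst_poly_Const)

lemma subst_poly_Var: "subst_poly s (Var i) = s i"
  using subst_poly_Var_mult[of s i 1] subst_poly_Const[of s 1] by simp

lemma pd_endo_chain:
  assumes "poly_endo \<sigma>"
  shows "pd k (\<sigma> f) = (\<Sum>l\<in>UNIV. \<sigma> (pd l f) * pd k (\<sigma> (Var l)))"
proof -
  interpret poly_endo \<sigma> by fact
  show ?thesis
  proof (induction f rule: mpoly_induct)
    case (Const c)
    show ?case by (simp add: endo_Const hom_0)
  next
    case (Var i f)
    have pd_l: "\<sigma> (pd l (Var i * f)) = (if l = i then \<sigma> f else 0) + \<sigma> (Var i) * \<sigma> (pd l f)" for l
      by (simp add: pd_Var_mult hom_add hom_mult hom_0)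
    have "(\<Sum>l\<in>UNIV. \<sigma> (pd l (Var i * f)) * pd k (\<sigma> (Var l))) =
        (\<Sum>l\<in>UNIV. (if l = i then \<sigma> f * pd k (\<sigma> (Var i)) else 0) + \<sigma> (Var i) * (\<sigma> (pd l f) * pd k (\<sigma> (Var l))))"
      unfolding pd_l by (intro sum.cong) (auto simp: algebra_simps)
    also have "\<dots> = \<sigma> f * pd k (\<sigma> (Var i)) + \<sigma> (Var i) * (\<Sum>l\<in>UNIV. \<sigma> (pd l f) * pd k (\<sigma> (Var l)))"
      by (simp add: sum.distrib sum_distrib_left)
    finally show ?case using Var by (simp add: hom_mult pd_mult algebra_simps)
  qed (auto simp: hom_add pd_add sum.distrib distrib_right)
qed

section \<open>Grading, Euler's identity, ideals and divided differences\<close>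

definition homog :: "nat \<Rightarrow> ('n::finite, 'k::field_char_0) mpoly \<Rightarrow> bool" where
  "homog d f \<longleftrightarrow> (\<forall>m\<in>keys f. mdeg m = d)"

definition hcomp :: "nat \<Rightarrow> ('n::finite, 'k::field_char_0) mpoly \<Rightarrow> ('n, 'k) mpoly" where
  "hcomp d f = (\<Sum>m\<in>{m\<in>keys f. mdeg m = d}. single m (lookup f m))"

lemma lookup_hcomp: "lookup (hcomp d f) m = (if mdeg m = d then lookup f m else 0)"
proof -
  have "(\<Sum>x\<in>{x\<in>keys f. mdeg x = d}. lookup f x when x = m) =
      (\<Sum>x\<in>{x\<in>keys f. mdeg x = d}. if x = m then lookup f x else 0)"
    by (intro sum.cong) (auto simp: when_def)
  then show ?thesis by (auto simp: hcomp_def lookup_sum lookup_single sum.delta in_keys_iff)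
qed

lemma homogI: "(\<And>m. lookup f m \<noteq> 0 \<Longrightarrow> mdeg m = d) \<Longrightarrow> homog d f"
  by (auto simp: homog_def in_keys_iff)

lemma homogD: "homog d f \<Longrightarrow> mdeg m \<noteq> d \<Longrightarrow> lookup f m = 0"
  by (auto simp: homog_def in_keys_iff)

lemma homog_hcomp: "homog d (hcomp d f)"
  by (rule homogI) (auto simp: lookup_hcomp split: if_splits)

lemma hcomp_homog: "homog d f \<Longrightarrow> hcomp e f = (if d = e then f else 0)"
  by (intro poly_mapping_eqI) (auto simp: lookup_hcomp homogD)

lemma hcomp_add: "hcomp d (f + g) = hcomp d f + hcomp d g"
  by (intro poly_mapping_eqI) (auto simp: lookup_hcomp lookup_add)

lemma hcomp_0 [simp]: "hcomp d 0 = 0"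
  by (intro poly_mapping_eqI) (auto simp: lookup_hcomp)

lemma hcomp_sum: "hcomp d (sum f A) = (\<Sum>x\<in>A. hcomp d (f x))"
  by (induction A rule: infinite_finite_induct) (auto simp: hcomp_add)

lemma homog_0 [simp]: "homog d 0" by (simp add: homog_def)

lemma homog_add: "homog d f \<Longrightarrow> homog d g \<Longrightarrow> homog d (f + g)"
  by (rule homogI) (metis add_0 homogD lookup_add)

lemma homog_sum: "(\<And>x. x \<in> A \<Longrightarrow> homog d (f x)) \<Longrightarrow> homog d (sum f A)"
  by (induction A rule: infinite_finite_induct) (auto simp: homog_add)

lemma homog_Const: "homog 0 (Const c)"
  by (rule homogI) (auto simp: Const_def lookup_single when_def split: if_splits)

lemma homog_Var: "homog 1 (Var i)"
  by (rule homogI) (auto simp: Var_def lookup_single when_def split: if_splits)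

lemma homog_mult:
  assumes "homog d f" "homog e g" shows "homog (d + e) (f * g)"
  unfolding homog_def
proof
  fix m assume "m \<in> keys (f * g)"
  then obtain a b where "m = a + b" "a \<in> keys f" "b \<in> keys g"
    using keys_mult[of f g] by blast
  then show "mdeg m = d + e" using assms by (simp add: homog_def mdeg_add)
qed

lemma homog_Const_mult: "homog d f \<Longrightarrow> homog d (Const c * f)"
  using homog_mult[OF homog_Const] by fastforce

lemma homog_diff: "homog d f \<Longrightarrow> homog d g \<Longrightarrow> homog d (f - g)"
  using homog_add[of d f "Const (- 1) * g"] homog_Const_mult[of d g "- 1"] by (simp add: Const_uminus)

lemma mpoly_sum_hcomp:
  obtains D where "f = (\<Sum>d<D. hcomp d f)"
proof -
  obtain D where D: "\<forall>m\<in>keys f. mdeg m < D"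
    using finite_nat_set_iff_bounded[of "mdeg ` keys f"] by auto
  have "f = (\<Sum>d<D. hcomp d f)"
  proof (rule poly_mapping_eqI)
    fix m
    show "lookup f m = lookup (\<Sum>d<D. hcomp d f) m"
      using D by (auto simp: lookup_sum lookup_hcomp in_keys_iff)
  qed
  then show ?thesis by (rule that)
qed

lemma hcomp_mult_homog:
  assumes "homog e g" shows "hcomp n (f * g) = (if e \<le> n then hcomp (n - e) f * g else 0)"
proof -
  obtain D where D: "f = (\<Sum>d<D. hcomp d f)" by (rule mpoly_sum_hcomp)
  have 1: "hcomp n (hcomp d f * g) = (if e \<le> n then hcomp (n - e) (hcomp d f) * g else 0)" for d
    by (auto simp: hcomp_homog[OF homog_mult[OF homog_hcomp assms]] hcomp_homog[OF homog_hcomp])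
  have "hcomp n ((\<Sum>d<D. hcomp d f) * g) = (if e \<le> n then hcomp (n - e) (\<Sum>d<D. hcomp d f) * g else 0)"
    by (simp add: sum_distrib_right hcomp_sum 1)
  then show ?thesis using D by simp
qed

text \<open>The truncated degree is right also for \<open>d = 0\<close>: the derivative vanishes
  there, and zero is homogeneous of every degree.\<close>

lemma homog_pd:
  assumes "homog d f" shows "homog (d - 1) (pd i f)"
proof (rule homogI)
  fix m assume "lookup (pd i f) m \<noteq> 0"
  then have "lookup f (m + single i 1) \<noteq> 0" by (auto simp: lookup_pd)
  then have "mdeg (m + single i 1) = d" using homogD[OF assms] by blast
  then show "mdeg m = d - 1" by (simp add: mdeg_add)
qed

lemma euler_identity:
  fixes f :: "('n::finite, 'k::field_char_0) mpoly"
  assumes "homog d f" shows "(\<Sum>i\<in>UNIV. Var i * pd i f) = of_nat d * f"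
proof -
  have "(\<Sum>i\<in>UNIV. Var i * pd i (single m c)) = of_nat (mdeg m) * single m c"
    for m :: "'n \<Rightarrow>\<^sub>0 nat" and c :: 'k
  proof (induction "mdeg m" arbitrary: m)
    case 0
    then have "m = 0" by (simp add: mdeg_eq_0_iff)
    then show ?case by (simp add: pd_single)
  next
    case (Suc d)
    then obtain i m' where m': "m = single i 1 + m'" and d: "d = mdeg m'"
      by (blast elim: monomial_split_Suc)
    define g where "g = single m' c"
    have s: "single m c = Var i * g" by (simp add: m' g_def Var_mult_single)
    have "(\<Sum>j\<in>UNIV. Var j * pd j (Var i * g)) =
        (\<Sum>j\<in>UNIV. (if j = i then Var i * g else 0) + Var i * (Var j * pd j g))"
      unfolding pd_Var_mult by (intro sum.cong) (auto simp: algebra_simps)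
    also have "\<dots> = Var i * g + Var i * (of_nat d * g)"
      using Suc.hyps(1)[OF d] by (simp add: sum.distrib sum_distrib_left[symmetric] g_def d)
    finally show ?case unfolding s Suc.hyps(2)[symmetric] by (simp add: algebra_simps)
  qed
  note single = this
  have "(\<Sum>i\<in>UNIV. Var i * pd i (\<Sum>m\<in>keys f. single m (lookup f m))) =
      (\<Sum>m\<in>keys f. \<Sum>i\<in>UNIV. Var i * pd i (single m (lookup f m)))"
    by (simp add: pd.D_sum sum_distrib_left) (rule sum.swap)
  also have "\<dots> = (\<Sum>m\<in>keys f. of_nat d * single m (lookup f m))"
    using assms by (intro sum.cong) (auto simp: single homog_def)
  finally show ?thesis using mpoly_expand[of f] by (simp add: sum_distrib_left[symmetric])
qed

text \<open>Any nonconstant monomial of \<open>g\<close> would push the product above the lowest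
  degree of \<open>f\<close>. This later extracts constant terms from a relation between
  products.\<close>

lemma lookup_mult_lowest:
  fixes f g :: "('n::finite, 'k::field_char_0) mpoly"
  assumes f: "\<And>m. m \<in> keys f \<Longrightarrow> e \<le> mdeg m" and m: "mdeg m = e"
  shows "lookup (f * g) m = lookup f m * lookup g 0"
proof -
  define h where "h = g - Const (lookup g 0)"
  have "lookup (f * h) m = 0"
  proof (rule ccontr)
    assume "lookup (f * h) m \<noteq> 0"
    then have "m \<in> keys (f * h)" by (simp add: in_keys_iff)
    then obtain a b where ab: "m = a + b" "a \<in> keys f" "b \<in> keys h"
      using keys_mult[of f h] by blast
    then have "mdeg b = 0" using f m by (fastforce simp: mdeg_add)
    then have "b = 0" by (simp add: mdeg_eq_0_iff)
    then show False using ab by (simp add: h_def in_keys_iff lookup_minus Const_def)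
  qed
  moreover have "f * g = f * h + Const (lookup g 0) * f" by (simp add: h_def right_diff_distrib mult.commute)
  ultimately show ?thesis by (simp only: lookup_add lookup_Const_mult) (simp add: mult.commute)
qed

inductive_set poly_ideal :: "('n, 'k::field_char_0) mpoly set \<Rightarrow> ('n, 'k) mpoly set" for S where
  zero: "0 \<in> poly_ideal S"
| step: "x \<in> S \<Longrightarrow> p \<in> poly_ideal S \<Longrightarrow> a * x + p \<in> poly_ideal S"

lemma poly_ideal_base: "x \<in> S \<Longrightarrow> x \<in> poly_ideal S"
  using poly_ideal.step[OF _ poly_ideal.zero, of x S 1] by simp

lemma poly_ideal_add: "p \<in> poly_ideal S \<Longrightarrow> q \<in> poly_ideal S \<Longrightarrow> p + q \<in> poly_ideal S"
  by (induction rule: poly_ideal.induct) (auto simp: add.assoc intro: poly_ideal.intros)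

lemma poly_ideal_mult: "p \<in> poly_ideal S \<Longrightarrow> a * p \<in> poly_ideal S"
  by (induction rule: poly_ideal.induct) (auto simp: distrib_left simp flip: mult.assoc intro: poly_ideal.intros)

lemma poly_ideal_uminus: "p \<in> poly_ideal S \<Longrightarrow> - p \<in> poly_ideal S"
  using poly_ideal_mult[of p S "- 1"] by simp

lemma poly_ideal_diff: "p \<in> poly_ideal S \<Longrightarrow> q \<in> poly_ideal S \<Longrightarrow> p - q \<in> poly_ideal S"
  using poly_ideal_add[OF _ poly_ideal_uminus, of p S q] by simp

lemma poly_ideal_sum: "(\<And>x. x \<in> A \<Longrightarrow> f x \<in> poly_ideal S) \<Longrightarrow> sum f A \<in> poly_ideal S"
  by (induction A rule: infinite_finite_induct) (auto intro: poly_ideal.zero poly_ideal_add)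

text \<open>Identity plus a map of rank at most one on linear forms; for a reflection,
  \<open>lf\<close> is an equation of its hyperplane.\<close>

definition reflection_endo :: "(('n::finite, 'k::field_char_0) mpoly \<Rightarrow> ('n, 'k) mpoly) \<Rightarrow> bool" where
  "reflection_endo \<sigma> \<longleftrightarrow> (\<exists>lf a. lf \<noteq> 0 \<and> homog 1 lf \<and> (\<forall>i. \<sigma> (Var i) = Var i + Const (a i) * lf))"

text \<open>Modulo \<open>lf\<close> the substitution is the identity, so \<open>lf\<close> divides
  the difference; the quotient is the divided difference of \<open>p\<close> along the
  reflection.\<close>

lemma reflection_difference:
  assumes "poly_endo \<sigma>" "homog 1 lf" "\<And>i. \<sigma> (Var i) = Var i + Const (a i) * lf"
    and deg: "\<And>m. m \<in> keys p \<Longrightarrow> mdeg m \<le> D"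
  shows "\<exists>q. \<sigma> p - p = lf * q \<and> (\<forall>m\<in>keys q. mdeg m < D)"
proof -
  interpret poly_endo \<sigma> by fact
  \<comment> \<open>The clause for \<open>m = 0\<close> guards the truncated subtraction: constants
    have divided difference 0.\<close>
  have single: "\<exists>q. \<sigma> (single m c) - single m c = lf * q \<and> homog (mdeg m - 1) q \<and> (m = 0 \<longrightarrow> q = 0)"
    for m c
  proof (induction "mdeg m" arbitrary: m)
    case 0
    then have "m = 0" by (simp add: mdeg_eq_0_iff)
    then show ?case using endo_Const[of c] by (intro exI[of _ 0]) (simp add: Const_def)
  next
    case (Suc d)
    then obtain i m' where m': "m = single i 1 + m'" and d: "d = mdeg m'"
      by (blast elim: monomial_split_Suc)
    define g where "g = single m' c"
    have s: "single m c = Var i * g" by (simp add: m' g_def Var_mult_single)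
    obtain q where q: "\<sigma> g - g = lf * q" "homog (d - 1) q" "m' = 0 \<longrightarrow> q = 0"
      using Suc.hyps(1)[OF d] by (auto simp: g_def d)
    \<comment> \<open>Twisted Leibniz rule: \<open>\<sigma> (Var i)\<close> times the divided
      difference of \<open>g\<close>, plus the divided difference of \<open>Var i\<close> times
      \<open>g\<close>.\<close>
    define r where "r = \<sigma> (Var i) * q + Const (a i) * g"
    have "\<sigma> (Var i * g) - Var i * g = \<sigma> (Var i) * (\<sigma> g - g) + (\<sigma> (Var i) - Var i) * g"
      by (simp add: hom_mult algebra_simps)
    also have "\<dots> = lf * r" by (simp add: q r_def assms(3) algebra_simps)
    finally have "\<sigma> (Var i * g) - Var i * g = lf * r" .
    moreover have "homog d r"
      unfolding r_def
    proof (rule homog_add)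
      have "homog 1 (\<sigma> (Var i))" unfolding assms(3) by (intro homog_add homog_Var homog_Const_mult assms(2))
      from homog_mult[OF this q(2)] show "homog d (\<sigma> (Var i) * q)"
        using q(3) by (cases "m' = 0") (auto simp: d mdeg_eq_0_iff Suc_diff_1 simp flip: mdeg_eq_0_iff)
      have "homog d g" by (rule homogI) (auto simp: g_def d lookup_single when_def split: if_splits)
      then show "homog d (Const (a i) * g)" by (rule homog_Const_mult)
    qed
    moreover have "m \<noteq> 0" using Suc.hyps(2) by auto
    ultimately show ?case unfolding s using Suc.hyps(2)[symmetric] by auto
  qed
  then obtain Q where Q: "\<And>m c. \<sigma> (single m c) - single m c = lf * Q m c"
    "\<And>m c. homog (mdeg m - 1) (Q m c)" "\<And>m c. m = 0 \<Longrightarrow> Q m c = 0" by metis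
  define q where "q = (\<Sum>m\<in>keys p. Q m (lookup p m))"
  have "\<sigma> p - p = (\<Sum>m\<in>keys p. \<sigma> (single m (lookup p m)) - single m (lookup p m))"
    using mpoly_expand[of p] by (metis (no_types, lifting) hom_sum sum.cong sum_subtractf)
  also have "\<dots> = lf * q" by (simp add: Q q_def sum_distrib_left)
  finally have "\<sigma> p - p = lf * q" .
  moreover have "mdeg m < D" if m: "m \<in> keys q" for m
  proof -
    obtain m' where m': "m' \<in> keys p" "m \<in> keys (Q m' (lookup p m'))"
      using m keys_sum[of "\<lambda>m. Q m (lookup p m)" "keys p"] unfolding q_def by blast
    then have "mdeg m = mdeg m' - 1" using Q(2) by (auto simp: homog_def)
    moreover have "m' \<noteq> 0" using m' Q(3) by auto
    then have "mdeg m' > 0" by (simp add: mdeg_eq_0_iff flip: neq0_conv)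
    ultimately show ?thesis using deg[OF m'(1)] by simp
  qed
  ultimately show ?thesis by blast
qed

section \<open>Invariants of reflection groups\<close>

inductive_set compositions :: "('a \<Rightarrow> 'a) set \<Rightarrow> ('a \<Rightarrow> 'a) set" for R where
  id: "id \<in> compositions R"
| comp: "\<sigma> \<in> R \<Longrightarrow> \<tau> \<in> compositions R \<Longrightarrow> \<sigma> \<circ> \<tau> \<in> compositions R"

locale linear_poly_group =
  fixes G :: "(('n::finite, 'k::field_char_0) mpoly \<Rightarrow> ('n, 'k) mpoly) set"
  assumes finite_G: "finite G"
    and id_in_G: "id \<in> G"
    and comp_in_G: "\<sigma> \<in> G \<Longrightarrow> \<tau> \<in> G \<Longrightarrow> \<sigma> \<circ> \<tau> \<in> G"
    and inverse_in_G: "\<sigma> \<in> G \<Longrightarrow> \<exists>\<tau>\<in>G. \<tau> \<circ> \<sigma> = id \<and> \<sigma> \<circ> \<tau> = id"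
    and endo_G: "\<sigma> \<in> G \<Longrightarrow> poly_endo \<sigma>"
    and linear_G: "\<sigma> \<in> G \<Longrightarrow> homog 1 (\<sigma> (Var i))"
begin

lemmas G_simps = poly_endo.endo_add[OF endo_G] poly_endo.endo_mult[OF endo_G] poly_endo.endo_Const[OF endo_G]

lemma G_hom: "\<sigma> \<in> G \<Longrightarrow> unital_ring_hom \<sigma>"
  using endo_G[of \<sigma>] unfolding poly_endo_def unital_ring_hom_def by (metis Const_1)

lemma bij_G: "\<sigma> \<in> G \<Longrightarrow> bij \<sigma>"
  using inverse_in_G o_bij by blast

lemma G_eq_0_iff: "\<sigma> \<in> G \<Longrightarrow> \<sigma> p = 0 \<longleftrightarrow> p = 0"
  using unital_ring_hom.hom_0[OF G_hom] bij_is_inj[OF bij_G] by (metis injD)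

lemma homog_G: "\<sigma> \<in> G \<Longrightarrow> homog d p \<Longrightarrow> homog d (\<sigma> p)"
proof -
  assume \<sigma>: "\<sigma> \<in> G" and d: "homog d p"
  interpret poly_endo \<sigma> using endo_G \<sigma> by blast
  have single: "homog (mdeg m) (\<sigma> (single m c))" for m c
  proof (induction "mdeg m" arbitrary: m)
    case 0
    then have "m = 0" by (simp add: mdeg_eq_0_iff)
    then show ?case using homog_Const[of c] endo_Const[of c] by (simp add: Const_def)
  next
    case (Suc d)
    then obtain i m' where m': "m = single i 1 + m'" and d: "d = mdeg m'"
      by (blast elim: monomial_split_Suc)
    have "homog (1 + mdeg m') (\<sigma> (Var i) * \<sigma> (single m' c))"
      using Suc.hyps(1)[OF d] linear_G[OF \<sigma>] by (intro homog_mult)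
    then show ?case by (simp add: m' mdeg_add hom_mult[symmetric] Var_mult_single)
  qed
  have "homog d (\<Sum>m\<in>keys p. \<sigma> (single m (lookup p m)))"
    by (rule homog_sum) (use d single in \<open>auto simp: homog_def\<close>)
  then show ?thesis using mpoly_expand[of p] by (simp flip: hom_sum)
qed

lemma hcomp_G:
  assumes "\<sigma> \<in> G" shows "hcomp d (\<sigma> p) = \<sigma> (hcomp d p)"
proof -
  interpret poly_endo \<sigma> using endo_G assms by blast
  obtain D where D: "p = (\<Sum>d<D. hcomp d p)" by (rule mpoly_sum_hcomp)
  have 1: "hcomp d (\<sigma> (hcomp e p)) = \<sigma> (hcomp d (hcomp e p))" for e
    by (simp add: hcomp_homog[OF homog_G[OF assms homog_hcomp]] hcomp_homog[OF homog_hcomp] hom_0)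
  have "hcomp d (\<sigma> (\<Sum>d<D. hcomp d p)) = \<sigma> (hcomp d (\<Sum>d<D. hcomp d p))"
    by (simp add: hom_sum hcomp_sum 1)
  then show ?thesis using D by simp
qed

lemma lookup_G_0: "\<sigma> \<in> G \<Longrightarrow> lookup (\<sigma> p) 0 = lookup p 0"
proof -
  assume \<sigma>: "\<sigma> \<in> G"
  have "hcomp 0 q = Const (lookup q 0)" for q :: "('n, 'k) mpoly"
    by (intro poly_mapping_eqI) (auto simp: lookup_hcomp mdeg_eq_0_iff Const_def lookup_single)
  then have "Const (lookup (\<sigma> p) 0) = \<sigma> (Const (lookup p 0))"
    using hcomp_G[OF \<sigma>, of 0 p] by simp
  then show ?thesis by (simp add: G_simps \<sigma>)
qed

definition invar :: "('n, 'k) mpoly \<Rightarrow> bool" where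
  "invar p \<longleftrightarrow> (\<forall>\<sigma>\<in>G. \<sigma> p = p)"

lemma invarI: "(\<And>\<sigma>. \<sigma> \<in> G \<Longrightarrow> \<sigma> p = p) \<Longrightarrow> invar p"
  by (simp add: invar_def)

lemma invarD: "invar p \<Longrightarrow> \<sigma> \<in> G \<Longrightarrow> \<sigma> p = p"
  by (simp add: invar_def)

lemma invar_Const: "invar (Const c)" by (rule invarI) (simp add: G_simps)

lemma invar_add: "invar p \<Longrightarrow> invar q \<Longrightarrow> invar (p + q)"
  by (rule invarI) (simp add: G_simps invarD)

lemma invar_mult: "invar p \<Longrightarrow> invar q \<Longrightarrow> invar (p * q)"
  by (rule invarI) (simp add: G_simps invarD)

lemma invar_0: "invar 0" using invar_Const[of 0] by simp

lemma invar_sum: "(\<And>x. x \<in> A \<Longrightarrow> invar (f x)) \<Longrightarrow> invar (sum f A)"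
  by (induction A rule: infinite_finite_induct) (auto simp: invar_0 invar_add)

lemma invar_diff: "invar p \<Longrightarrow> invar q \<Longrightarrow> invar (p - q)"
  using invar_add[OF _ invar_mult[OF invar_Const[of "- 1"]], of p q] by (simp add: Const_uminus)

lemma invar_hcomp: "invar p \<Longrightarrow> invar (hcomp d p)"
  by (rule invarI) (simp add: invarD flip: hcomp_G)

text \<open>The Reynolds operator of the group.\<close>

definition avg :: "('n, 'k) mpoly \<Rightarrow> ('n, 'k) mpoly" where
  "avg p = Const (1 / of_nat (card G)) * (\<Sum>\<sigma>\<in>G. \<sigma> p)"

lemma card_G: "card G > 0"
  using finite_G id_in_G by (auto simp: card_gt_0_iff)

lemma avg_const_cancel: "Const (1 / of_nat (card G)) * (of_nat (card G) * p) = p"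
  for p :: "('n, 'k) mpoly"
  using card_G by (simp flip: mult.assoc Const_of_nat Const_mult)

lemma sum_G_translate: "\<sigma> \<in> G \<Longrightarrow> (\<Sum>\<tau>\<in>G. f (\<sigma> \<circ> \<tau>)) = (\<Sum>\<tau>\<in>G. f \<tau>)"
proof -
  assume \<sigma>: "\<sigma> \<in> G"
  obtain \<rho> where \<rho>: "\<rho> \<in> G" "\<rho> \<circ> \<sigma> = id" "\<sigma> \<circ> \<rho> = id" using inverse_in_G[OF \<sigma>] by blast
  have "bij_betw ((\<circ>) \<sigma>) G G"
    by (rule bij_betw_byWitness[where f' = "(\<circ>) \<rho>"])
      (auto simp: comp_in_G \<sigma> \<rho> comp_assoc[symmetric])
  then show ?thesis by (rule sum.reindex_bij_betw)
qed

lemma invar_avg: "invar (avg p)"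
  unfolding invar_def
proof
  fix \<sigma> assume \<sigma>: "\<sigma> \<in> G"
  interpret poly_endo \<sigma> using endo_G \<sigma> by blast
  have "(\<Sum>\<tau>\<in>G. \<sigma> (\<tau> p)) = (\<Sum>\<tau>\<in>G. \<tau> p)"
    using sum_G_translate[OF \<sigma>, of "\<lambda>\<tau>. \<tau> p"] by simp
  then show "\<sigma> (avg p) = avg p" by (simp add: avg_def hom_mult endo_Const hom_sum)
qed

lemma avg_mult_invar: "invar p \<Longrightarrow> avg (p * q) = p * avg q"
  by (simp add: avg_def G_simps invarD sum_distrib_left mult.left_commute)

lemma avg_add: "avg (p + q) = avg p + avg q"
  by (simp add: avg_def G_simps sum.distrib distrib_left)

lemma avg_0: "avg 0 = 0"
  by (simp add: avg_def unital_ring_hom.hom_0[OF G_hom])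

lemma avg_sum: "avg (sum f A) = (\<Sum>x\<in>A. avg (f x))"
  by (induction A rule: infinite_finite_induct) (auto simp: avg_0 avg_add)

lemma avg_invar: "invar p \<Longrightarrow> avg p = p"
  by (simp add: avg_def invarD avg_const_cancel)

lemma homog_avg: "homog d p \<Longrightarrow> homog d (avg p)"
  unfolding avg_def by (rule homog_Const_mult, rule homog_sum) (rule homog_G)

lemma lookup_avg_0: "lookup (avg p) 0 = lookup p 0"
  using card_G by (simp add: avg_def lookup_Const_mult lookup_sum lookup_G_0)

text \<open>Otherwise the automorphisms in \<open>G\<close> would satisfy a linear relation with
  coefficients \<open>\<sigma> p\<close>, and independence of characters would give
  \<open>p = 0\<close>.\<close>

lemma exists_avg_nonzero:
  assumes "p \<noteq> 0" shows "\<exists>e. avg (p * e) \<noteq> 0"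
proof (rule ccontr)
  assume "\<not> ?thesis"
  then have "(\<Sum>\<sigma>\<in>G. \<sigma> p * \<sigma> e) = 0" for e
    using card_G by (simp add: avg_def G_simps)
  then have "\<forall>\<sigma>\<in>G. \<sigma> p = 0"
    by (intro dedekind_independence[where ch = "\<lambda>\<sigma>. \<sigma>" and mul = "(*)" and u = 1])
      (auto simp: finite_G G_simps unital_ring_hom.hom_1[OF G_hom] mult.commute fun_eq_iff)
  then show False using assms id_in_G by fastforce
qed

definition hilbert_ideal :: "('n, 'k) mpoly set" where
  "hilbert_ideal = poly_ideal {h. invar h \<and> lookup h 0 = 0}"

text \<open>Measures which invariants of degree \<open>d\<close> are new: those inside this ideal
  are accounted for by invariants of smaller degree.\<close>

definition hilbert_ideal_below :: "nat \<Rightarrow> ('n, 'k) mpoly set" where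
  "hilbert_ideal_below d = poly_ideal {h. invar h \<and> (\<exists>e\<ge>1. e < d \<and> homog e h)}"

lemma hilbert_ideal_G: "p \<in> hilbert_ideal \<Longrightarrow> \<sigma> \<in> G \<Longrightarrow> \<sigma> p \<in> hilbert_ideal"
  unfolding hilbert_ideal_def
proof (induction rule: poly_ideal.induct)
  case zero
  then show ?case by (simp add: unital_ring_hom.hom_0[OF G_hom] poly_ideal.zero)
next
  case (step x p a)
  then have "\<sigma> (a * x + p) = \<sigma> a * x + \<sigma> p" by (simp add: G_simps invarD)
  then show ?case using step by (auto intro: poly_ideal.step)
qed

text \<open>In degree \<open>e\<close> only the components of generators in degrees 1 to
  \<open>e\<close> take part, and these are invariants of degree below \<open>d\<close>.\<close>

lemma hcomp_hilbert_ideal: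
  "p \<in> hilbert_ideal \<Longrightarrow> e < d \<Longrightarrow> hcomp e p \<in> hilbert_ideal_below d"
  unfolding hilbert_ideal_def hilbert_ideal_below_def
proof (induction rule: poly_ideal.induct)
  case zero
  then show ?case by (simp add: poly_ideal.zero)
next
  case (step x p a)
  obtain D where D: "x = (\<Sum>i<D. hcomp i x)" by (rule mpoly_sum_hcomp)
  have "hcomp e (a * hcomp i x) \<in> poly_ideal {h. invar h \<and> (\<exists>e\<ge>1. e < d \<and> homog e h)}" for i
  proof (cases "1 \<le> i \<and> i \<le> e")
    case True
    then have "hcomp i x \<in> {h. invar h \<and> (\<exists>e\<ge>1. e < d \<and> homog e h)}"
      using step by (auto intro: invar_hcomp homog_hcomp intro!: exI[of _ i])
    then show ?thesis using True by (simp add: hcomp_mult_homog[OF homog_hcomp] poly_ideal_mult poly_ideal_base)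
  next
    case False
    moreover have "hcomp 0 x = 0"
      using step.hyps by (intro poly_mapping_eqI) (auto simp: lookup_hcomp mdeg_eq_0_iff)
    ultimately show ?thesis
      by (cases "i = 0") (auto simp: hcomp_mult_homog[OF homog_hcomp] poly_ideal.zero)
  qed
  then have "hcomp e (a * (\<Sum>i<D. hcomp i x)) \<in> poly_ideal {h. invar h \<and> (\<exists>e\<ge>1. e < d \<and> homog e h)}"
    by (auto simp: sum_distrib_left hcomp_sum intro: poly_ideal_sum)
  then show ?case using step D by (simp add: hcomp_add poly_ideal_add)
qed

inductive_set subalgebra :: "('n, 'k) mpoly set \<Rightarrow> ('n, 'k) mpoly set" for B where
  Const: "Const c \<in> subalgebra B"
| base: "b \<in> B \<Longrightarrow> b \<in> subalgebra B"
| add: "p \<in> subalgebra B \<Longrightarrow> q \<in> subalgebra B \<Longrightarrow> p + q \<in> subalgebra B"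
| mult: "p \<in> subalgebra B \<Longrightarrow> q \<in> subalgebra B \<Longrightarrow> p * q \<in> subalgebra B"

lemma subalgebra_sum: "(\<And>x. x \<in> A \<Longrightarrow> f x \<in> subalgebra B) \<Longrightarrow> sum f A \<in> subalgebra B"
  by (induction A rule: infinite_finite_induct) (use subalgebra.Const[of 0] in \<open>auto intro: subalgebra.add\<close>)

text \<open>Irredundant in each degree, with generation left out on purpose: the size of such
  families will be bounded through their gradients, so a largest one exists, and a largest one
  generates.\<close>

definition basic_invariants :: "('n, 'k) mpoly set \<Rightarrow> (('n, 'k) mpoly \<Rightarrow> nat) \<Rightarrow> bool" where
  "basic_invariants B deg \<longleftrightarrow> finite B \<and> (\<forall>b\<in>B. invar b \<and> 1 \<le> deg b \<and> homog (deg b) b) \<and>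
     (\<forall>d c. (\<Sum>b\<in>{b\<in>B. deg b = d}. Const (c b) * b) \<in> hilbert_ideal_below d \<longrightarrow>
        (\<forall>b\<in>B. deg b = d \<longrightarrow> c b = 0))"

lemma basic_invariantsD:
  assumes "basic_invariants B deg"
    "(\<Sum>b\<in>{b\<in>B. deg b = d}. Const (c b) * b) \<in> hilbert_ideal_below d" "b \<in> B" "deg b = d"
  shows "c b = 0"
proof -
  have "\<forall>d c. (\<Sum>b\<in>{b\<in>B. deg b = d}. Const (c b) * b) \<in> hilbert_ideal_below d \<longrightarrow>
      (\<forall>b\<in>B. deg b = d \<longrightarrow> c b = 0)"
    using assms(1) by (simp add: basic_invariants_def)
  from this[THEN spec, THEN spec, THEN mp, of c d, OF assms(2)] show ?thesis
    using assms(3,4) by blast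
qed

text \<open>A relation with nonzero coefficient at \<open>f\<close> can be divided by it and
  contradicts \<open>new\<close>; any other relation already lives in \<open>B\<close>.\<close>

lemma basic_invariants_insert:
  assumes B: "basic_invariants B deg" and f: "invar f" "homog d f" "1 \<le> d"
    and new: "\<And>c. f - (\<Sum>b\<in>{b\<in>B. deg b = d}. Const (c b) * b) \<notin> hilbert_ideal_below d"
  shows "f \<notin> B" "basic_invariants (insert f B) (deg(f := d))"
proof -
  have fin: "finite B" using B by (simp add: basic_invariants_def)
  have zero: "0 \<in> hilbert_ideal_below d" by (simp add: hilbert_ideal_below_def poly_ideal.zero)
  show fB: "f \<notin> B"
  proof
    assume fB: "f \<in> B"
    have f0: "f \<noteq> 0" using new[of "\<lambda>_. 0"] zero by auto
    have "deg f = d"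
      using hcomp_homog[OF f(2), of "deg f"] hcomp_homog[of "deg f" f "deg f"] B fB f0
      by (auto simp: basic_invariants_def split: if_splits)
    then have "(\<Sum>b\<in>{b\<in>B. deg b = d}. Const (if b = f then 1 else 0) * b) = f"
      using fin fB by (subst sum.mono_neutral_right[of _ "{f}"]) auto
    then show False using new[of "\<lambda>b. if b = f then 1 else 0"] zero by simp
  qed
  have "\<forall>b\<in>insert f B. (deg(f := d)) b = e \<longrightarrow> c b = 0"
    if rel: "(\<Sum>b\<in>{b\<in>insert f B. (deg(f := d)) b = e}. Const (c b) * b) \<in> hilbert_ideal_below e" for e c
  proof (cases "e = d")
    case False
    then have "{b\<in>insert f B. (deg(f := d)) b = e} = {b\<in>B. deg b = e}" using fB by auto
    then show ?thesis using rel B False by (auto simp: basic_invariants_def)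
  next
    case True
    then have "{b\<in>insert f B. (deg(f := d)) b = e} = insert f {b\<in>B. deg b = d}" using fB by auto
    then have rel': "Const (c f) * f + (\<Sum>b\<in>{b\<in>B. deg b = d}. Const (c b) * b) \<in> hilbert_ideal_below d"
      using rel fin fB True by simp
    have cf: "c f = 0"
    proof (rule ccontr)
      assume cf: "c f \<noteq> 0"
      have "Const (1 / c f) * (Const (c f) * f + (\<Sum>b\<in>{b\<in>B. deg b = d}. Const (c b) * b)) \<in> hilbert_ideal_below d"
        using rel' poly_ideal_mult by (auto simp: hilbert_ideal_below_def)
      also have "Const (1 / c f) * (Const (c f) * f + (\<Sum>b\<in>{b\<in>B. deg b = d}. Const (c b) * b)) =
          f - (\<Sum>b\<in>{b\<in>B. deg b = d}. Const (- c b / c f) * b)"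
        using cf by (simp add: distrib_left sum_distrib_left sum_negf Const_uminus
            flip: mult.assoc Const_mult)
      finally show False using new[of "\<lambda>b. - c b / c f"] by blast
    qed
    then have "(\<Sum>b\<in>{b\<in>B. deg b = d}. Const (c b) * b) \<in> hilbert_ideal_below d" using rel' by simp
    then have "\<forall>b\<in>B. deg b = d \<longrightarrow> c b = 0" using basic_invariantsD[OF B, where c = c] by blast
    then show ?thesis using cf True fB by auto
  qed
  then show "basic_invariants (insert f B) (deg(f := d))"
    using B f fB fin by (auto simp: basic_invariants_def)
qed

text \<open>A family that cannot be enlarged spans the invariants modulo products of invariants of
  smaller degree, and averaging turns the polynomial coefficients of such products into invariants.\<close>

lemma maximal_basic_invariants_generate:
  assumes B: "basic_invariants B deg"
    and max: "\<And>B' deg'. basic_invariants B' deg' \<Longrightarrow> card B' \<le> card B"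
    and p: "invar p"
  shows "p \<in> subalgebra B"
proof -
  have fin: "finite B" and Bh: "\<And>b. b \<in> B \<Longrightarrow> homog (deg b) b \<and> invar b" using B by (auto simp: basic_invariants_def)
  have homogeneous: "f \<in> subalgebra B" if "invar f" "homog d f" for d f
    using that
  proof (induction d arbitrary: f rule: less_induct)
    case (less d)
    show ?case
    proof (cases "d = 0")
      case True
      then have "f = Const (lookup f 0)"
        using less.prems(2) by (intro poly_mapping_eqI)
          (auto simp: Const_def lookup_single when_def mdeg_eq_0_iff homogD)
      then show ?thesis using subalgebra.Const by metis
    next
      case False
      \<comment> \<open>Without such coefficients \<open>f\<close> could be adjoined to
        \<open>B\<close>, against maximality.\<close>
      obtain c where c: "f - (\<Sum>b\<in>{b\<in>B. deg b = d}. Const (c b) * b) \<in> hilbert_ideal_below d"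
        using basic_invariants_insert[OF B less.prems, of] max False fin
        by (metis (no_types, lifting) One_nat_def card_insert_disjoint not_less_eq_eq order_refl less_Suc0 not_less)
      define r where "r = f - (\<Sum>b\<in>{b\<in>B. deg b = d}. Const (c b) * b)"
      have r: "invar r" "homog d r"
        unfolding r_def using Bh less.prems
        by (auto intro!: invar_diff homog_diff invar_sum homog_sum invar_mult invar_Const homog_Const_mult)
      have "avg (hcomp d q) \<in> subalgebra B" if "q \<in> hilbert_ideal_below d" for q
        using that unfolding hilbert_ideal_below_def
      proof (induction q rule: poly_ideal.induct)
        case zero
        then show ?case using subalgebra.Const[of 0 B] by (simp add: avg_0)
      next
        case (step x q a)
        then obtain e where e: "1 \<le> e" "e < d" "homog e x" and x: "invar x" by blast
        have "avg (hcomp d (a * x)) = x * avg (hcomp (d - e) a)"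
          using e avg_mult_invar[OF x, of "hcomp (d - e) a"] by (simp add: hcomp_mult_homog mult.commute)
        \<comment> \<open>Since \<open>e \<ge> 1\<close>, the averaged coefficient has degree below
          \<open>d\<close> and is covered by the induction.\<close>
        moreover have "avg (hcomp (d - e) a) \<in> subalgebra B"
          using e by (intro less.IH[of "d - e"] invar_avg homog_avg homog_hcomp) auto
        moreover have "x \<in> subalgebra B" using less.IH e x by blast
        ultimately show ?case using step by (simp add: hcomp_add avg_add subalgebra.intros)
      qed
      from this[OF c] have "r \<in> subalgebra B"
        using r by (simp add: r_def[symmetric] hcomp_homog avg_invar)
      moreover have "(\<Sum>b\<in>{b\<in>B. deg b = d}. Const (c b) * b) \<in> subalgebra B"
        by (intro subalgebra_sum subalgebra.mult subalgebra.Const subalgebra.base) auto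
      ultimately have "r + (\<Sum>b\<in>{b\<in>B. deg b = d}. Const (c b) * b) \<in> subalgebra B"
        by (rule subalgebra.add)
      then show ?thesis by (simp add: r_def)
    qed
  qed
  obtain D where D: "p = (\<Sum>d<D. hcomp d p)" by (rule mpoly_sum_hcomp)
  have "(\<Sum>d<D. hcomp d p) \<in> subalgebra B"
    by (intro subalgebra_sum homogeneous[OF invar_hcomp[OF p] homog_hcomp])
  then show ?thesis using D by simp
qed

end

locale poly_reflection_group = linear_poly_group G
  for G :: "(('n::finite, 'k::field_char_0) mpoly \<Rightarrow> ('n, 'k) mpoly) set" +
  assumes generated: "G \<subseteq> compositions {\<sigma>\<in>G. reflection_endo \<sigma>}"
begin

text \<open>Chevalley's key lemma: divided differences along the reflections lower the degree of the
  coefficients \<open>p b\<close>.\<close>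

lemma chevalley_syzygy:
  assumes g: "\<And>b. b \<in> B \<Longrightarrow> invar (g b)" "\<And>b m'. b \<in> B \<Longrightarrow> m' \<in> keys (g b) \<Longrightarrow> e \<le> mdeg m'"
    and m: "mdeg m = e"
    and rel: "(\<Sum>b\<in>B. g b * p b) = 0"
    and deg: "\<And>b m'. b \<in> B \<Longrightarrow> m' \<in> keys (p b) \<Longrightarrow> mdeg m' < D"
  shows "(\<Sum>b\<in>B. Const (lookup (g b) m) * p b) \<in> hilbert_ideal"
  using rel deg
proof (induction D arbitrary: p)
  case 0
  then have "keys (p b) = {}" if "b \<in> B" for b using that by fastforce
  then have "p b = 0" if "b \<in> B" for b using that by (metis keys_eq_empty)
  then show ?case by (simp add: hilbert_ideal_def poly_ideal.zero)
next
  case (Suc D)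
  define P where "P = (\<Sum>b\<in>B. Const (lookup (g b) m) * p b)"
  have refl: "\<sigma> P - P \<in> hilbert_ideal" if \<sigma>: "\<sigma> \<in> G" "reflection_endo \<sigma>" for \<sigma>
  proof -
    interpret poly_endo \<sigma> using endo_G \<sigma> by blast
    obtain lf a where lf: "lf \<noteq> 0" "homog 1 lf" "\<And>i. \<sigma> (Var i) = Var i + Const (a i) * lf"
      using \<sigma>(2) unfolding reflection_endo_def by blast
    have "\<exists>q. \<sigma> (p b) - p b = lf * q \<and> (\<forall>m\<in>keys q. mdeg m < D)" if "b \<in> B" for b
      using Suc.prems(2)[OF that] by (intro reflection_difference[OF poly_endo_axioms lf(2,3)]) (auto simp: less_Suc_eq_le)
    then obtain q where q: "\<And>b. b \<in> B \<Longrightarrow> \<sigma> (p b) - p b = lf * q b"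
      "\<And>b m. b \<in> B \<Longrightarrow> m \<in> keys (q b) \<Longrightarrow> mdeg m < D" by metis
    \<comment> \<open>Subtracting the relation from its image under \<sigma> leaves a multiple of
      \<open>lf\<close>; cancelling it gives a relation of the same shape for the divided
      differences \<open>q\<close>.\<close>
    have "lf * (\<Sum>b\<in>B. g b * q b) = (\<Sum>b\<in>B. g b * (\<sigma> (p b) - p b))"
      by (simp add: sum_distrib_left q mult.left_commute)
    also have "\<dots> = \<sigma> (\<Sum>b\<in>B. g b * p b) - (\<Sum>b\<in>B. g b * p b)"
      using g(1) \<sigma>(1) by (simp add: hom_sum hom_mult invarD right_diff_distrib sum_subtractf)
    also have "\<dots> = 0" by (simp add: Suc.prems hom_0)
    finally have "(\<Sum>b\<in>B. g b * q b) = 0" using lf(1) by simp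
    then have "(\<Sum>b\<in>B. Const (lookup (g b) m) * q b) \<in> hilbert_ideal"
      using Suc.IH q(2) by blast
    then have "lf * (\<Sum>b\<in>B. Const (lookup (g b) m) * q b) \<in> hilbert_ideal"
      unfolding hilbert_ideal_def by (rule poly_ideal_mult)
    also have "lf * (\<Sum>b\<in>B. Const (lookup (g b) m) * q b) =
        (\<Sum>b\<in>B. Const (lookup (g b) m) * (\<sigma> (p b) - p b))"
      by (simp add: sum_distrib_left q mult.left_commute)
    also have "\<dots> = \<sigma> P - P"
      by (simp add: P_def hom_sum hom_mult endo_Const right_diff_distrib sum_subtractf)
    finally show ?thesis .
  qed
  \<comment> \<open>The congruence passes from reflections to their products because the ideal is
    stable under \<open>G\<close>; summing over \<open>G\<close> then compares \<open>P\<close> with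
    its average.\<close>
  have "\<sigma> P - P \<in> hilbert_ideal" if "\<sigma> \<in> compositions {\<sigma>\<in>G. reflection_endo \<sigma>}" for \<sigma>
    using that
  proof (induction rule: compositions.induct)
    case id
    then show ?case by (simp add: hilbert_ideal_def poly_ideal.zero)
  next
    case (comp \<sigma> \<tau>)
    have "(\<sigma> \<circ> \<tau>) P - P = \<sigma> (\<tau> P - P) + (\<sigma> P - P)"
      using comp(1) by (simp add: unital_ring_hom.hom_diff[OF G_hom])
    also have "\<dots> \<in> hilbert_ideal"
      using comp refl[of \<sigma>] hilbert_ideal_G poly_ideal_add unfolding hilbert_ideal_def by blast
    finally show ?case .
  qed
  then have "(\<Sum>\<sigma>\<in>G. \<sigma> P - P) \<in> hilbert_ideal"
    unfolding hilbert_ideal_def using generated by (intro poly_ideal_sum) blast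
  then have "Const (1 / of_nat (card G)) * (\<Sum>\<sigma>\<in>G. \<sigma> P - P) \<in> hilbert_ideal"
    unfolding hilbert_ideal_def by (rule poly_ideal_mult)
  also have "Const (1 / of_nat (card G)) * (\<Sum>\<sigma>\<in>G. \<sigma> P - P) = avg P - P"
    by (simp add: avg_def sum_subtractf right_diff_distrib avg_const_cancel)
  finally have diff: "avg P - P \<in> hilbert_ideal" .
  \<comment> \<open>The averaged relation, read at the lowest monomial \<open>m\<close>, says that
    \<open>P\<close> has constant term 0; so \<open>avg P\<close> is itself a generator of the
    ideal.\<close>
  have "(\<Sum>b\<in>B. g b * avg (p b)) = avg (\<Sum>b\<in>B. g b * p b)"
    using g(1) by (simp add: avg_sum avg_mult_invar)
  then have "lookup (\<Sum>b\<in>B. g b * avg (p b)) m = 0" by (simp add: Suc.prems avg_0)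
  moreover have "lookup (g b * avg (p b)) m = lookup (g b) m * lookup (p b) 0"
    if "b \<in> B" for b
    using lookup_mult_lowest[of "g b" e m "avg (p b)"] g(2)[OF that] m by (simp add: lookup_avg_0)
  ultimately have "lookup P 0 = 0"
    by (simp add: P_def lookup_sum lookup_Const_mult)
  then have "avg P \<in> hilbert_ideal"
    unfolding hilbert_ideal_def by (intro poly_ideal_base) (simp add: invar_avg lookup_avg_0)
  then have "avg P - (avg P - P) \<in> hilbert_ideal"
    using diff poly_ideal_diff unfolding hilbert_ideal_def by blast
  then show ?case by (simp add: P_def)
qed

text \<open>The coefficients of a relation are made invariant by averaging and then homogeneous.
  Chevalley's lemma turns them into a scalar combination \<open>f\<close> of members of one degree
  \<open>d\<close> whose partial derivatives all lie in the Hilbert ideal. Euler's identity puts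
  \<open>f\<close> into the ideal of smaller degrees, against irredundancy.\<close>

theorem basic_invariants_gradient_independent:
  assumes B: "basic_invariants B deg"
    and rel: "\<And>k. (\<Sum>b\<in>B. a b * pd k b) = 0" and b: "b \<in> B"
  shows "a b = 0"
proof (rule ccontr)
  assume ab: "a b \<noteq> 0"
  have fin: "finite B" and Bh: "\<And>b. b \<in> B \<Longrightarrow> invar b \<and> 1 \<le> deg b \<and> homog (deg b) b"
    using B by (auto simp: basic_invariants_def)
  obtain e where e: "avg (a b * e) \<noteq> 0" using exists_avg_nonzero[OF ab] by blast
  define A where "A x = avg (a x * e)" for x
  \<comment> \<open>By the chain rule \<sigma> carries a gradient relation to a gradient relation,
    up to the matrix \<open>pd k (\<sigma> (Var l))\<close>; the factor \<open>e\<close> keeps the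
    average from vanishing.\<close>
  have rel_A: "(\<Sum>x\<in>B. A x * pd k x) = 0" for k
  proof -
    have "(\<Sum>x\<in>B. \<sigma> (a x * e) * pd k x) = 0" if \<sigma>: "\<sigma> \<in> G" for \<sigma>
    proof -
      interpret poly_endo \<sigma> using endo_G \<sigma> by blast
      have "(\<Sum>x\<in>B. \<sigma> (a x * e) * pd k x) = (\<Sum>x\<in>B. \<sigma> (a x * e) * pd k (\<sigma> x))"
        using Bh \<sigma> by (intro sum.cong) (auto simp: invarD)
      also have "\<dots> = (\<Sum>x\<in>B. \<Sum>l\<in>UNIV. \<sigma> (a x * e) * (\<sigma> (pd l x) * pd k (\<sigma> (Var l))))"
        by (intro sum.cong refl) (subst pd_endo_chain[OF poly_endo_axioms], rule sum_distrib_left)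
      also have "\<dots> = (\<Sum>l\<in>UNIV. \<Sum>x\<in>B. \<sigma> (a x * e) * (\<sigma> (pd l x) * pd k (\<sigma> (Var l))))"
        by (rule sum.swap)
      also have "\<dots> = (\<Sum>l\<in>UNIV. \<sigma> e * \<sigma> (\<Sum>x\<in>B. a x * pd l x) * pd k (\<sigma> (Var l)))"
        by (intro sum.cong refl) (simp add: hom_sum hom_mult sum_distrib_left sum_distrib_right mult_ac)
      also have "\<dots> = 0" by (simp add: rel hom_0)
      finally show ?thesis .
    qed
    then have "(\<Sum>\<sigma>\<in>G. \<Sum>x\<in>B. \<sigma> (a x * e) * pd k x) = 0" by simp
    then have "(\<Sum>x\<in>B. (\<Sum>\<sigma>\<in>G. \<sigma> (a x * e)) * pd k x) = 0"
      by (subst (asm) sum.swap) (simp add: sum_distrib_right)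
    then have "Const (1 / of_nat (card G)) * (\<Sum>x\<in>B. (\<Sum>\<sigma>\<in>G. \<sigma> (a x * e)) * pd k x) = 0" by simp
    then show ?thesis
      by (subst (asm) sum_distrib_left) (simp only: A_def avg_def mult.assoc)
  qed
  obtain m0 where m0: "m0 \<in> keys (A b)" using e by (metis A_def ex_in_conv keys_eq_empty)
  \<comment> \<open>The component of degree \<open>c - 1\<close> of the relation is taken, which
    cuts the coefficient of \<open>x\<close> to degree \<open>c - deg x\<close>; this
    \<open>c\<close> keeps the monomial \<open>m0\<close> of \<open>A b\<close> alive.\<close>
  define c where "c = mdeg m0 + deg b"
  define H where "H x = (if deg x \<le> c then hcomp (c - deg x) (A x) else 0)" for x
  have H_hom: "homog (c - deg x) (H x)" for x by (simp add: H_def homog_hcomp)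
  have H_inv: "invar (H x)" for x by (simp add: H_def invar_0 invar_hcomp invar_avg A_def)
  have "lookup (H b) m0 \<noteq> 0" using m0 by (simp add: H_def c_def lookup_hcomp in_keys_iff)
  then have Hb: "H b \<noteq> 0" by auto
  have rel_H: "(\<Sum>x\<in>B. H x * pd k x) = 0" for k
  proof -
    have "hcomp (c - 1) (A x * pd k x) = H x * pd k x" if x: "x \<in> B" for x
    proof -
      have x1: "1 \<le> deg x" "homog (deg x - 1) (pd k x)" using Bh[OF x] homog_pd by auto
      have "c - 1 - (deg x - 1) = c - deg x" using x1 by simp
      moreover have "deg x - 1 \<le> c - 1 \<longleftrightarrow> deg x \<le> c" using x1 Bh[OF b] by (auto simp: c_def)
      ultimately show ?thesis using hcomp_mult_homog[OF x1(2), of "c - 1" "A x"] by (simp add: H_def)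
    qed
    then have "(\<Sum>x\<in>B. H x * pd k x) = hcomp (c - 1) (\<Sum>x\<in>B. A x * pd k x)" by (simp add: hcomp_sum)
    then show ?thesis by (simp add: rel_A)
  qed
  define S where "S = {x\<in>B. H x \<noteq> 0}"
  have S: "finite S" "b \<in> S" using fin b Hb by (auto simp: S_def)
  \<comment> \<open>Top degree \<open>d\<close> among the members in use means lowest degree
    \<open>c - d\<close> among their coefficients, as Chevalley's lemma requires.\<close>
  define d where "d = Max (deg ` S)"
  have "d \<in> deg ` S" unfolding d_def using S by (intro Max_in) auto
  then obtain b1 where b1: "b1 \<in> S" "deg b1 = d" by blast
  have le_d: "deg x \<le> d" if "x \<in> S" for x unfolding d_def using S that by (intro Max_ge) auto
  have le_c: "deg x \<le> c" if "x \<in> S" for x using that by (auto simp: S_def H_def split: if_splits)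
  obtain m where m: "m \<in> keys (H b1)" using b1 by (metis (mono_tags, lifting) S_def ex_in_conv keys_eq_empty mem_Collect_eq)
  then have deg_m: "mdeg m = c - d" using H_hom[of b1] b1 by (auto simp: homog_def)
  define f where "f = (\<Sum>x\<in>{x\<in>B. deg x = d}. Const (lookup (H x) m) * x)"
  have coeff_0: "lookup (H x) m = 0" if "x \<in> B" "deg x \<noteq> d" for x
  proof (rule ccontr)
    assume *: "lookup (H x) m \<noteq> 0"
    then have x: "x \<in> S" using that by (auto simp: S_def)
    have "c - deg x = c - d" using * H_hom[of x] deg_m homogD by metis
    then show False using le_d[OF x] le_c[OF b1(1)] that b1 by simp
  qed
  have "pd k f \<in> hilbert_ideal" for k
  proof -
    have "(\<Sum>x\<in>B. Const (lookup (H x) m) * pd k x) \<in> hilbert_ideal"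
    proof (rule chevalley_syzygy[OF _ _ deg_m])
      show "c - d \<le> mdeg m'" if "x \<in> B" "m' \<in> keys (H x)" for x m'
      proof -
        have "x \<in> S" using that by (auto simp: S_def)
        then show ?thesis using le_d[of x] that H_hom[of x] by (auto simp: homog_def)
      qed
      show "mdeg m' < Suc (Max (deg ` B))" if "x \<in> B" "m' \<in> keys (pd k x)" for x m'
      proof -
        have "mdeg m' = deg x - 1" using homog_pd[of "deg x" x k] Bh that by (auto simp: homog_def)
        also have "\<dots> \<le> Max (deg ` B)" using fin that by (meson Max_ge diff_le_self finite_imageI imageI order_trans)
        finally show ?thesis by simp
      qed
    qed (use H_inv rel_H in auto)
    also have "(\<Sum>x\<in>B. Const (lookup (H x) m) * pd k x) =
        (\<Sum>x\<in>{x\<in>B. deg x = d}. Const (lookup (H x) m) * pd k x)"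
      using fin coeff_0 by (intro sum.mono_neutral_right) auto
    also have "\<dots> = pd k f" by (simp add: f_def pd.D_sum pd_Const_mult)
    finally show ?thesis .
  qed
  moreover have f_hom: "homog d f"
    unfolding f_def using Bh by (auto intro!: homog_sum homog_Const_mult)
  have d1: "1 \<le> d" using b1 Bh by (auto simp: S_def)
  \<comment> \<open>The derivatives have degree \<open>d - 1\<close>, where the Hilbert ideal is
    reached by invariants of degree below \<open>d\<close>.\<close>
  ultimately have "pd k f \<in> hilbert_ideal_below d" for k
    using hcomp_hilbert_ideal[of "pd k f" "d - 1" d] hcomp_homog[OF homog_pd[OF f_hom], of "d - 1"] d1 by simp
  then have "Const (1 / of_nat d) * (\<Sum>k\<in>UNIV. Var k * pd k f) \<in> hilbert_ideal_below d"
    unfolding hilbert_ideal_below_def by (intro poly_ideal_mult poly_ideal_sum)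
  also have "Const (1 / of_nat d) * (\<Sum>k\<in>UNIV. Var k * pd k f) = f"
    unfolding euler_identity[OF f_hom] using d1 by (simp flip: mult.assoc Const_of_nat Const_mult)
  finally have "f \<in> hilbert_ideal_below d" .
  then have "lookup (H b1) m = 0"
    using basic_invariantsD[OF B, where c = "\<lambda>x. lookup (H x) m"] b1 by (simp add: f_def S_def)
  then show False using m by (simp add: in_keys_iff)
qed

end

section \<open>Rational functions inside the skew field\<close>

type_synonym ('n, 'k) wfield = "('n, 'k) weyl ofrac"

abbreviation emb :: "('n::finite, 'k::field_char_0) weyl \<Rightarrow> ('n, 'k) wfield" where
  "emb a \<equiv> fr a 1"

abbreviation emp :: "('n::finite, 'k::field_char_0) mpoly \<Rightarrow> ('n, 'k) wfield" where
  "emp p \<equiv> emb (wm p)"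

abbreviation ed :: "'n \<Rightarrow> ('n::finite, 'k::field_char_0) wfield" where
  "ed i \<equiv> emb (wd i)"

lemma emb_1 [simp]: "emb 1 = 1"
  by (simp add: one_ofrac_def)

interpretation emp: unital_ring_hom "\<lambda>p. emp p"
  by unfold_locales (simp_all add: wm_add wm_mult fr.hom_add fr.hom_mult fr.hom_1)

lemma emb_eq_0_iff [simp]: "emb a = 0 \<longleftrightarrow> a = 0"
  by (simp add: zero_ofrac_def)

lemma emb_eq_iff [simp]: "emb a = emb b \<longleftrightarrow> a = b"
  using emb_eq_0_iff[of "a - b"] by (simp add: fr.hom_diff)

lemma emp_commute: "emp p * emp q = emp q * emp p"
  by (simp add: mult.commute flip: emp.hom_mult)

lemma emp_inverse_commute: "inverse (emp q) * emp p = emp p * inverse (emp q)"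
  by (rule mult_commute_imp_mult_inverse_commute) (rule emp_commute)

lemma emp_fraction_cancel: "q' \<noteq> 0 \<Longrightarrow> emp (p * q') / emp (q * q') = emp p / emp q"
  by (cases "q = 0")
    (simp_all add: emp.hom_mult divide_inverse nonzero_inverse_mult_distrib emp.hom_0 mult.assoc
      mult.assoc[symmetric, of "emp q'" "inverse (emp q')"])

lemma emp_fraction_add:
  "q \<noteq> 0 \<Longrightarrow> q' \<noteq> 0 \<Longrightarrow> emp p / emp q + emp p' / emp q' = emp (p * q' + p' * q) / emp (q * q')"
  using emp_fraction_cancel[of q' p q] emp_fraction_cancel[of q p' q']
  by (simp add: emp.hom_add add_divide_distrib mult.commute)

lemma emp_fraction_mult:
  "q \<noteq> 0 \<Longrightarrow> q' \<noteq> 0 \<Longrightarrow> (emp p / emp q) * (emp p' / emp q') = emp (p * p') / emp (q' * q)"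
proof -
  assume nz: "q \<noteq> 0" "q' \<noteq> 0"
  have "emp p * inverse (emp q) * (emp p' * inverse (emp q')) = emp p * (emp p' * inverse (emp q)) * inverse (emp q')"
    using emp_inverse_commute[of q p'] by (simp only: mult.assoc[symmetric]) (simp only: mult.assoc)
  then show ?thesis
    using nz by (simp add: divide_inverse emp.hom_mult nonzero_inverse_mult_distrib mult.assoc)
qed

definition rational_elements :: "('n::finite, 'k::field_char_0) wfield set" where
  "rational_elements = {emp p / emp q | p q. q \<noteq> 0}"

lemma rational_elementsE:
  assumes "z \<in> rational_elements" obtains p q where "q \<noteq> 0" "z = emp p / emp q"
  using assms by (auto simp: rational_elements_def)

lemma rational_elementsI: "q \<noteq> 0 \<Longrightarrow> emp p / emp q \<in> rational_elements"
  by (auto simp: rational_elements_def)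

lemma emp_rational: "emp p \<in> rational_elements"
  using rational_elementsI[of 1 p] by (simp add: emp.hom_1)

lemma rational_add: "z \<in> rational_elements \<Longrightarrow> w \<in> rational_elements \<Longrightarrow> z + w \<in> rational_elements"
  by (elim rational_elementsE) (simp add: emp_fraction_add rational_elementsI)

lemma rational_mult: "z \<in> rational_elements \<Longrightarrow> w \<in> rational_elements \<Longrightarrow> z * w \<in> rational_elements"
  by (elim rational_elementsE)
    (simp add: emp_fraction_mult rational_elementsI del: times_divide_eq_right times_divide_eq_left)

lemma rational_commute: "z \<in> rational_elements \<Longrightarrow> w \<in> rational_elements \<Longrightarrow> z * w = w * z"
  by (elim rational_elementsE)
    (simp add: emp_fraction_mult mult.commute del: times_divide_eq_right times_divide_eq_left)

lemma rational_uminus: "z \<in> rational_elements \<Longrightarrow> - z \<in> rational_elements"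
  using rational_mult[OF emp_rational[of "- 1"]] by (simp add: emp.hom_uminus emp.hom_1)

lemma rational_inverse: "z \<in> rational_elements \<Longrightarrow> inverse z \<in> rational_elements"
proof (elim rational_elementsE)
  fix p q :: "('a, 'b) mpoly"
  assume z: "q \<noteq> 0" "z = emp p / emp q"
  show "inverse z \<in> rational_elements"
  proof (cases "p = 0")
    case True
    then show ?thesis using z emp_rational[of 0] by (simp add: emp.hom_0)
  next
    case False
    then have "inverse z = emp q / emp p"
      using z by (simp add: divide_inverse nonzero_inverse_mult_distrib)
    then show ?thesis using False by (simp add: rational_elementsI)
  qed
qed

text \<open>The subfield \<open>K\<close> of rational functions becomes a type of its own to have linear algebra over it.\<close>

typedef (overloaded) ('n, 'k) ratf = "rational_elements :: ('n::finite, 'k::field_char_0) wfield set"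
  using emp_rational by blast

setup_lifting type_definition_ratf

instantiation ratf :: (finite, field_char_0) field
begin

lift_definition zero_ratf :: "('a, 'b) ratf" is 0 using emp_rational[of 0] by (simp add: emp.hom_0)
lift_definition one_ratf :: "('a, 'b) ratf" is 1 using emp_rational[of 1] by (simp add: emp.hom_1)
lift_definition plus_ratf :: "('a, 'b) ratf \<Rightarrow> ('a, 'b) ratf \<Rightarrow> ('a, 'b) ratf" is "(+)" by (rule rational_add)
lift_definition times_ratf :: "('a, 'b) ratf \<Rightarrow> ('a, 'b) ratf \<Rightarrow> ('a, 'b) ratf" is "(*)" by (rule rational_mult)
lift_definition uminus_ratf :: "('a, 'b) ratf \<Rightarrow> ('a, 'b) ratf" is uminus by (rule rational_uminus)
lift_definition inverse_ratf :: "('a, 'b) ratf \<Rightarrow> ('a, 'b) ratf" is inverse by (rule rational_inverse)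
lift_definition minus_ratf :: "('a, 'b) ratf \<Rightarrow> ('a, 'b) ratf \<Rightarrow> ('a, 'b) ratf" is "(-)"
  by (metis diff_conv_add_uminus rational_add rational_uminus)
lift_definition divide_ratf :: "('a, 'b) ratf \<Rightarrow> ('a, 'b) ratf \<Rightarrow> ('a, 'b) ratf" is "(/)"
  by (metis divide_inverse rational_mult rational_inverse)

instance
proof
  fix a b c :: "('a, 'b) ratf"
  show "a + b + c = a + (b + c)" "a + b = b + a" "0 + a = a" "- a + a = 0" "a - b = a + - b"
    "1 * a = a" "a * b * c = a * (b * c)" "(a + b) * c = a * c + b * c" "a div b = a * inverse b"
    "inverse (0 :: ('a, 'b) ratf) = 0"
    by (transfer, simp add: add_ac mult.assoc distrib_right divide_inverse)+
  show "a * b = b * a" by transfer (rule rational_commute)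
  show "(0 :: ('a, 'b) ratf) \<noteq> 1" by transfer simp
  show "a \<noteq> 0 \<Longrightarrow> inverse a * a = 1" by transfer simp
qed

end

lift_definition rp :: "('n::finite, 'k::field_char_0) mpoly \<Rightarrow> ('n, 'k) ratf" is "\<lambda>p. emp p"
  by (rule emp_rational)

interpretation rp: unital_ring_hom rp
  by unfold_locales (transfer, simp add: emp.hom_add emp.hom_mult emp.hom_1)+

lemma rp_eq_0_iff [simp]: "rp p = 0 \<longleftrightarrow> p = 0"
  by transfer simp

lemma rp_eq_iff [simp]: "rp p = rp q \<longleftrightarrow> p = q"
  by transfer simp

lemma ratf_cases: obtains p q where "q \<noteq> 0" "r = rp p / rp q"
proof -
  have "\<exists>p q. q \<noteq> 0 \<and> r = rp p / rp q"
    by transfer (auto simp: rational_elements_def)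
  then show ?thesis using that by blast
qed

lemma ratf_common_denominator:
  assumes "finite B"
  shows "\<exists>Q a. Q \<noteq> 0 \<and> (\<forall>b\<in>B. rp Q * r b = rp (a b))"
  using assms
proof (induction B rule: finite_induct)
  case empty
  then show ?case by (auto intro: exI[of _ 1])
next
  case (insert b B)
  then obtain Q a where Q: "Q \<noteq> 0" "\<forall>b\<in>B. rp Q * r b = rp (a b)" by blast
  obtain p q where pq: "q \<noteq> 0" "r b = rp p / rp q" by (rule ratf_cases)
  have "rp (Q * q) * r x = rp (if x = b then Q * p else q * a x)" if "x \<in> insert b B" for x
    using that pq Q insert.hyps by (auto simp: rp.hom_mult mult.commute mult.left_commute)
  then show ?case using Q pq
    by (intro exI[of _ "Q * q"] exI[of _ "\<lambda>x. if x = b then Q * p else q * a x"]) auto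
qed

lemma ratf_of_nat_neq_0: "n > 0 \<Longrightarrow> of_nat n \<noteq> (0 :: ('n::finite, 'k::field_char_0) ratf)"
  by (metis Const_eq_0_iff Const_of_nat less_irrefl of_nat_eq_0_iff rp.hom_of_nat rp_eq_0_iff)

section \<open>Gradients over the field of rational functions\<close>

definition grad :: "('n::finite, 'k::field_char_0) mpoly \<Rightarrow> ('n, 'k) ratf ^ 'n" where
  "grad p = (\<chi> k. rp (pd k p))"

lemma grad_add: "grad (p + q) = grad p + grad q"
  by (simp add: grad_def vec_eq_iff pd_add rp.hom_add)

lemma grad_Const: "grad (Const c) = 0"
  by (simp add: grad_def vec_eq_iff)

lemma grad_mult: "grad (p * q) = rp p *s grad q + rp q *s grad p"
  by (simp add: grad_def vec_eq_iff pd_mult rp.hom_add rp.hom_mult mult.commute add.commute)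

lemma grad_sum: "grad (sum f A) = (\<Sum>x\<in>A. grad (f x))"
  using grad_Const[of 0] by (induction A rule: infinite_finite_induct) (auto simp: grad_add)

lemma grad_power: "grad (p ^ Suc n) = (of_nat (Suc n) * rp p ^ n) *s grad p"
proof (induction n)
  case (Suc n)
  have "grad (p ^ Suc (Suc n)) = rp p *s grad (p ^ Suc n) + rp (p ^ Suc n) *s grad p"
    by (simp only: power_Suc[of p "Suc n"] grad_mult)
  also have "\<dots> = (rp p * (of_nat (Suc n) * rp p ^ n) + rp p ^ Suc n) *s grad p"
    by (simp only: Suc vec.scale_scale rp.hom_power vec.scale_left_distrib)
  also have "rp p * (of_nat (Suc n) * rp p ^ n) + rp p ^ Suc n = of_nat (Suc (Suc n)) * rp p ^ Suc n"
    by (simp add: algebra_simps)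
  finally show ?case .
qed simp

lemma grad_Var: "grad (Var i) = axis i 1"
  by (simp add: grad_def vec_eq_iff pd_Var axis_def rp.hom_0 rp.hom_1 eq_commute)

context linear_poly_group
begin

text \<open>The power sums of the conjugates of \<open>x\<close> are invariant; since the distinct conjugates give
  independent characters \<open>m \<mapsto> y ^ m\<close>, a linear functional vanishing on the gradients of these
  power sums vanishes on the gradient of \<open>x\<close>.\<close>

lemma linear_vanishing_on_invariant_gradients:
  assumes \<phi>: "Vector_Spaces.linear (*s) (*s) (\<phi> :: ('n, 'k) ratf ^ 'n \<Rightarrow> ('n, 'k) ratf ^ 'n)"
    and vanish: "\<And>p. invar p \<Longrightarrow> \<phi> (grad p) = 0"
  shows "\<phi> (grad x) = 0"
proof -
  interpret \<phi>: Vector_Spaces.linear "(*s)" "(*s)" \<phi> by fact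
  have "\<phi> (grad x) $ j = 0" for j
  proof -
    define Y where "Y = (\<lambda>\<sigma>. \<sigma> x) ` G"
    \<comment> \<open>Several group elements may give the same conjugate, so the characters are
      indexed by the conjugates \<open>y\<close> with multiplicity \<open>N y\<close>, nonzero in
      \<open>K\<close> by characteristic zero.\<close>
    define N where "N y = card {\<sigma>\<in>G. \<sigma> x = y}" for y
    define c where "c y = of_nat (N y) * \<phi> (grad y) $ j" for y
    have "(\<Sum>y\<in>Y. c y * rp y ^ m) = 0" for m
    proof -
      \<comment> \<open>Exponent \<open>Suc m\<close>, so that differentiation leaves the character
        value \<open>y ^ m\<close>, for \<open>m = 0\<close> as well.\<close>
      define P where "P = (\<Sum>\<sigma>\<in>G. (\<sigma> x) ^ Suc m)"
      have P: "invar P"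
        unfolding P_def
      proof (rule invarI)
        fix \<sigma> assume \<sigma>: "\<sigma> \<in> G"
        interpret poly_endo \<sigma> using endo_G \<sigma> by blast
        show "\<sigma> (\<Sum>\<tau>\<in>G. (\<tau> x) ^ Suc m) = (\<Sum>\<tau>\<in>G. (\<tau> x) ^ Suc m)"
          using sum_G_translate[OF \<sigma>, of "\<lambda>\<tau>. (\<tau> x) ^ Suc m"] by (simp add: hom_sum hom_power hom_mult)
      qed
      have "0 = \<phi> (grad P) $ j" by (simp add: vanish P)
      also have "\<dots> = (\<Sum>\<sigma>\<in>G. of_nat (Suc m) * (rp (\<sigma> x) ^ m * \<phi> (grad (\<sigma> x)) $ j))"
        by (simp add: P_def grad_sum grad_power \<phi>.sum \<phi>.scale mult.assoc del: of_nat_Suc power_Suc)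
      also have "\<dots> = of_nat (Suc m) * (\<Sum>\<sigma>\<in>G. rp (\<sigma> x) ^ m * \<phi> (grad (\<sigma> x)) $ j)"
        by (simp only: sum_distrib_left)
      finally have "(\<Sum>\<sigma>\<in>G. rp (\<sigma> x) ^ m * \<phi> (grad (\<sigma> x)) $ j) = 0"
        using ratf_of_nat_neq_0[of "Suc m", where 'n = 'n and 'k = 'k] by (simp del: of_nat_Suc)
      also have "(\<Sum>\<sigma>\<in>G. rp (\<sigma> x) ^ m * \<phi> (grad (\<sigma> x)) $ j) =
          (\<Sum>y\<in>Y. \<Sum>\<sigma>\<in>{\<sigma>\<in>G. \<sigma> x = y}. rp (\<sigma> x) ^ m * \<phi> (grad (\<sigma> x)) $ j)"
        unfolding Y_def using finite_G by (rule sum.image_gen)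
      also have "\<dots> = (\<Sum>y\<in>Y. c y * rp y ^ m)"
        by (intro sum.cong) (auto simp: c_def N_def mult_ac)
      finally show ?thesis .
    qed
    then have "\<forall>y\<in>Y. c y = 0"
      by (intro dedekind_independence[where ch = "\<lambda>y m. rp y ^ m" and mul = "(+)" and u = 0])
        (auto simp: Y_def finite_G power_add mult.commute intro: exI[of _ 1])
    moreover have "x \<in> Y" unfolding Y_def using id_in_G by (rule rev_image_eqI) simp
    ultimately have "c x = 0" by blast
    moreover have "N x > 0" unfolding N_def using finite_G id_in_G by (auto simp: card_gt_0_iff intro!: exI[of _ id])
    ultimately show ?thesis using ratf_of_nat_neq_0[of "N x", where 'n = 'n and 'k = 'k] by (simp add: c_def)
  qed
  then show ?thesis by (simp add: vec_eq_iff)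
qed

end

context poly_reflection_group
begin

text \<open>Clearing denominators turns a relation over \<open>K\<close> into one with polynomial
  coefficients.\<close>

lemma basic_invariants_grad:
  assumes B: "basic_invariants B deg"
  shows "inj_on grad B" "vec.independent (grad ` B)"
proof -
  have fin: "finite B" using B by (simp add: basic_invariants_def)
  have indep: "r b = 0" if rel: "(\<Sum>b\<in>B. r b *s grad b) = 0" and b: "b \<in> B" for r b
  proof -
    obtain Q a where Q: "Q \<noteq> 0" "\<forall>b\<in>B. rp Q * r b = rp (a b)" using ratf_common_denominator[OF fin] by blast
    have "(\<Sum>b\<in>B. a b * pd k b) = 0" for k
    proof -
      have "rp (\<Sum>b\<in>B. a b * pd k b) = (\<Sum>b\<in>B. rp Q * (r b * rp (pd k b)))"
        using Q(2) by (auto simp: rp.hom_sum rp.hom_mult mult.assoc[symmetric] intro: sum.cong)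
      also have "\<dots> = rp Q * (\<Sum>b\<in>B. r b *s grad b) $ k"
        by (simp add: grad_def sum_distrib_left)
      finally show ?thesis using rel by simp
    qed
    then have "a b = 0" using basic_invariants_gradient_independent[OF B _ b] by blast
    then show ?thesis using Q b by (metis mult_eq_0_iff rp_eq_0_iff)
  qed
  show inj: "inj_on grad B"
  proof (rule inj_onI, rule ccontr)
    fix b b' assume bb: "b \<in> B" "b' \<in> B" "grad b = grad b'" "b \<noteq> b'"
    let ?r = "\<lambda>x. if x = b then 1 else if x = b' then - 1 else 0 :: ('n, 'k) ratf"
    have "(\<Sum>x\<in>B. ?r x *s grad x) = (\<Sum>x\<in>{b, b'}. ?r x *s grad x)"
      using fin bb by (intro sum.mono_neutral_right) auto
    also have "\<dots> = 0" using bb by simp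
    finally show False using indep[of ?r b] bb by simp
  qed
  show "vec.independent (grad ` B)"
  proof (rule vec.independent_if_scalars_zero)
    fix h v assume "(\<Sum>x\<in>grad ` B. h x *s x) = 0" "v \<in> grad ` B"
    then show "h v = 0" using indep[of "\<lambda>b. h (grad b)"] inj by (auto simp: sum.reindex)
  qed (use fin in simp)
qed

lemma basic_invariants_card: "basic_invariants B deg \<Longrightarrow> card B \<le> CARD('n)"
  using basic_invariants_grad[of B deg] vec.independent_card_le_dim[of "grad ` B" UNIV]
  by (simp add: card_image card_cart_basis)

text \<open>The last two clauses say that the gradients form a basis: \<open>c\<close> is the dual
  basis, and a functional \<open>e\<close> that kills them all is zero. They span, because a linear
  map that kills the gradients of \<open>B\<close> kills, by Leibniz, those of all invariants, hence
  those of the variables.\<close>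

theorem exists_invariant_coordinates:
  obtains f :: "'n \<Rightarrow> ('n, 'k) mpoly" and c :: "'n \<Rightarrow> 'n \<Rightarrow> ('n, 'k) ratf" where
    "\<And>i. invar (f i)" "\<And>p. invar p \<Longrightarrow> p \<in> subalgebra (range f)"
    "\<And>i j. (\<Sum>k\<in>UNIV. c i k * rp (pd k (f j))) = (if i = j then 1 else 0)"
    "\<And>e k. (\<And>j. (\<Sum>k\<in>UNIV. e k * rp (pd k (f j))) = 0) \<Longrightarrow> e k = 0"
proof -
  have "basic_invariants {} (\<lambda>_. 0)" by (simp add: basic_invariants_def)
  \<comment> \<open>Independence of gradients bounds the size of every family by the dimension, so a
    largest one exists.\<close>
  then obtain B where B': "\<exists>deg. basic_invariants B deg"
    and max: "\<forall>B'. (\<exists>deg. basic_invariants B' deg) \<longrightarrow> card B' \<le> card B"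
    using ex_has_greatest_nat[of "\<lambda>B. \<exists>deg. basic_invariants B deg" "{}" card "CARD('n) + 1"]
      basic_invariants_card by (metis le_imp_less_Suc add.commute plus_1_eq_Suc)
  then obtain deg where B: "basic_invariants B deg" by blast
  have gen: "p \<in> subalgebra B" if "invar p" for p
    using maximal_basic_invariants_generate[OF B _ that] max by blast
  note inj = basic_invariants_grad(1)[OF B] and ind = basic_invariants_grad(2)[OF B]
  have inv: "invar b" if "b \<in> B" for b using B that by (simp add: basic_invariants_def)
  have vanish: "\<phi> (grad x) = 0" if lin: "Vector_Spaces.linear (*s) (*s) \<phi>" and 0: "\<And>b. b \<in> B \<Longrightarrow> \<phi> (grad b) = 0"
    for \<phi> :: "('n, 'k) ratf ^ 'n \<Rightarrow> ('n, 'k) ratf ^ 'n" and x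
  proof (rule linear_vanishing_on_invariant_gradients[OF lin])
    interpret \<phi>: Vector_Spaces.linear "(*s)" "(*s)" \<phi> by (rule lin)
    fix p assume "invar p"
    from gen[OF this] show "\<phi> (grad p) = 0"
      by (induction rule: subalgebra.induct)
        (auto simp: grad_Const grad_add grad_mult \<phi>.add \<phi>.scale \<phi>.zero 0)
  qed
  have span: "vec.span (grad ` B) = UNIV"
  proof (rule ccontr)
    assume "vec.span (grad ` B) \<noteq> UNIV"
    then obtain v where v: "v \<notin> vec.span (grad ` B)" by blast
    then have "vec.independent (insert v (grad ` B))" using ind by (rule vec.independent_insertI)
    then obtain \<phi> :: "('n, 'k) ratf ^ 'n \<Rightarrow> ('n, 'k) ratf ^ 'n" where \<phi>: "Vector_Spaces.linear (*s) (*s) \<phi>"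
      "\<forall>x\<in>insert v (grad ` B). \<phi> x = (if x = v then v else 0)"
      using vec.linear_independent_extend[of "insert v (grad ` B)" "\<lambda>x. if x = v then v else 0"] by blast
    interpret \<phi>: Vector_Spaces.linear "(*s)" "(*s)" \<phi> by (rule \<phi>(1))
    have vB: "v \<notin> grad ` B" using v vec.span_base by blast
    have "\<phi> (grad x) = 0" for x
    proof (rule vanish[OF \<phi>(1)])
      fix b assume b: "b \<in> B"
      then have "grad b \<noteq> v" using vB by blast
      then show "\<phi> (grad b) = 0" using \<phi>(2) b by simp
    qed
    from this[of "Var _"] have ax: "\<phi> (axis k 1) = 0" for k by (simp only: grad_Var)
    have "\<phi> (\<Sum>k\<in>UNIV. v $ k *s axis k 1) = 0" by (simp only: \<phi>.sum \<phi>.scale ax) simp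
    then have "\<phi> v = 0" by (simp only: basis_expansion)
    then have "v = 0" using \<phi>(2) by (simp add: ax)
    then show False using v vec.span_zero by blast
  qed
  have fin: "finite B" using B by (simp add: basic_invariants_def)
  have "card B = CARD('n)"
    using vec.dim_span_eq_card_independent[OF ind] inj span by (simp add: card_image card_cart_basis)
  then obtain f where f: "bij_betw f (UNIV :: 'n set) B"
    using finite_same_card_bij[of "UNIV :: 'n set" B] fin by auto
  then have fB: "range f = B" and finj: "inj f" by (auto simp: bij_betw_def)
  have inj_gf: "inj (\<lambda>i. grad (f i))" using comp_inj_on[OF finj, of grad] inj by (simp add: fB o_def)
  define g where "g = inv_into UNIV (\<lambda>i. grad (f i))"
  have g: "g (grad (f i)) = i" for i unfolding g_def by (rule inv_f_f[OF inj_gf])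
  obtain \<phi> :: "('n, 'k) ratf ^ 'n \<Rightarrow> ('n, 'k) ratf ^ 'n" where \<phi>: "Vector_Spaces.linear (*s) (*s) \<phi>"
      "\<forall>x\<in>grad ` B. \<phi> x = axis (g x) 1"
    using vec.linear_independent_extend[OF ind, of "\<lambda>x. axis (g x) 1"] by blast
  interpret \<phi>: Vector_Spaces.linear "(*s)" "(*s)" \<phi> by (rule \<phi>(1))
  \<comment> \<open>\<phi> sends the gradient of \<open>f j\<close> to the \<open>j\<close>-th unit
    vector, so these are the coordinates of the \<open>k\<close>-th unit vector in the basis of
    gradients.\<close>
  define c where "c i k = \<phi> (axis k 1) $ i" for i k
  show ?thesis
  proof (rule that)
    show "invar (f i)" for i using inv fB by blast
    show "p \<in> subalgebra (range f)" if "invar p" for p using gen[OF that] fB by simp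
    show "(\<Sum>k\<in>UNIV. c i k * rp (pd k (f j))) = (if i = j then 1 else 0)" for i j
    proof -
      have "grad (f j) = (\<Sum>k\<in>UNIV. rp (pd k (f j)) *s axis k 1)"
        using basis_expansion[of "grad (f j)"] by (simp add: grad_def)
      then have "\<phi> (grad (f j)) = (\<Sum>k\<in>UNIV. rp (pd k (f j)) *s \<phi> (axis k 1))"
        by (simp add: \<phi>.sum \<phi>.scale)
      moreover have "\<phi> (grad (f j)) = axis j 1" using \<phi>(2) fB g by auto
      ultimately have "(\<Sum>k\<in>UNIV. rp (pd k (f j)) *s \<phi> (axis k 1)) $ i = axis j 1 $ i" by simp
      then show ?thesis by (simp add: c_def mult.commute axis_def)
    qed
    show "e k = 0" if e: "\<And>j. (\<Sum>k\<in>UNIV. e k * rp (pd k (f j))) = 0" for e k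
    proof -
      have "(\<Sum>k\<in>UNIV. e k * v $ k) = 0" for v
      proof -
        have "v \<in> vec.span (grad ` B)" using span by simp
        then show ?thesis
        proof (induction rule: vec.span_induct_alt)
          case (step r y z)
          have "(\<Sum>k\<in>UNIV. e k * (r *s y + z) $ k) = r * (\<Sum>k\<in>UNIV. e k * y $ k) + (\<Sum>k\<in>UNIV. e k * z $ k)"
            by (simp add: distrib_left sum.distrib sum_distrib_left mult.left_commute)
          moreover have "(\<Sum>k\<in>UNIV. e k * y $ k) = 0" using step(1) fB e by (auto simp: grad_def)
          ultimately show ?case using step(2) by simp
        qed simp
      qed
      from this[of "axis k 1"] show ?thesis
        by (simp add: axis_def if_distrib cong: if_cong)
    qed
  qed
qed

end

section \<open>Invariants of the skew field\<close>

lemma Rep_weyl_sum: "Rep_weyl (sum g A) p = (\<Sum>x\<in>A. Rep_weyl (g x) p)"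
  by (induction A rule: infinite_finite_induct) (auto simp: zero_weyl.rep_eq plus_weyl.rep_eq)

lemma poly_derivation_expand:
  fixes \<delta> :: "('n::finite, 'k::field_char_0) mpoly \<Rightarrow> ('n, 'k) mpoly"
  assumes "\<And>p q. \<delta> (p + q) = \<delta> p + \<delta> q" "\<And>p q. \<delta> (p * q) = \<delta> p * q + p * \<delta> q" "\<And>c. \<delta> (Const c) = 0"
  shows "\<delta> p = (\<Sum>l\<in>UNIV. \<delta> (Var l) * pd l p)"
proof (induction p rule: mpoly_induct)
  case (Var i p)
  have "(\<Sum>l\<in>UNIV. \<delta> (Var l) * pd l (Var i * p)) =
      (\<Sum>l\<in>UNIV. (if l = i then \<delta> (Var i) * p else 0) + Var i * (\<delta> (Var l) * pd l p))"
    unfolding pd_Var_mult by (intro sum.cong) (auto simp: algebra_simps)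
  then show ?case using Var by (simp add: assms(2) sum.distrib sum_distrib_left)
qed (auto simp: assms pd_add distrib_left sum.distrib)

lemma unital_ring_hom_ad: "unital_ring_hom \<phi> \<Longrightarrow> \<phi> (ad x y) = ad (\<phi> x) (\<phi> y)"
  by (simp add: ad_def unital_ring_hom.hom_diff unital_ring_hom.hom_mult)

lemma ad_inverse: "(y :: 'a::division_ring) \<noteq> 0 \<Longrightarrow> ad x (inverse y) = - (inverse y * ad x y * inverse y)"
  by (simp add: ad_def right_diff_distrib left_diff_distrib mult.assoc)
     (simp flip: mult.assoc)

lemma ad_mult_left: "ad (r * d) w = r * ad d w + ad r w * d"
  by (simp add: ad_def algebra_simps)

lemma ad_sum_left: "ad (sum g A) w = (\<Sum>x\<in>A. ad (g x) w)"
  by (simp add: ad_def sum_distrib_left sum_distrib_right sum_subtractf)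

lemma ad_diff_left: "ad (x - y) w = ad x w - ad y w"
  by (simp add: ad_def algebra_simps)

lemma emp_Const_central:
  fixes z :: "('n::finite, 'k::field_char_0) wfield"
  shows "emp (Const c) * z = z * emp (Const c)"
proof -
  obtain a b where z: "b \<noteq> 0" "z = fr a b" by (rule fr_cases)
  have emb: "emb x * emp (Const c) = emp (Const c) * emb x" for x :: "('n, 'k) weyl"
    by (simp add: wc_central flip: fr.hom_mult)
  have "inverse (emb b) * emp (Const c) = emp (Const c) * inverse (emb b)"
    using emb by (intro mult_commute_imp_mult_inverse_commute) simp
  then show ?thesis
    unfolding z(2) fr_eq_divide[OF z(1)] divide_inverse
    by (simp only: mult.assoc) (simp only: mult.assoc[symmetric] emb)
qed

lemma wfield_of_nat_neq_0: "n > 0 \<Longrightarrow> of_nat n \<noteq> (0 :: ('n::finite, 'k::field_char_0) wfield)"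
  by (metis Const_eq_0_iff Const_of_nat emb_eq_0_iff emp.hom_of_nat less_irrefl of_nat_eq_0_iff wm_eq_0_iff)

lemma Rep_ratf_sum: "Rep_ratf (sum g A) = (\<Sum>x\<in>A. Rep_ratf (g x))"
  by (induction A rule: infinite_finite_induct) (auto simp: zero_ratf.rep_eq plus_ratf.rep_eq)

lemma rational_sum: "(\<And>x. x \<in> A \<Longrightarrow> g x \<in> rational_elements) \<Longrightarrow> sum g A \<in> rational_elements"
  using emp_rational[of 0]
  by (induction A rule: infinite_finite_induct) (auto simp: rational_add emp.hom_0)

lemma ad_ed_rational:
  assumes "r \<in> rational_elements" shows "ad (ed k) r \<in> rational_elements"
proof -
  have emp: "ad (ed k) (emp p) = emp (pd k p)" for p
    using unital_ring_hom_ad[OF unital_ring_hom_fr, of "wd k" "wm p"] by (simp add: ad_wd_wm)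
  obtain p q where r: "q \<noteq> 0" "r = emp p / emp q" using assms by (rule rational_elementsE)
  have "ad (ed k) r = emp (pd k p) * inverse (emp q) + emp p * - (inverse (emp q) * emp (pd k q) * inverse (emp q))"
    using r by (simp only: divide_inverse ad.D_mult) (simp add: ad_inverse emp)
  also have "\<dots> \<in> rational_elements"
    by (intro rational_add rational_mult rational_uminus rational_inverse emp_rational)
  finally show ?thesis .
qed

section \<open>Vector fields with rational coefficients and their brackets\<close>

definition vector_field :: "('n \<Rightarrow> ('n::finite, 'k::field_char_0) ratf) \<Rightarrow> ('n, 'k) wfield" where
  "vector_field e = (\<Sum>k\<in>UNIV. Rep_ratf (e k) * ed k)"

lemma ad_vector_field_emp: "ad (vector_field e) (emp p) = Rep_ratf (\<Sum>k\<in>UNIV. e k * rp (pd k p))"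
proof -
  have "ad (ed k) (emp p) = emp (pd k p)" for k
    using unital_ring_hom_ad[OF unital_ring_hom_fr, of "wd k" "wm p"] by (simp add: ad_wd_wm)
  moreover have "ad (Rep_ratf r) (emp p) = 0" for r
    using rational_commute[OF Rep_ratf emp_rational] by (simp add: ad_def)
  ultimately show ?thesis
    by (simp add: vector_field_def ad_sum_left ad_mult_left Rep_ratf_sum times_ratf.rep_eq rp.rep_eq)
qed

lemma vector_field_add: "vector_field e + vector_field e' = vector_field (\<lambda>k. e k + e' k)"
  by (simp add: vector_field_def plus_ratf.rep_eq distrib_right sum.distrib)

lemma vector_field_scale: "Rep_ratf r * vector_field e = vector_field (\<lambda>k. r * e k)"
  by (simp add: vector_field_def times_ratf.rep_eq sum_distrib_left mult.assoc)

lemma vector_field_diff: "vector_field e - vector_field e' = vector_field (\<lambda>k. e k - e' k)"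
  by (simp add: vector_field_def minus_ratf.rep_eq left_diff_distrib sum_subtractf)

lemma vector_field_ed:
  "(ed k :: ('n::finite, 'k::field_char_0) wfield) = vector_field (\<lambda>j. if j = k then 1 else 0)"
proof -
  have "Rep_ratf (if j = k then 1 else 0) * ed j = (if j = k then ed j else 0 :: ('n, 'k) wfield)" for j
    by (simp add: one_ratf.rep_eq zero_ratf.rep_eq)
  then show ?thesis by (simp add: vector_field_def)
qed

lemma ed_in_range_vector_field: "ed k \<in> range vector_field"
  unfolding vector_field_ed by (rule rangeI)

lemma range_vector_field_scale:
  assumes "r \<in> rational_elements" "z \<in> range vector_field" shows "r * z \<in> range vector_field"
proof -
  obtain s where "r = Rep_ratf s" using assms(1) by (metis Abs_ratf_inverse)
  then show ?thesis using assms(2) vector_field_scale by blast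
qed

lemma range_vector_field_diff:
  "z \<in> range vector_field \<Longrightarrow> w \<in> range vector_field \<Longrightarrow> z - w \<in> range vector_field"
  using vector_field_diff by blast

lemma range_vector_field_sum:
  "(\<And>x. x \<in> A \<Longrightarrow> g x \<in> range vector_field) \<Longrightarrow> sum g A \<in> range vector_field"
proof (induction A rule: infinite_finite_induct)
  case (insert x A)
  then show ?case using vector_field_add by force
qed (auto simp: vector_field_def zero_ratf.rep_eq image_iff intro!: exI[of _ "\<lambda>_. 0"])

text \<open>The second-order parts cancel because \<open>K\<close> is commutative and the partial
  derivatives commute.\<close>

lemma range_vector_field_ad:
  assumes "z \<in> range vector_field" "w \<in> range vector_field" shows "ad z w \<in> range vector_field"
proof -
  obtain e e' where zw: "z = vector_field e" "w = vector_field e'" using assms by blast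
  have comm: "ed l * ed k = (ed k * ed l :: ('a, 'b) wfield)" for k l
    by (simp add: wd_commute flip: fr.hom_mult)
  have "ad (r * ed k) (s * ed l) = r * ad (ed k) s * ed l - s * ad (ed l) r * ed k"
    if "r \<in> rational_elements" "s \<in> rational_elements" for r s :: "('a, 'b) wfield" and k l
  proof -
    have "ed k * s = s * ed k + ad (ed k) s" "ed l * r = r * ed l + ad (ed l) r" by (simp_all add: ad_def)
    then have "r * (ed k * s) * ed l - s * (ed l * r) * ed k =
        r * s * (ed k * ed l) + r * ad (ed k) s * ed l - (s * r * (ed l * ed k) + s * ad (ed l) r * ed k)"
      by (simp add: distrib_left distrib_right mult.assoc)
    then show ?thesis using rational_commute[OF that] comm[of l k] by (simp add: ad_def mult.assoc)
  qed
  then have "ad (Rep_ratf (e k) * ed k) (Rep_ratf (e' l) * ed l) \<in> range vector_field" for k l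
    by (simp add: Rep_ratf ed_in_range_vector_field range_vector_field_diff range_vector_field_scale
        rational_mult ad_ed_rational)
  then have "(\<Sum>l\<in>UNIV. \<Sum>k\<in>UNIV. ad (Rep_ratf (e k) * ed k) (Rep_ratf (e' l) * ed l)) \<in> range vector_field"
    by (intro range_vector_field_sum)
  then show ?thesis by (simp only: zw vector_field_def[of e] vector_field_def[of e'] ad_sum_left ad.D_sum)
qed

section \<open>The group action on the Weyl algebra and its skew field\<close>

abbreviation finv :: "('a \<Rightarrow> 'a) \<Rightarrow> 'a \<Rightarrow> 'a" where "finv \<equiv> inv_into UNIV"

context linear_poly_group
begin

lemma inv_in_G: "\<sigma> \<in> G \<Longrightarrow> finv \<sigma> \<in> G"
  using inverse_in_G inv_unique_comp by metis

lemma G_inv: "\<sigma> \<in> G \<Longrightarrow> \<sigma> (finv \<sigma> p) = p" "\<sigma> \<in> G \<Longrightarrow> finv \<sigma> (\<sigma> p) = p"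
  using bij_G by (simp_all add: bij_is_surj surj_f_inv_f bij_is_inj)

definition wact :: "(('n, 'k) mpoly \<Rightarrow> ('n, 'k) mpoly) \<Rightarrow> ('n, 'k) weyl \<Rightarrow> ('n, 'k) weyl" where
  "wact \<sigma> a = Abs_weyl (\<sigma> \<circ> Rep_weyl a \<circ> finv \<sigma>)"

text \<open>The conjugate is again a derivation over the scalars, hence determined by its values on
  the variables. This is why conjugation preserves the Weyl algebra.\<close>

lemma conjugate_pd:
  assumes "\<sigma> \<in> G"
  shows "\<sigma> \<circ> pd i \<circ> finv \<sigma> = Rep_weyl (\<Sum>l\<in>UNIV. wm (\<sigma> (pd i (finv \<sigma> (Var l)))) * wd l)"
proof
  fix p
  note simps = G_simps[OF assms] G_simps[OF inv_in_G[OF assms]]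
  have "(\<sigma> \<circ> pd i \<circ> finv \<sigma>) p = (\<Sum>l\<in>UNIV. (\<sigma> \<circ> pd i \<circ> finv \<sigma>) (Var l) * pd l p)"
    by (rule poly_derivation_expand)
      (simp_all add: simps pd_add pd_mult G_inv assms unital_ring_hom.hom_0[OF G_hom])
  then show "(\<sigma> \<circ> pd i \<circ> finv \<sigma>) p = Rep_weyl (\<Sum>l\<in>UNIV. wm (\<sigma> (pd i (finv \<sigma> (Var l)))) * wd l) p"
    by (simp add: Rep_weyl_sum times_weyl.rep_eq wm.rep_eq wd.rep_eq)
qed

lemma conjugate_weyl_carrier:
  assumes \<sigma>: "\<sigma> \<in> G"
  shows "d \<in> weyl_carrier \<Longrightarrow> \<sigma> \<circ> d \<circ> finv \<sigma> \<in> weyl_carrier"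
proof (induction d rule: weyl_carrier.induct)
  case (var i)
  have "\<sigma> \<circ> (\<lambda>f. Var i * f) \<circ> finv \<sigma> = (\<lambda>f. \<sigma> (Var i) * f)" by (auto simp: G_simps \<sigma> G_inv)
  then show ?case using mult_in_weyl_carrier by metis
next
  case (pd i)
  show ?case unfolding conjugate_pd[OF \<sigma>] by (rule Rep_weyl)
next
  case (scalar c)
  have "\<sigma> \<circ> (\<lambda>f. Const c * f) \<circ> finv \<sigma> = (\<lambda>f. Const c * f)" by (auto simp: G_simps \<sigma> G_inv)
  then show ?case using weyl_carrier.scalar by metis
next
  case (add d e)
  then show ?case using weyl_carrier.add[OF add.IH] by (simp add: o_def G_simps \<sigma>)
next
  case (comp d e)
  have "\<sigma> \<circ> (d \<circ> e) \<circ> finv \<sigma> = (\<sigma> \<circ> d \<circ> finv \<sigma>) \<circ> (\<sigma> \<circ> e \<circ> finv \<sigma>)" by (auto simp: G_inv \<sigma>)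
  then show ?case using weyl_carrier.comp[OF comp.IH] by metis
qed

lemma Rep_wact: "\<sigma> \<in> G \<Longrightarrow> Rep_weyl (wact \<sigma> a) = \<sigma> \<circ> Rep_weyl a \<circ> finv \<sigma>"
  unfolding wact_def by (rule Abs_weyl_inverse) (rule conjugate_weyl_carrier[OF _ Rep_weyl])

lemma weyl_eqI: "(\<And>p. Rep_weyl a p = Rep_weyl b p) \<Longrightarrow> a = b"
  by (metis Rep_weyl_inject ext)

lemma wact_hom: "\<sigma> \<in> G \<Longrightarrow> unital_ring_hom (wact \<sigma>)"
  by unfold_locales
    (auto intro!: weyl_eqI simp: Rep_wact plus_weyl.rep_eq times_weyl.rep_eq one_weyl.rep_eq G_simps G_inv)

lemma wact_comp: "\<sigma> \<in> G \<Longrightarrow> \<tau> \<in> G \<Longrightarrow> wact (\<sigma> \<circ> \<tau>) a = wact \<sigma> (wact \<tau> a)"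
  by (auto intro!: weyl_eqI simp: Rep_wact comp_in_G o_inv_distrib bij_G)

lemma wact_id: "wact id a = a"
  by (auto intro!: weyl_eqI simp: Rep_wact id_in_G)

lemma wact_wm: "\<sigma> \<in> G \<Longrightarrow> wact \<sigma> (wm p) = wm (\<sigma> p)"
  by (auto intro!: weyl_eqI simp: Rep_wact wm.rep_eq G_simps G_inv)

lemma wact_wd: "\<sigma> \<in> G \<Longrightarrow> wact \<sigma> (wd i) = (\<Sum>l\<in>UNIV. wm (\<sigma> (pd i (finv \<sigma> (Var l)))) * wd l)"
  unfolding wact_def wd.rep_eq conjugate_pd by (rule Rep_weyl_inverse)

lemma wact_inverse: "\<sigma> \<in> G \<Longrightarrow> wact \<sigma> (wact (finv \<sigma>) a) = a"
proof -
  assume \<sigma>: "\<sigma> \<in> G"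
  have "\<sigma> \<circ> finv \<sigma> = id" using G_inv(1)[OF \<sigma>] by auto
  then show ?thesis using wact_comp[OF \<sigma> inv_in_G[OF \<sigma>], of a] by (simp add: wact_id)
qed

lemma inv_inv_G: "\<sigma> \<in> G \<Longrightarrow> finv (finv \<sigma>) = \<sigma>"
  by (simp add: bij_G inv_inv_eq)

lemma wact_eq_0_iff: "\<sigma> \<in> G \<Longrightarrow> wact \<sigma> a = 0 \<longleftrightarrow> a = 0"
  using wact_inverse[of "finv \<sigma>" a] inv_in_G[of \<sigma>] inv_inv_G[of \<sigma>] unital_ring_hom.hom_0[OF wact_hom]
  by metis

definition act :: "(('n, 'k) mpoly \<Rightarrow> ('n, 'k) mpoly) \<Rightarrow> ('n, 'k) wfield \<Rightarrow> ('n, 'k) wfield" where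
  "act \<sigma> = ofrac_lift (\<lambda>a. emb (wact \<sigma> a))"

lemma emb_wact:
  assumes "\<sigma> \<in> G"
  shows "unital_ring_hom (\<lambda>a. emb (wact \<sigma> a))" "inj (\<lambda>a. emb (wact \<sigma> a))"
proof -
  interpret unital_ring_hom "wact \<sigma>" by (rule wact_hom[OF assms])
  show "unital_ring_hom (\<lambda>a. emb (wact \<sigma> a))"
    by unfold_locales (simp_all add: hom_add hom_mult hom_1 fr.hom_add fr.hom_mult)
  show "inj (\<lambda>a. emb (wact \<sigma> a))"
  proof (rule injI)
    fix a b assume "emb (wact \<sigma> a) = emb (wact \<sigma> b)"
    then have "wact \<sigma> (a - b) = 0" by (simp add: hom_diff)
    then show "a = b" using wact_eq_0_iff[OF assms] by simp
  qed
qed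

lemma act_hom: "\<sigma> \<in> G \<Longrightarrow> unital_ring_hom (act \<sigma>)"
  unfolding act_def by (rule ofrac_lift_hom[OF emb_wact])

lemma act_fr: "\<sigma> \<in> G \<Longrightarrow> b \<noteq> 0 \<Longrightarrow> act \<sigma> (fr a b) = fr (wact \<sigma> a) (wact \<sigma> b)"
  unfolding act_def by (simp add: ofrac_lift_fr[OF emb_wact] fr_eq_divide[of "wact \<sigma> b"] wact_eq_0_iff)

lemma act_emb: "\<sigma> \<in> G \<Longrightarrow> act \<sigma> (emb a) = emb (wact \<sigma> a)"
  by (simp add: act_fr unital_ring_hom.hom_1[OF wact_hom])

lemma act_comp:
  assumes "\<sigma> \<in> G" "\<tau> \<in> G" shows "act (\<sigma> \<circ> \<tau>) z = act \<sigma> (act \<tau> z)"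
proof -
  obtain a b where "b \<noteq> 0" "z = fr a b" by (rule fr_cases)
  then show ?thesis using assms by (simp add: act_fr wact_eq_0_iff comp_in_G wact_comp)
qed

lemma act_rational: "\<sigma> \<in> G \<Longrightarrow> z \<in> rational_elements \<Longrightarrow> act \<sigma> z \<in> rational_elements"
  by (elim rational_elementsE)
    (simp add: division_ring_hom_inverse[OF act_hom] act_emb wact_wm rational_elementsI G_eq_0_iff)

lemma act_vector_field:
  assumes \<sigma>: "\<sigma> \<in> G" and z: "z \<in> range vector_field" shows "act \<sigma> z \<in> range vector_field"
proof -
  interpret unital_ring_hom "act \<sigma>" by (rule act_hom[OF \<sigma>])
  obtain e where e: "z = vector_field e" using z by blast
  have "act \<sigma> (ed k) = (\<Sum>l\<in>UNIV. emp (\<sigma> (pd k (finv \<sigma> (Var l)))) * ed l)" for k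
    by (simp add: act_emb \<sigma> wact_wd fr.hom_sum fr.hom_mult)
  then have "act \<sigma> (ed k) \<in> range vector_field" for k
    by (auto intro!: range_vector_field_sum range_vector_field_scale emp_rational ed_in_range_vector_field)
  then have "(\<Sum>k\<in>UNIV. act \<sigma> (Rep_ratf (e k)) * act \<sigma> (ed k)) \<in> range vector_field"
    by (intro range_vector_field_sum range_vector_field_scale act_rational \<sigma> Rep_ratf)
  then show ?thesis by (simp only: e vector_field_def[of e] hom_sum hom_mult)
qed

definition fixed :: "('n, 'k) wfield set" where
  "fixed = {z. \<forall>\<sigma>\<in>G. act \<sigma> z = z}"

text \<open>The intersection of the conjugates of the right ideal generated by \<open>Q\<close> is stable and nonzero,
  and some trace of one of its elements is nonzero by independence of characters.\<close>

lemma exists_invariant_right_multiple: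
  assumes Q: "Q \<noteq> 0"
  obtains u where "Q * u \<noteq> 0" "\<And>\<sigma>. \<sigma> \<in> G \<Longrightarrow> wact \<sigma> (Q * u) = Q * u"
proof -
  have "\<exists>p. p \<noteq> 0 \<and> (\<forall>\<sigma>\<in>S. \<exists>u. p = wact \<sigma> Q * u)" if "finite S" "S \<subseteq> G" for S
    using that
  proof (induction S rule: finite_induct)
    case (insert \<sigma> S)
    then obtain p where p: "p \<noteq> 0" "\<forall>\<sigma>\<in>S. \<exists>u. p = wact \<sigma> Q * u" by auto
    have "wact \<sigma> Q \<noteq> 0" using insert.prems Q wact_eq_0_iff by blast
    then obtain u v where uv: "u \<noteq> 0" "p * u = wact \<sigma> Q * v" using right_ore by blast
    have "\<exists>w. p * u = wact \<tau> Q * w" if "\<tau> \<in> S" for \<tau>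
      using p(2) that by (metis mult.assoc)
    then show ?case using uv p(1) by (intro exI[of _ "p * u"]) auto
  qed (auto intro: exI[of _ 1])
  from this[OF finite_G subset_refl]
  obtain p where p: "p \<noteq> 0" "\<And>\<sigma>. \<sigma> \<in> G \<Longrightarrow> \<exists>u. p = wact \<sigma> Q * u" by blast
  define t where "t e = (\<Sum>\<tau>\<in>G. wact \<tau> (p * wm e))" for e
  have "\<exists>e. t e \<noteq> 0"
  proof (rule ccontr)
    assume "\<not> ?thesis"
    then have "(\<Sum>\<tau>\<in>G. wact \<tau> p * wm (\<tau> e)) = 0" for e
      by (simp add: t_def unital_ring_hom.hom_mult[OF wact_hom] wact_wm)
    then have "\<forall>\<tau>\<in>G. wact \<tau> p = 0"
      by (intro dedekind_independence[where ch = "\<lambda>\<tau> e. wm (\<tau> e)" and mul = "(*)" and u = 1])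
        (auto simp: finite_G G_simps unital_ring_hom.hom_1[OF G_hom] wm_mult wm_commute fun_eq_iff)
    then show False using p(1) id_in_G wact_id by metis
  qed
  then obtain e where e: "t e \<noteq> 0" by blast
  have inv: "wact \<sigma> (t e) = t e" if "\<sigma> \<in> G" for \<sigma>
    using sum_G_translate[OF that, of "\<lambda>\<tau>. wact \<tau> (p * wm e)"] that
    by (simp add: t_def unital_ring_hom.hom_sum[OF wact_hom] wact_comp)
  \<comment> \<open>\<open>p\<close> also lies in the right ideal of the conjugate of
    \<open>Q\<close> by the inverse of \<tau>, and \<tau> carries that ideal back to the one of
    \<open>Q\<close>. So every summand of the trace is a right multiple of \<open>Q\<close>.\<close>
  have "\<exists>u. wact \<tau> (p * wm e) = Q * u" if \<tau>: "\<tau> \<in> G" for \<tau>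
  proof -
    obtain u where "p = wact (finv \<tau>) Q * u" using p(2)[OF inv_in_G[OF \<tau>]] by blast
    then have "wact \<tau> (p * wm e) = Q * (wact \<tau> u * wact \<tau> (wm e))"
      using \<tau> by (simp add: unital_ring_hom.hom_mult[OF wact_hom] wact_inverse mult.assoc)
    then show ?thesis by blast
  qed
  then obtain u where u: "\<And>\<tau>. \<tau> \<in> G \<Longrightarrow> wact \<tau> (p * wm e) = Q * u \<tau>" by metis
  have "t e = Q * (\<Sum>\<tau>\<in>G. u \<tau>)" by (simp add: t_def u sum_distrib_left)
  then show ?thesis using that e inv by metis
qed

lemma invar_prod: "invar (\<Prod>\<sigma>\<in>G. \<sigma> q)"
proof (rule invarI)
  fix \<sigma> assume \<sigma>: "\<sigma> \<in> G"
  interpret poly_endo \<sigma> using endo_G \<sigma> by blast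
  have "\<sigma> (prod g A) = (\<Prod>x\<in>A. \<sigma> (g x))" for g and A :: "(('n, 'k) mpoly \<Rightarrow> ('n, 'k) mpoly) set"
    by (induction A rule: infinite_finite_induct) (auto simp: hom_1 hom_mult)
  then have "\<sigma> (\<Prod>\<tau>\<in>G. \<tau> q) = (\<Prod>\<tau>\<in>G. (\<sigma> \<circ> \<tau>) q)" by simp
  also have "bij_betw ((\<circ>) \<sigma>) G G"
    by (rule bij_betw_byWitness[where f' = "(\<circ>) (finv \<sigma>)"])
      (auto simp: comp_in_G \<sigma> inv_in_G G_inv fun_eq_iff)
  then have "(\<Prod>\<tau>\<in>G. (\<sigma> \<circ> \<tau>) q) = (\<Prod>\<tau>\<in>G. \<tau> q)" by (rule prod.reindex_bij_betw)
  finally show "\<sigma> (\<Prod>\<tau>\<in>G. \<tau> q) = (\<Prod>\<tau>\<in>G. \<tau> q)" .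
qed

text \<open>The denominator is expanded to its norm, the product of its conjugates, which is
  invariant; the numerator is then \<open>z\<close> times an invariant.\<close>

lemma fixed_rational:
  assumes z: "z \<in> rational_elements" "z \<in> fixed"
  obtains p q where "invar p" "invar q" "q \<noteq> 0" "z = emp p / emp q"
proof -
  obtain p q where pq: "q \<noteq> 0" "z = emp p / emp q" using z(1) by (rule rational_elementsE)
  define N where "N = (\<Prod>\<sigma>\<in>G. \<sigma> q)"
  define N' where "N' = (\<Prod>\<sigma>\<in>G - {id}. \<sigma> q)"
  have N: "N = q * N'" unfolding N_def N'_def using prod.remove[OF finite_G id_in_G, of "\<lambda>\<sigma>. \<sigma> q"] by simp
  have N0: "N \<noteq> 0" unfolding N_def using finite_G pq(1) G_eq_0_iff by (simp add: mpoly_prod_eq_0_iff)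
  then have "N' \<noteq> 0" using N by auto
  then have zN: "z = emp (p * N') / emp N" unfolding pq N by (rule emp_fraction_cancel[symmetric])
  have iN: "invar N" unfolding N_def by (rule invar_prod)
  have "invar (p * N')"
  proof (rule invarI)
    fix \<sigma> assume \<sigma>: "\<sigma> \<in> G"
    have eq: "emp (p * N') = z * emp N" using N0 by (simp only: zN divide_inverse mult.assoc) simp
    have "act \<sigma> (z * emp N) = z * emp N"
      using z(2) \<sigma> invarD[OF iN] by (simp add: fixed_def unital_ring_hom.hom_mult[OF act_hom] act_emb wact_wm)
    then have "act \<sigma> (emp (p * N')) = emp (p * N')" by (simp only: eq)
    then show "\<sigma> (p * N') = p * N'" by (simp add: act_emb wact_wm \<sigma>)
  qed
  then show ?thesis using that iN N0 zN by blast
qed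

end

section \<open>Dual vector fields, the embedding and its image\<close>

locale invariant_coordinates = poly_reflection_group G
  for G :: "(('n::finite, 'k::field_char_0) mpoly \<Rightarrow> ('n, 'k) mpoly) set" +
  fixes f :: "'n \<Rightarrow> ('n, 'k) mpoly" and c :: "'n \<Rightarrow> 'n \<Rightarrow> ('n, 'k) ratf"
  assumes f_invar: "invar (f i)"
    and f_generate: "invar p \<Longrightarrow> p \<in> subalgebra (range f)"
    and c_dual: "(\<Sum>k\<in>UNIV. c i k * rp (pd k (f j))) = (if i = j then 1 else 0)"
    and f_separate: "(\<And>j. (\<Sum>k\<in>UNIV. e k * rp (pd k (f j))) = 0) \<Longrightarrow> e k = 0"
begin

text \<open>The derivation with respect to the coordinate \<open>f i\<close>, as an element of the
  skew field.\<close>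

definition D :: "'n \<Rightarrow> ('n, 'k) wfield" where "D i = vector_field (c i)"

lemma ad_D_f: "ad (D i) (emp (f j)) = (if i = j then 1 else 0)"
  by (simp add: D_def ad_vector_field_emp c_dual one_ratf.rep_eq zero_ratf.rep_eq)

text \<open>The gradients of the coordinates span, so brackets with the coordinates detect a vector
  field. Commutation, invariance and the expansion below are all checked this way.\<close>

lemma vector_field_eq_0:
  assumes "z \<in> range vector_field" "\<And>j. ad z (emp (f j)) = 0" shows "z = 0"
proof -
  obtain e where e: "z = vector_field e" using assms(1) by blast
  have "(\<Sum>k\<in>UNIV. e k * rp (pd k (f j))) = 0" for j
    using assms(2)[of j] unfolding e ad_vector_field_emp by (metis Rep_ratf_inject zero_ratf.rep_eq)
  then have "e k = 0" for k by (rule f_separate)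
  then show ?thesis by (simp add: e vector_field_def zero_ratf.rep_eq)
qed

text \<open>Dual fields map the coordinates to constants, so by Jacobi their bracket kills every
  coordinate.\<close>

lemma D_commute: "D i * D j = D j * D i"
proof -
  have "ad (D i) (D j) = 0"
  proof (rule vector_field_eq_0)
    show "ad (D i) (D j) \<in> range vector_field" by (intro range_vector_field_ad) (auto simp: D_def)
    show "ad (ad (D i) (D j)) (emp (f l)) = 0" for l
    proof -
      have "ad x (if P then 1 else 0) = 0" for x :: "('n, 'k) wfield" and P by (simp add: ad.D_0 ad.D_1)
      then show ?thesis using ad_jacobi[of "D i" "D j" "emp (f l)"] by (simp add: ad_D_f)
    qed
  qed
  then show ?thesis by (simp add: ad_def)
qed

lemma act_emp_f: "\<sigma> \<in> G \<Longrightarrow> act \<sigma> (emp (f j)) = emp (f j)"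
  by (simp add: act_emb wact_wm invarD[OF f_invar])

lemma act_D: "\<sigma> \<in> G \<Longrightarrow> act \<sigma> (D i) = D i"
proof -
  assume \<sigma>: "\<sigma> \<in> G"
  have "act \<sigma> (D i) - D i = 0"
  proof (rule vector_field_eq_0)
    show "act \<sigma> (D i) - D i \<in> range vector_field"
      by (intro range_vector_field_diff act_vector_field \<sigma>) (auto simp: D_def)
    fix j
    have "ad (act \<sigma> (D i)) (emp (f j)) = act \<sigma> (ad (D i) (emp (f j)))"
      by (simp add: unital_ring_hom_ad[OF act_hom[OF \<sigma>]] act_emp_f \<sigma>)
    also have "\<dots> = ad (D i) (emp (f j))"
      using act_hom[OF \<sigma>] by (simp add: ad_D_f unital_ring_hom.hom_0 unital_ring_hom.hom_1)
    finally show "ad (act \<sigma> (D i) - D i) (emp (f j)) = 0" by (simp add: ad_diff_left)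
  qed
  then show ?thesis by simp
qed

text \<open>The chain rule for the coordinates \<open>f i\<close>: both sides have the same brackets
  with them.\<close>

lemma ed_expand: "ed k = (\<Sum>i\<in>UNIV. emp (pd k (f i)) * D i)"
proof -
  have "ed k - (\<Sum>i\<in>UNIV. emp (pd k (f i)) * D i) = 0"
  proof (rule vector_field_eq_0)
    show "ed k - (\<Sum>i\<in>UNIV. emp (pd k (f i)) * D i) \<in> range vector_field"
      by (intro range_vector_field_diff range_vector_field_sum range_vector_field_scale emp_rational
          ed_in_range_vector_field) (auto simp: D_def)
    fix j
    have "ad (emp p) (emp q) = 0" for p q :: "('n, 'k) mpoly" by (simp add: ad_def emp_commute)
    moreover have "ad (ed k) (emp (f j)) = emp (pd k (f j))"
      using unital_ring_hom_ad[OF unital_ring_hom_fr, of "wd k" "wm (f j)"] by (simp add: ad_wd_wm)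
    moreover have "emp (pd k (f i)) * (if i = j then 1 else 0) = (if i = j then emp (pd k (f j)) else 0)" for i
      by simp
    ultimately show "ad (ed k - (\<Sum>i\<in>UNIV. emp (pd k (f i)) * D i)) (emp (f j)) = 0"
      by (simp add: ad_diff_left ad_sum_left ad_mult_left ad_D_f)
  qed
  then show ?thesis by simp
qed

lemma weyl_system_D: "weyl_system (\<lambda>c. emp (Const c)) (\<lambda>i. emp (f i)) D"
proof (rule weyl_system.intro)
  show "unital_ring_hom (\<lambda>c. emp (Const c) :: ('n, 'k) wfield)"
    by unfold_locales (simp_all add: Const_add Const_mult emp.hom_add emp.hom_mult)
qed (simp_all add: emp_Const_central emp_commute D_commute ad_D_f)

definition weyl_embedding :: "('n, 'k) weyl \<Rightarrow> ('n, 'k) wfield" where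
  "weyl_embedding = weyl_lift (\<lambda>c. emp (Const c)) (\<lambda>i. emp (f i)) D"

lemma weyl_embedding_hom: "unital_ring_hom weyl_embedding" "inj weyl_embedding"
  unfolding weyl_embedding_def
  by (rule weyl_system.weyl_lift_hom[OF weyl_system_D], rule weyl_system.weyl_lift_inj[OF weyl_system_D])

lemma weyl_embedding_gens:
  "weyl_embedding (wc a) = emp (Const a)" "weyl_embedding (wv i) = emp (f i)" "weyl_embedding (wd i) = D i"
  unfolding weyl_embedding_def by (rule weyl_system.weyl_lift_gens[OF weyl_system_D])+

definition field_embedding :: "('n, 'k) wfield \<Rightarrow> ('n, 'k) wfield" where
  "field_embedding = ofrac_lift weyl_embedding"

lemma field_embedding_hom: "unital_ring_hom field_embedding"
  unfolding field_embedding_def by (rule ofrac_lift_hom[OF weyl_embedding_hom])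

interpretation \<Phi>: unital_ring_hom field_embedding by (rule field_embedding_hom)

lemma field_embedding_emb: "field_embedding (emb a) = weyl_embedding a"
  unfolding field_embedding_def using unital_ring_hom.hom_1[OF weyl_embedding_hom(1)]
  by (simp add: ofrac_lift_fr[OF weyl_embedding_hom])

abbreviation T :: "('n, 'k) wfield set" where "T \<equiv> range field_embedding"

lemma T_add: "z \<in> T \<Longrightarrow> w \<in> T \<Longrightarrow> z + w \<in> T"
  by (elim rangeE) (simp flip: \<Phi>.hom_add)

lemma T_mult: "z \<in> T \<Longrightarrow> w \<in> T \<Longrightarrow> z * w \<in> T"
  by (elim rangeE) (simp flip: \<Phi>.hom_mult)

lemma T_divide: "z \<in> T \<Longrightarrow> w \<in> T \<Longrightarrow> z / w \<in> T"
  by (elim rangeE) (simp flip: division_ring_hom_inverse(4)[OF field_embedding_hom])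

lemma T_gens: "emp (Const a) \<in> T" "emp (f i) \<in> T" "D i \<in> T"
proof -
  show "emp (Const a) \<in> T"
    by (rule range_eqI[of _ _ "emb (wc a)"]) (simp only: field_embedding_emb weyl_embedding_gens)
  show "emp (f i) \<in> T"
    by (rule range_eqI[of _ _ "emb (wv i)"]) (simp only: field_embedding_emb weyl_embedding_gens)
  show "D i \<in> T"
    by (rule range_eqI[of _ _ "emb (wd i)"]) (simp only: field_embedding_emb weyl_embedding_gens)
qed

lemma T_1: "1 \<in> T"
  by (rule range_eqI[of _ _ 1]) (simp add: \<Phi>.hom_1)

lemma T_subset_fixed: "T \<subseteq> fixed"
proof
  fix w assume "w \<in> T"
  then obtain z where w: "w = field_embedding z" by blast
  have weyl: "act \<sigma> (weyl_embedding a) = weyl_embedding a" if \<sigma>: "\<sigma> \<in> G" for \<sigma> a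
  proof (induction a rule: weyl_induct)
    case (scalar x)
    show ?case using \<sigma> by (simp add: weyl_embedding_gens act_emb wact_wm G_simps)
  qed (use \<sigma> act_hom[OF \<sigma>] weyl_embedding_hom(1) in \<open>simp_all add: weyl_embedding_gens act_emp_f act_D
      unital_ring_hom.hom_add unital_ring_hom.hom_mult\<close>)
  obtain a b where "b \<noteq> 0" "z = fr a b" by (rule fr_cases)
  then show "w \<in> fixed"
    by (simp add: w fixed_def field_embedding_def ofrac_lift_fr[OF weyl_embedding_hom]
        division_ring_hom_inverse[OF act_hom] weyl)
qed

lemma emp_invar_in_T: "invar p \<Longrightarrow> emp p \<in> T"
proof -
  assume "invar p"
  then have "p \<in> subalgebra (range f)" by (rule f_generate)
  then show ?thesis
    by (induction rule: subalgebra.induct) (auto simp: emp.hom_add emp.hom_mult T_add T_mult T_gens)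
qed

lemma fixed_rational_in_T: "z \<in> rational_elements \<Longrightarrow> z \<in> fixed \<Longrightarrow> z \<in> T"
  by (elim fixed_rational) (simp_all add: T_divide emp_invar_in_T)

inductive_set rational_span :: "('n, 'k) wfield set" where
  zero: "0 \<in> rational_span"
| step: "k \<in> rational_elements \<Longrightarrow> t \<in> T \<Longrightarrow> z \<in> rational_span \<Longrightarrow> k * t + z \<in> rational_span"

lemma rational_span_add: "z \<in> rational_span \<Longrightarrow> w \<in> rational_span \<Longrightarrow> z + w \<in> rational_span"
  by (induction rule: rational_span.induct) (auto simp: add.assoc intro: rational_span.step)

lemma rational_span_scale: "z \<in> rational_span \<Longrightarrow> k \<in> rational_elements \<Longrightarrow> k * z \<in> rational_span"
  by (induction rule: rational_span.induct)
    (auto simp: distrib_left rational_mult simp flip: mult.assoc intro: rational_span.intros)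

lemma rational_span_sum: "(\<And>x. x \<in> A \<Longrightarrow> g x \<in> rational_span) \<Longrightarrow> sum g A \<in> rational_span"
  by (induction A rule: infinite_finite_induct) (auto intro: rational_span.zero rational_span_add)

lemma rational_span_base: "k \<in> rational_elements \<Longrightarrow> t \<in> T \<Longrightarrow> k * t \<in> rational_span"
  using rational_span.step[OF _ _ rational_span.zero] by fastforce

lemma ad_D_rational:
  assumes "r \<in> rational_elements" shows "ad (D i) r \<in> rational_elements"
proof -
  have "ad (Rep_ratf s) r = 0" for s using rational_commute[OF Rep_ratf assms] by (simp add: ad_def)
  then have *: "ad (D i) r = (\<Sum>k\<in>UNIV. Rep_ratf (c i k) * ad (ed k) r)"
    by (simp add: D_def vector_field_def ad_sum_left ad_mult_left)
  show ?thesis unfolding * by (intro rational_sum rational_mult Rep_ratf ad_ed_rational assms)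
qed

text \<open>Moving \<open>D i\<close> past a coefficient \<open>k\<close> costs the bracket
  \<open>ad (D i) k\<close>, which is again rational.\<close>

lemma rational_span_D: "z \<in> rational_span \<Longrightarrow> D i * z \<in> rational_span"
proof (induction rule: rational_span.induct)
  case (step k t z)
  have "D i * (k * t + z) = ad (D i) k * t + k * (D i * t) + D i * z"
    by (simp add: ad_def algebra_simps)
  also have "\<dots> \<in> rational_span"
    using step rational_span_base[OF ad_D_rational[OF step(1), of i] step(2)]
      rational_span_base[OF step(1) T_mult[OF T_gens(3)[of i] step(2)]]
    by (intro rational_span_add)
  finally show ?case .
qed (simp add: rational_span.zero)

lemma emb_in_rational_span: "emb a \<in> rational_span"
proof -
  \<comment> \<open>Stated for left multiplication on the whole span, so that the induction passes
    through products; applied to 1 afterwards.\<close>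
  have "emb a * z \<in> rational_span" if "z \<in> rational_span" for z
    using that
  proof (induction a arbitrary: z rule: weyl_induct)
    case (pd i)
    show ?case unfolding ed_expand[of i] sum_distrib_right mult.assoc
      by (intro rational_span_sum rational_span_scale rational_span_D pd emp_rational)
  next
    case (add a b)
    then show ?case by (simp add: fr.hom_add distrib_right rational_span_add)
  next
    case (mult a b)
    then show ?case by (simp add: fr.hom_mult mult.assoc)
  qed (auto intro: rational_span_scale emp_rational)
  from this[OF rational_span_base[OF emp_rational[of 1] T_1]] show ?thesis by (simp add: emp.hom_1)
qed

text \<open>Elements of \<open>T\<close> are fixed, so the trace acts on the rational coefficients
  alone and makes them invariant rational functions, which lie in \<open>T\<close>.\<close>

lemma trace_in_T: "z \<in> rational_span \<Longrightarrow> (\<Sum>\<sigma>\<in>G. act \<sigma> z) \<in> T"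
proof (induction rule: rational_span.induct)
  case zero
  have "(\<Sum>\<sigma>\<in>G. act \<sigma> 0) = 0" by (simp add: unital_ring_hom.hom_0[OF act_hom])
  then show ?case by (metis \<Phi>.hom_0 rangeI)
next
  case (step k t z)
  have "act \<sigma> t = t" if "\<sigma> \<in> G" for \<sigma> using step(2) T_subset_fixed that by (auto simp: fixed_def)
  then have "(\<Sum>\<sigma>\<in>G. act \<sigma> (k * t + z)) = (\<Sum>\<sigma>\<in>G. act \<sigma> k) * t + (\<Sum>\<sigma>\<in>G. act \<sigma> z)"
    by (simp add: unital_ring_hom.hom_add[OF act_hom] unital_ring_hom.hom_mult[OF act_hom]
        sum.distrib sum_distrib_right)
  moreover have "(\<Sum>\<sigma>\<in>G. act \<sigma> k) \<in> T"
  proof (rule fixed_rational_in_T)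
    show "(\<Sum>\<sigma>\<in>G. act \<sigma> k) \<in> rational_elements" using step(1) by (intro rational_sum act_rational)
    have "act \<sigma> (\<Sum>\<tau>\<in>G. act \<tau> k) = (\<Sum>\<tau>\<in>G. act \<tau> k)" if "\<sigma> \<in> G" for \<sigma>
      using sum_G_translate[OF that, of "\<lambda>\<tau>. act \<tau> k"] that
      by (simp add: unital_ring_hom.hom_sum[OF act_hom] act_comp)
    then show "(\<Sum>\<tau>\<in>G. act \<tau> k) \<in> fixed" by (simp add: fixed_def)
  qed
  ultimately show ?case using step T_add T_mult by simp
qed

lemma emb_fixed_in_T: "emb a \<in> fixed \<Longrightarrow> emb a \<in> T"
proof -
  assume "emb a \<in> fixed"
  then have "(\<Sum>\<sigma>\<in>G. act \<sigma> (emb a)) = (\<Sum>\<sigma>\<in>G. emb a)" by (intro sum.cong) (auto simp: fixed_def)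
  then have "of_nat (card G) * emb a \<in> T" using trace_in_T[OF emb_in_rational_span, of a] by simp
  moreover have "of_nat (card G) \<in> T"
    by (rule range_eqI[of _ _ "of_nat (card G)"]) (simp add: \<Phi>.hom_of_nat)
  ultimately have "of_nat (card G) * emb a / of_nat (card G) \<in> T" by (rule T_divide)
  also have "of_nat (card G) * emb a = emb a * of_nat (card G)" by (rule mult_of_nat_commute)
  finally have "emb a * (of_nat (card G) * inverse (of_nat (card G))) \<in> T"
    by (simp only: divide_inverse mult.assoc)
  then show ?thesis using wfield_of_nat_neq_0[OF card_G, where 'n = 'n and 'k = 'k] by simp
qed

theorem range_field_embedding: "T = fixed"
proof
  show "fixed \<subseteq> T"
  proof
    fix z assume z: "z \<in> fixed"
    obtain P Q where PQ: "Q \<noteq> 0" "z = fr P Q" by (rule fr_cases)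
    \<comment> \<open>An invariant denominator is enough: the new numerator \<open>P * u\<close> is
      \<open>z\<close> times it, hence fixed as well.\<close>
    obtain u where u: "Q * u \<noteq> 0" "\<And>\<sigma>. \<sigma> \<in> G \<Longrightarrow> wact \<sigma> (Q * u) = Q * u"
      using exists_invariant_right_multiple[OF PQ(1)] by blast
    have zt: "z * emb (Q * u) = emb (P * u)"
      using PQ(1) unfolding PQ(2) fr_eq_divide[OF PQ(1)] fr.hom_mult mult.assoc[symmetric]
      by (simp only: divide_inverse mult.assoc[of _ "inverse (emb Q)"]) simp
    have "emb (Q * u) \<in> fixed" by (simp add: fixed_def act_emb u)
    then have "emb (P * u) \<in> fixed"
      using z unfolding fixed_def zt[symmetric] by (auto simp: unital_ring_hom.hom_mult[OF act_hom])
    then have "emb (P * u) / emb (Q * u) \<in> T"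
      using \<open>emb (Q * u) \<in> fixed\<close> by (intro T_divide emb_fixed_in_T)
    also have "emb (P * u) / emb (Q * u) = z" 
      unfolding zt[symmetric] using u(1) by (simp only: divide_inverse mult.assoc) simp
    finally show "z \<in> T" .
  qed
qed (rule T_subset_fixed)

lemma field_embedding_scalar: "field_embedding (emp (Const a)) = emp (Const a)"
  by (simp add: field_embedding_emb weyl_embedding_gens)

end

section \<open>Linear groups and the record-based skew field\<close>

lemma carrier_GL: "g \<in> carrier GL \<longleftrightarrow> Vector_Spaces.linear (*s) (*s) g \<and> bij g"
  by (simp add: GL_def)

lemma linear_inv_GL:
  assumes "g \<in> carrier GL" shows "finv g \<in> carrier GL"
proof -
  interpret g: Vector_Spaces.linear "(*s)" "(*s)" g using assms by (simp add: carrier_GL)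
  have bij: "bij g" using assms by (simp add: carrier_GL)
  have g_inv: "g (finv g v) = v" for v using bij by (simp add: bij_is_surj surj_f_inv_f)
  have inv_g: "finv g (g v) = v" for v using bij by (simp add: bij_is_inj)
  have "finv g (v + w) = finv g v + finv g w" for v w
    using inv_g[of "finv g v + finv g w"] by (simp add: g.add g_inv)
  moreover have "finv g (c *s v) = c *s finv g v" for c v
    using inv_g[of "c *s finv g v"] by (simp add: g.scale g_inv)
  ultimately have "Vector_Spaces.linear (*s) (*s) (finv g)"
    by (intro Vector_Spaces.linear.intro module_hom.intro module_hom_axioms.intro vec.module_axioms
        vec.vector_space_axioms) auto
  then show ?thesis using bij by (simp add: carrier_GL bij_imp_bij_inv)
qed

lemma group_GL: "group (GL :: ('k::field ^ 'n::finite \<Rightarrow> 'k ^ 'n) monoid)"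
proof (rule groupI)
  fix g h :: "'k ^ 'n \<Rightarrow> 'k ^ 'n"
  assume gh: "g \<in> carrier GL" "h \<in> carrier GL"
  show "g \<otimes>\<^bsub>GL\<^esub> h \<in> carrier GL"
    using gh by (auto simp: GL_def bij_comp intro: Vector_Spaces.linear_compose)
next
  fix g :: "'k ^ 'n \<Rightarrow> 'k ^ 'n"
  assume g: "g \<in> carrier GL"
  then have "finv g \<circ> g = id" by (simp add: carrier_GL bij_is_inj)
  then show "\<exists>h\<in>carrier GL. h \<otimes>\<^bsub>GL\<^esub> g = \<one>\<^bsub>GL\<^esub>"
    using linear_inv_GL[OF g] by (auto simp: GL_def)
next
  show "\<one>\<^bsub>GL\<^esub> \<in> carrier (GL :: ('k ^ 'n \<Rightarrow> 'k ^ 'n) monoid)"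
    by (simp add: GL_def vec.linear_id)
qed (auto simp: GL_def comp_assoc)

lemma m_inv_GL: "g \<in> carrier GL \<Longrightarrow> m_inv GL g = finv g"
  by (rule group.inv_equality[OF group_GL])
    (auto simp: linear_inv_GL, simp add: GL_def bij_is_inj)

lemma linear_expand:
  assumes "Vector_Spaces.linear (*s) (*s) (h :: 'k::field ^ 'n::finite \<Rightarrow> 'k ^ 'n)"
  shows "h v $ i = (\<Sum>j\<in>UNIV. v $ j * h (axis j 1) $ i)"
proof -
  interpret h: Vector_Spaces.linear "(*s)" "(*s)" h by fact
  have "h (\<Sum>j\<in>UNIV. v $ j *s axis j 1) = (\<Sum>j\<in>UNIV. v $ j *s h (axis j 1))"
    by (simp only: h.sum h.scale)
  then show ?thesis by (simp add: basis_expansion)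
qed

lemma poly_endo_poly_act: "poly_endo (poly_act g)"
  unfolding poly_act_def by (rule poly_endo_subst_poly)

lemma poly_act_Var: "poly_act g (Var i) = (\<Sum>j\<in>UNIV. Const (finv g (axis j 1) $ i) * Var j)"
  by (simp add: poly_act_def subst_poly_Var)

lemma homog_poly_act_Var: "homog 1 (poly_act g (Var i))"
  unfolding poly_act_Var by (intro homog_sum homog_Const_mult homog_Var)

text \<open>Substitution reverses the order of composition; the inverse inside
  \<open>poly_act\<close> reverses it back.\<close>

lemma poly_act_comp:
  fixes g h :: "'k::field_char_0 ^ 'n::finite \<Rightarrow> 'k ^ 'n"
  assumes "g \<in> carrier GL" "h \<in> carrier GL"
  shows "poly_act (g \<circ> h) = poly_act g \<circ> poly_act h"
proof (rule poly_endo_eqI[OF poly_endo_poly_act poly_endo_comp[OF poly_endo_poly_act poly_endo_poly_act]])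
  interpret g: poly_endo "poly_act g" by (rule poly_endo_poly_act)
  fix i
  have lin: "Vector_Spaces.linear (*s) (*s) (finv h)" using linear_inv_GL[OF assms(2)] by (simp add: carrier_GL)
  have "(poly_act g \<circ> poly_act h) (Var i) =
      (\<Sum>j\<in>UNIV. Const (finv h (axis j 1) $ i) * (\<Sum>l\<in>UNIV. Const (finv g (axis l 1) $ j) * Var l))"
    by (simp add: poly_act_Var[of h] g.hom_sum g.hom_mult g.endo_Const) (simp add: poly_act_Var)
  also have "\<dots> = (\<Sum>l\<in>UNIV. \<Sum>j\<in>UNIV. Const (finv g (axis l 1) $ j * finv h (axis j 1) $ i) * Var l)"
    unfolding sum_distrib_left by (subst sum.swap) (simp add: Const_mult mult_ac)
  also have "\<dots> = (\<Sum>l\<in>UNIV. Const (finv h (finv g (axis l 1)) $ i) * Var l)"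
    unfolding linear_expand[OF lin, of "finv g _"] by (simp add: Const_sum sum_distrib_right)
  also have "\<dots> = poly_act (g \<circ> h) (Var i)"
    using assms by (simp add: poly_act_Var carrier_GL o_inv_distrib)
  finally show "poly_act (g \<circ> h) (Var i) = (poly_act g \<circ> poly_act h) (Var i)" ..
qed

lemma poly_act_id: "poly_act (id :: 'k::field_char_0 ^ 'n::finite \<Rightarrow> 'k ^ 'n) = id"
proof (rule poly_endo_eqI[OF poly_endo_poly_act poly_endo_id])
  fix i :: 'n
  have "(\<Sum>j\<in>UNIV. Const ((axis j 1 :: 'k ^ 'n) $ i) * Var j) = (\<Sum>j\<in>UNIV. if j = i then Var j else 0 :: ('n, 'k) mpoly)"
    by (intro sum.cong) (auto simp: axis_def)
  then show "poly_act (id :: 'k ^ 'n \<Rightarrow> 'k ^ 'n) (Var i) = id (Var i)"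
    unfolding poly_act_Var by (simp add: inv_id)
qed

lemma poly_act_inverse:
  fixes g :: "'k::field_char_0 ^ 'n::finite \<Rightarrow> 'k ^ 'n"
  assumes "g \<in> carrier GL"
  shows "poly_act g \<circ> poly_act (finv g) = id" "poly_act (finv g) \<circ> poly_act g = id"
    "finv (poly_act g) = poly_act (finv g)"
proof -
  have bij: "bij g" using assms by (simp add: carrier_GL)
  have "g \<circ> finv g = id" "finv g \<circ> g = id"
    using bij by (auto simp: bij_is_surj surj_f_inv_f bij_is_inj)
  then show *: "poly_act g \<circ> poly_act (finv g) = id" "poly_act (finv g) \<circ> poly_act g = id"
    using poly_act_comp[OF assms linear_inv_GL[OF assms]] poly_act_comp[OF linear_inv_GL[OF assms] assms]
    by (simp_all add: poly_act_id)
  show "finv (poly_act g) = poly_act (finv g)" by (rule inv_unique_comp[OF *])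
qed

text \<open>A notion stable under inversion, since \<open>generate\<close> also adjoins the inverses
  of the generators.\<close>

definition hyperplane_fixing :: "('k::field ^ 'n::finite \<Rightarrow> 'k ^ 'n) \<Rightarrow> bool" where
  "hyperplane_fixing g \<longleftrightarrow> g \<in> carrier GL \<and> vec.dim {v. g v = v} + 1 = CARD('n)"

lemma hyperplane_fixing_inv: "hyperplane_fixing g \<Longrightarrow> hyperplane_fixing (finv g)"
proof -
  assume g: "hyperplane_fixing g"
  then have "bij g" by (simp add: hyperplane_fixing_def carrier_GL)
  then have "finv g v = v \<longleftrightarrow> g v = v" for v
    by (metis bij_inv_eq_iff)
  then show ?thesis using g by (simp add: hyperplane_fixing_def linear_inv_GL)
qed

text \<open>The inverse \<open>h\<close> moves all vectors along one line: with \<open>v0\<close>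
  off the hyperplane and \<open>u = h v0 - v0\<close>, each \<open>h v - v\<close> is a multiple of
  \<open>u\<close>. The factor, read as a linear form, is \<open>lf\<close>.\<close>

lemma reflection_endo_poly_act:
  fixes g :: "'k::field_char_0 ^ 'n::finite \<Rightarrow> 'k ^ 'n"
  assumes "hyperplane_fixing g"
  shows "reflection_endo (poly_act g)"
proof -
  define h where "h = finv g"
  have "hyperplane_fixing h" unfolding h_def by (rule hyperplane_fixing_inv[OF assms])
  then have lin: "Vector_Spaces.linear (*s) (*s) h" and dim: "vec.dim {v. h v = v} + 1 = CARD('n)"
    by (auto simp: hyperplane_fixing_def carrier_GL)
  interpret h: Vector_Spaces.linear "(*s)" "(*s)" h by (rule lin)
  define H where "H = {v. h v = v}"
  have "vec.subspace H"
    unfolding H_def by (rule vec.subspaceI) (simp_all add: h.zero h.add h.scale)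
  then have span_H: "vec.span H = H" by (simp add: vec.span_eq_iff)
  have "H \<noteq> UNIV" using dim vec_dim_card[where 'a = 'k and 'n = 'n] unfolding H_def[symmetric] by auto
  then obtain v0 where v0: "v0 \<notin> H" by blast
  then have "vec.dim (insert v0 H) = CARD('n)"
    using dim by (simp add: vec.dim_insert span_H H_def[symmetric])
  then have span: "vec.span (insert v0 H) = UNIV"
    using vec.dim_eq_full[of "insert v0 H"] by (simp add: vec.dimension_def card_cart_basis)
  define u where "u = h v0 - v0"
  have "\<exists>t. h v - v = t *s u" for v
  proof -
    have "v \<in> vec.span (insert v0 H)" using span by simp
    then obtain t where "v - t *s v0 \<in> H" using vec.span_breakdown_eq[of v v0 H] by (auto simp: span_H)
    then have "h v - t *s h v0 = v - t *s v0" by (simp add: H_def h.diff h.scale)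
    then have "h v - v = t *s u" by (simp add: u_def algebra_simps vec.scale_right_diff_distrib)
    then show ?thesis ..
  qed
  then obtain t where t: "\<And>v. h v - v = t v *s u" by metis
  define lf :: "('n, 'k) mpoly" where "lf = (\<Sum>j\<in>UNIV. Const (t (axis j 1)) * Var j)"
  have "homog 1 lf" unfolding lf_def by (intro homog_sum homog_Const_mult homog_Var)
  moreover have "poly_act g (Var i) = Var i + Const (u $ i) * lf" for i
  proof -
    have "h (axis j 1) $ i = (if j = i then 1 else 0) + t (axis j 1) * u $ i" for j
    proof -
      have "h (axis j 1) = axis j 1 + t (axis j 1) *s u" using t[of "axis j 1"] by (simp add: algebra_simps)
      then show ?thesis by (simp add: axis_def)
    qed
    then have "poly_act g (Var i) = (\<Sum>j\<in>UNIV. (if j = i then Var j else 0) + Const (u $ i) * (Const (t (axis j 1)) * Var j))"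
      unfolding poly_act_Var h_def[symmetric]
      by (intro sum.cong) (auto simp: Const_add Const_mult algebra_simps)
    then show ?thesis by (simp add: sum.distrib sum_distrib_left lf_def)
  qed
  moreover have "lf \<noteq> 0"
  proof
    assume lf0: "lf = 0"
    have "t (axis j 1) = 0" for j
    proof -
      have "pd j lf = (\<Sum>k\<in>UNIV. if k = j then Const (t (axis k 1)) else 0)"
        unfolding lf_def pd.D_sum by (intro sum.cong) (auto simp: pd_Const_mult pd_Var)
      then show ?thesis using lf0 by simp
    qed
    then have "h (axis j 1) = axis j 1" for j using t[of "axis j 1"] by simp
    then have "h v0 $ i = v0 $ i" for i
      unfolding linear_expand[OF lin, of v0 i]
      by (simp add: axis_def if_distrib[of "(*) _"] cong: if_cong)
    then show False using v0 by (simp add: H_def vec_eq_iff)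
  qed
  ultimately show ?thesis unfolding reflection_endo_def by (intro exI[of _ lf] exI[of _ "\<lambda>i. u $ i"]) blast
qed

lemma compositions_comp:
  "\<sigma> \<in> compositions R \<Longrightarrow> \<tau> \<in> compositions R \<Longrightarrow> \<sigma> \<circ> \<tau> \<in> compositions R"
  by (induction rule: compositions.induct) (auto simp: comp_assoc intro: compositions.comp)

lemma compositions_base: "\<sigma> \<in> R \<Longrightarrow> \<sigma> \<in> compositions R"
  using compositions.comp[OF _ compositions.id, of \<sigma> R] by simp

lemma poly_reflection_group_poly_act:
  fixes W :: "('k::field_char_0 ^ 'n::finite \<Rightarrow> 'k ^ 'n) set"
  assumes W: "pseudo_reflection_group W"
  shows "poly_reflection_group (poly_act ` W)"
proof (intro poly_reflection_group.intro linear_poly_group.intro poly_reflection_group_axioms.intro)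
  have sub: "subgroup W GL" and fin: "finite W" using W by (auto simp: pseudo_reflection_group_def)
  obtain S where S: "S \<subseteq> Collect pseudo_reflection" "W = generate GL S"
    using W by (auto simp: pseudo_reflection_group_def)
  have car: "g \<in> carrier GL" if "g \<in> W" for g using subgroup.subset[OF sub] that by blast
  have comp: "g \<circ> h \<in> W" if "g \<in> W" "h \<in> W" for g h
    using subgroup.m_closed[OF sub that] by (simp add: GL_def)
  have inverse: "finv g \<in> W" if "g \<in> W" for g
    using subgroup.m_inv_closed[OF sub that] m_inv_GL[OF car[OF that]] by simp
  have one: "id \<in> W" using subgroup.one_closed[OF sub] by (simp add: GL_def)
  show "finite (poly_act ` W)" using fin by simp
  show "id \<in> poly_act ` W" using one poly_act_id by (metis imageI)
  show "\<sigma> \<circ> \<tau> \<in> poly_act ` W" if "\<sigma> \<in> poly_act ` W" "\<tau> \<in> poly_act ` W" for \<sigma> \<tau>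
    using that by (auto simp: poly_act_comp[OF car car, symmetric] comp)
  show "\<exists>\<tau>\<in>poly_act ` W. \<tau> \<circ> \<sigma> = id \<and> \<sigma> \<circ> \<tau> = id" if "\<sigma> \<in> poly_act ` W" for \<sigma>
    using that poly_act_inverse[OF car] inverse by blast
  show "poly_endo \<sigma>" if "\<sigma> \<in> poly_act ` W" for \<sigma> using that poly_endo_poly_act by blast
  show "homog 1 (\<sigma> (Var i))" if "\<sigma> \<in> poly_act ` W" for \<sigma> i using that homog_poly_act_Var by blast
  show "poly_act ` W \<subseteq> compositions {\<sigma> \<in> poly_act ` W. reflection_endo \<sigma>}"
  proof clarify
    fix g assume "g \<in> W"
    then have "g \<in> generate GL S" using S by simp
    then show "poly_act g \<in> compositions {\<sigma> \<in> poly_act ` W. reflection_endo \<sigma>}"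
    proof (induction rule: generate.induct)
      case one
      have "\<one>\<^bsub>GL\<^esub> = (id :: 'k ^ 'n \<Rightarrow> 'k ^ 'n)" by (simp add: GL_def)
      then show ?case by (simp only: poly_act_id compositions.id)
    next
      case (incl h)
      then have h: "hyperplane_fixing h" "h \<in> W"
        using S generate.incl[of h S GL] by (auto simp: pseudo_reflection_def hyperplane_fixing_def)
      then show ?case by (intro compositions_base) (simp add: reflection_endo_poly_act)
    next
      case (inv h)
      then have h: "hyperplane_fixing h" "h \<in> W"
        using S generate.incl[of h S GL] by (auto simp: pseudo_reflection_def hyperplane_fixing_def)
      then show ?case unfolding m_inv_GL[OF car[OF h(2)]]
        by (intro compositions_base) (simp add: reflection_endo_poly_act hyperplane_fixing_inv inverse)
    next
      case (eng h1 h2)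
      then have "h1 \<in> W" "h2 \<in> W" using S by simp_all
      then have "poly_act (h1 \<otimes>\<^bsub>GL\<^esub> h2) = poly_act h1 \<circ> poly_act h2"
        using poly_act_comp[OF car car] by (simp add: GL_def)
      then show ?case using compositions_comp[OF eng.IH] by metis
    qed
  qed
qed

text \<open>Dictionary from the division ring type \<open>wfield\<close> to the record
  \<open>weyl_field\<close>: all pairs of operators representing \<open>x\<close>, which is one
  class of \<open>frac_rel\<close>.\<close>

definition frac_class :: "('n::finite, 'k::field_char_0) wfield \<Rightarrow> ('n, 'k) operator_frac" where
  "frac_class x = {(Rep_weyl a, Rep_weyl b) | a b. b \<noteq> 0 \<and> x = fr a b}"

lemma frac_class_iff: "(Rep_weyl a, Rep_weyl b) \<in> frac_class x \<longleftrightarrow> b \<noteq> 0 \<and> x = fr a b"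
  by (auto simp: frac_class_def Rep_weyl_inject)

lemma weyl_algebra_simps:
  "carrier weyl_algebra = range Rep_weyl"
  "Rep_weyl a \<otimes>\<^bsub>weyl_algebra\<^esub> Rep_weyl b = Rep_weyl (a * b)"
  "Rep_weyl a \<oplus>\<^bsub>weyl_algebra\<^esub> Rep_weyl b = Rep_weyl (a + b)"
  "\<zero>\<^bsub>weyl_algebra\<^esub> = Rep_weyl 0" "\<one>\<^bsub>weyl_algebra\<^esub> = Rep_weyl 1"
  "c \<odot>\<^bsub>weyl_algebra\<^esub> Rep_weyl a = Rep_weyl (wc c * a)"
  by (auto simp: weyl_algebra_def type_definition.Rep_range[OF type_definition_weyl] times_weyl.rep_eq
      plus_weyl.rep_eq zero_weyl.rep_eq one_weyl.rep_eq wm.rep_eq o_def)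

lemma frac_rel_iff:
  "((Rep_weyl a, Rep_weyl b), z) \<in> frac_rel weyl_algebra \<longleftrightarrow> b \<noteq> 0 \<and> z \<in> frac_class (fr a b)"
proof -
  have "((Rep_weyl a, Rep_weyl b), (Rep_weyl c, Rep_weyl d)) \<in> frac_rel weyl_algebra \<longleftrightarrow>
      b \<noteq> 0 \<and> d \<noteq> 0 \<and> fr a b = fr c d" for c d
    by (auto simp: frac_rel_def frac_pairs_def weyl_algebra_simps Rep_weyl_inject fr_eq_iff; blast)
  then show ?thesis
  proof (cases "\<exists>c d. z = (Rep_weyl c, Rep_weyl d)")
    case False
    have "((Rep_weyl a, Rep_weyl b), z) \<notin> frac_rel weyl_algebra"
      using False by (auto simp: frac_rel_def frac_pairs_def weyl_algebra_simps)
    moreover have "z \<notin> frac_class (fr a b)" using False by (auto simp: frac_class_def)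
    ultimately show ?thesis by blast
  qed (auto simp: frac_class_iff)
qed

lemma frac_class_eq: "b \<noteq> 0 \<Longrightarrow> frac_rel weyl_algebra `` {(Rep_weyl a, Rep_weyl b)} = frac_class (fr a b)"
  by (auto simp: Image_def frac_rel_iff)

lemma inj_frac_class: "inj frac_class"
proof (rule injI)
  fix x y :: "('a, 'b) wfield" assume eq: "frac_class x = frac_class y"
  obtain a b where "b \<noteq> 0" "x = fr a b" by (rule fr_cases)
  then have "(Rep_weyl a, Rep_weyl b) \<in> frac_class y" unfolding eq[symmetric] by (simp add: frac_class_iff)
  then show "x = y" using \<open>x = fr a b\<close> by (simp add: frac_class_iff)
qed

lemma carrier_weyl_field:
  "carrier (weyl_field :: ('k::field_char_0, ('n::finite, 'k) operator_frac) module) = range frac_class"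
proof (intro equalityI subsetI)
  fix X :: "('n, 'k) operator_frac" assume "X \<in> carrier weyl_field"
  then obtain z where z: "z \<in> frac_pairs weyl_algebra" "X = frac_rel weyl_algebra `` {z}"
    unfolding weyl_field_def skew_fraction_field_def by (auto elim: quotientE)
  then obtain a b where "z = (Rep_weyl a, Rep_weyl b)" "b \<noteq> 0"
    by (auto simp: frac_pairs_def weyl_algebra_simps Rep_weyl_inject)
  then show "X \<in> range frac_class" using z by (simp add: frac_class_eq)
next
  fix X :: "('n, 'k) operator_frac" assume "X \<in> range frac_class"
  then obtain x where x: "X = frac_class x" by blast
  obtain a b where ab: "b \<noteq> 0" "x = fr a b" by (rule fr_cases)
  then have "(Rep_weyl a, Rep_weyl b) \<in> frac_pairs weyl_algebra"
    by (auto simp: frac_pairs_def weyl_algebra_simps Rep_weyl_inject)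
  from quotientI[OF this, of "frac_rel weyl_algebra"]
  have "frac_class (fr a b) \<in> frac_pairs weyl_algebra // frac_rel weyl_algebra"
    by (simp only: frac_class_eq[OF ab(1)])
  then show "X \<in> carrier weyl_field" by (simp add: x ab weyl_field_def skew_fraction_field_def)
qed

text \<open>This shape and the next match the nested existentials in the record operations, so
  membership translates layer by layer into statements about the types.\<close>

lemma ex_frac_class:
  "(\<exists>A B. (A, B) \<in> frac_class x \<and> P A B) \<longleftrightarrow> (\<exists>a b. b \<noteq> 0 \<and> x = fr a b \<and> P (Rep_weyl a) (Rep_weyl b))"
  by (auto simp: frac_class_def)

lemma ex_weyl_algebra: "(\<exists>U. U \<in> carrier weyl_algebra \<and> P U) \<longleftrightarrow> (\<exists>u. P (Rep_weyl u))"
  by (auto simp: weyl_algebra_simps)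

lemma mem_mult_weyl_field:
  "z \<in> frac_class x \<otimes>\<^bsub>weyl_field\<^esub> frac_class y \<longleftrightarrow> (\<exists>a b c d u v. b \<noteq> 0 \<and> x = fr a b \<and> d \<noteq> 0 \<and> y = fr c d \<and>
      b * u = c * v \<and> v \<noteq> 0 \<and> z \<in> frac_class (fr (a * u) (d * v)))" (is "?L \<longleftrightarrow> ?R")
proof -
  have "?L \<longleftrightarrow> (\<exists>A B. (A, B) \<in> frac_class x \<and> (\<exists>C D. (C, D) \<in> frac_class y \<and>
      (\<exists>U. U \<in> carrier weyl_algebra \<and> (\<exists>V. V \<in> carrier weyl_algebra \<and>
      B \<otimes>\<^bsub>weyl_algebra\<^esub> U = C \<otimes>\<^bsub>weyl_algebra\<^esub> V \<and> V \<noteq> \<zero>\<^bsub>weyl_algebra\<^esub> \<and>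
      ((A \<otimes>\<^bsub>weyl_algebra\<^esub> U, D \<otimes>\<^bsub>weyl_algebra\<^esub> V), z) \<in> frac_rel weyl_algebra))))"
    by (simp add: weyl_field_def skew_fraction_field_def)
  also have "\<dots> \<longleftrightarrow> ?R"
    unfolding ex_frac_class ex_weyl_algebra unfolding weyl_algebra_simps Rep_weyl_inject frac_rel_iff mult_eq_0_iff de_Morgan_disj
    by blast
  finally show ?thesis .
qed

text \<open>Every choice of representatives and multipliers gives \<open>x * y\<close>, so the
  record product is contained in one class; the Ore condition provides a choice, so it is the whole
  class.\<close>

lemma mult_weyl_field: "frac_class x \<otimes>\<^bsub>weyl_field\<^esub> frac_class y = frac_class (x * y)"
proof -
  have key: "fr (a * u) (d * v) = x * y"
    if "b \<noteq> 0" "d \<noteq> 0" "x = fr a b" "y = fr c d" "b * u = c * v" "v \<noteq> 0" for a b c d u v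
    using that fr_cancel[of d v c] fr_mult[of b "d * v" a u] by auto
  obtain a b where ab: "b \<noteq> 0" "x = fr a b" by (rule fr_cases)
  obtain c d where cd: "d \<noteq> 0" "y = fr c d" by (rule fr_cases)
  obtain v u where uv: "v \<noteq> 0" "c * v = b * u" using right_ore[OF ab(1), of c] by blast
  show ?thesis
  proof (rule Set.set_eqI, unfold mem_mult_weyl_field, rule iffI)
    fix z assume "z \<in> frac_class (x * y)"
    then have "z \<in> frac_class (fr (a * u) (d * v))"
      using key[OF ab(1) cd(1) ab(2) cd(2) uv(2)[symmetric] uv(1)] by simp
    then show "\<exists>a b c d u v. b \<noteq> 0 \<and> x = fr a b \<and> d \<noteq> 0 \<and> y = fr c d \<and>
      b * u = c * v \<and> v \<noteq> 0 \<and> z \<in> frac_class (fr (a * u) (d * v))"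
      using ab cd uv(1) uv(2)[symmetric] by blast
  qed (use key in metis)
qed

lemma mem_add_weyl_field:
  "z \<in> frac_class x \<oplus>\<^bsub>weyl_field\<^esub> frac_class y \<longleftrightarrow> (\<exists>a b c d u v. b \<noteq> 0 \<and> x = fr a b \<and> d \<noteq> 0 \<and> y = fr c d \<and>
      b * u = d * v \<and> b * u \<noteq> 0 \<and> z \<in> frac_class (fr (a * u + c * v) (b * u)))" (is "?L \<longleftrightarrow> ?R")
proof -
  have "?L \<longleftrightarrow> (\<exists>A B. (A, B) \<in> frac_class x \<and> (\<exists>C D. (C, D) \<in> frac_class y \<and>
      (\<exists>U. U \<in> carrier weyl_algebra \<and> (\<exists>V. V \<in> carrier weyl_algebra \<and>
      B \<otimes>\<^bsub>weyl_algebra\<^esub> U = D \<otimes>\<^bsub>weyl_algebra\<^esub> V \<and> B \<otimes>\<^bsub>weyl_algebra\<^esub> U \<noteq> \<zero>\<^bsub>weyl_algebra\<^esub> \<and>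
      ((A \<otimes>\<^bsub>weyl_algebra\<^esub> U \<oplus>\<^bsub>weyl_algebra\<^esub> C \<otimes>\<^bsub>weyl_algebra\<^esub> V, B \<otimes>\<^bsub>weyl_algebra\<^esub> U), z)
        \<in> frac_rel weyl_algebra))))"
    by (simp add: weyl_field_def skew_fraction_field_def)
  also have "\<dots> \<longleftrightarrow> ?R"
    unfolding ex_frac_class ex_weyl_algebra unfolding weyl_algebra_simps Rep_weyl_inject frac_rel_iff by blast
  finally show ?thesis .
qed

lemma add_weyl_field: "frac_class x \<oplus>\<^bsub>weyl_field\<^esub> frac_class y = frac_class (x + y)"
proof -
  have key: "fr (a * u + c * v) (b * u) = x + y"
    if *: "b \<noteq> 0" "d \<noteq> 0" "x = fr a b" "y = fr c d" "b * u = d * v" "b * u \<noteq> 0" for a b c d u v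
  proof -
    have "u \<noteq> 0" using *(6) by auto
    moreover have "v \<noteq> 0" using *(5,6) by auto
    ultimately have "x = fr (a * u) (b * u)" "y = fr (c * v) (b * u)"
      using * fr_cancel[of b u a] fr_cancel[of d v c] by simp_all
    then show ?thesis using *(6) by (simp only: fr_add not_False_eq_True)
  qed
  obtain a b where ab: "b \<noteq> 0" "x = fr a b" by (rule fr_cases)
  obtain c d where cd: "d \<noteq> 0" "y = fr c d" by (rule fr_cases)
  obtain u v where uv: "u \<noteq> 0" "b * u = d * v" using right_ore[OF cd(1), of b] by blast
  have nz: "b * u \<noteq> 0" using uv(1) ab(1) by simp
  show ?thesis
  proof (rule Set.set_eqI, unfold mem_add_weyl_field, rule iffI)
    fix z assume "z \<in> frac_class (x + y)"
    then have "z \<in> frac_class (fr (a * u + c * v) (b * u))"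
      using key[OF ab(1) cd(1) ab(2) cd(2) uv(2) nz] by simp
    then show "\<exists>a b c d u v. b \<noteq> 0 \<and> x = fr a b \<and> d \<noteq> 0 \<and> y = fr c d \<and>
      b * u = d * v \<and> b * u \<noteq> 0 \<and> z \<in> frac_class (fr (a * u + c * v) (b * u))"
      using ab cd uv(2) nz by blast
  qed (use key in metis)
qed

lemma one_weyl_field: "\<one>\<^bsub>weyl_field\<^esub> = frac_class 1"
  by (simp add: weyl_field_def skew_fraction_field_def weyl_algebra_simps frac_class_eq)

lemma smult_weyl_field: "k \<odot>\<^bsub>weyl_field\<^esub> frac_class x = frac_class (emp (Const k) * x)"
proof -
  have unfold: "z \<in> k \<odot>\<^bsub>weyl_field\<^esub> frac_class x \<longleftrightarrow>
      (\<exists>A B. (A, B) \<in> frac_class x \<and> ((k \<odot>\<^bsub>weyl_algebra\<^esub> A, B), z) \<in> frac_rel weyl_algebra)" for z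
    by (simp add: weyl_field_def skew_fraction_field_def)
  have key: "fr (wc k * a) b = emp (Const k) * x" if "b \<noteq> 0" "x = fr a b" for a b
    using that fr_mult[of 1 b "wc k" a] by simp
  obtain a b where ab: "b \<noteq> 0" "x = fr a b" by (rule fr_cases)
  show ?thesis
  proof (rule Set.set_eqI, rule iffI)
    fix z assume "z \<in> k \<odot>\<^bsub>weyl_field\<^esub> frac_class x"
    then show "z \<in> frac_class (emp (Const k) * x)"
      unfolding unfold ex_frac_class weyl_algebra_simps frac_rel_iff using key by auto
  next
    fix z assume "z \<in> frac_class (emp (Const k) * x)"
    then show "z \<in> k \<odot>\<^bsub>weyl_field\<^esub> frac_class x"
      unfolding unfold using key[OF ab] ab
      by (intro exI[of _ "Rep_weyl a"] exI[of _ "Rep_weyl b"])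
        (simp add: weyl_algebra_simps frac_rel_iff frac_class_iff)
  qed
qed

text \<open>The image is a full class and not just part of one: pairs in the target class are pulled
  back by the inverse automorphism.\<close>

lemma weyl_field_act_frac_class:
  fixes W :: "('k::field_char_0 ^ 'n::finite \<Rightarrow> 'k ^ 'n) set"
  assumes W: "pseudo_reflection_group W" and g: "g \<in> W"
  shows "weyl_field_act g (frac_class x) = frac_class (linear_poly_group.act (poly_act g) x)"
proof -
  interpret poly_reflection_group "poly_act ` W" by (rule poly_reflection_group_poly_act[OF W])
  have G: "poly_act g \<in> poly_act ` W" using g by blast
  have "g \<in> carrier GL" using W g by (auto simp: pseudo_reflection_group_def dest: subgroup.subset)
  then have wa: "weyl_act g (Rep_weyl a) = Rep_weyl (wact (poly_act g) a)" for a
    by (simp add: weyl_act_def Rep_wact[OF G] poly_act_inverse)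
  have *: "b \<noteq> 0 \<and> x = fr a b \<longleftrightarrow> wact (poly_act g) b \<noteq> 0 \<and>
      act (poly_act g) x = fr (wact (poly_act g) a) (wact (poly_act g) b)" for a b
  proof (cases "b = 0")
    case False
    have "act (poly_act g) x = act (poly_act g) (fr a b) \<longleftrightarrow> x = fr a b"
      using division_ring_hom_inverse(3)[OF act_hom[OF G]] by (auto dest: injD)
    then show ?thesis using False by (simp add: act_fr[OF G] wact_eq_0_iff[OF G])
  qed (simp add: wact_eq_0_iff[OF G])
  show ?thesis
  proof (rule Set.set_eqI, rule iffI)
    fix z assume "z \<in> weyl_field_act g (frac_class x)"
    then obtain a b where "b \<noteq> 0" "x = fr a b" "z = (weyl_act g (Rep_weyl a), weyl_act g (Rep_weyl b))"
      by (auto simp: weyl_field_act_def frac_class_def)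
    then show "z \<in> frac_class (act (poly_act g) x)" using *[of b a] by (simp add: wa frac_class_iff)
  next
    fix z assume "z \<in> frac_class (act (poly_act g) x)"
    then obtain a' b' where z: "z = (Rep_weyl a', Rep_weyl b')" "b' \<noteq> 0" "act (poly_act g) x = fr a' b'"
      by (auto simp: frac_class_def)
    define a where "a = wact (finv (poly_act g)) a'"
    define b where "b = wact (finv (poly_act g)) b'"
    have ab: "wact (poly_act g) a = a'" "wact (poly_act g) b = b'" by (simp_all add: a_def b_def wact_inverse[OF G])
    then have "b \<noteq> 0 \<and> x = fr a b" using *[of b a] z by simp
    then have "(Rep_weyl a, Rep_weyl b) \<in> frac_class x" by (simp add: frac_class_iff)
    then have "map_prod (weyl_act g) (weyl_act g) (Rep_weyl a, Rep_weyl b) \<in> weyl_field_act g (frac_class x)"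
      unfolding weyl_field_act_def by (rule imageI)
    then show "z \<in> weyl_field_act g (frac_class x)" by (simp add: wa ab z)
  qed
qed

theorem theorem6p12:
  fixes W :: "('k::field_char_0 ^ 'n::finite \<Rightarrow> 'k ^ 'n) set"
  assumes "pseudo_reflection_group W"
  shows "algebra_isomorphic (weyl_field_invariants W)
    (weyl_field :: ('k, ('n, 'k) operator_frac) module)"
proof -
  interpret poly_reflection_group "poly_act ` W" by (rule poly_reflection_group_poly_act[OF assms])
  obtain f :: "'n \<Rightarrow> ('n, 'k) mpoly" and c :: "'n \<Rightarrow> 'n \<Rightarrow> ('n, 'k) ratf" where fc:
    "\<And>i. invar (f i)" "\<And>p. invar p \<Longrightarrow> p \<in> subalgebra (range f)"
    "\<And>i j. (\<Sum>k\<in>UNIV. c i k * rp (pd k (f j))) = (if i = j then 1 else 0)"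
    "\<And>e k. (\<And>j. (\<Sum>k\<in>UNIV. e k * rp (pd k (f j))) = 0) \<Longrightarrow> e k = 0"
    using exists_invariant_coordinates by blast
  interpret invariant_coordinates "poly_act ` W" f c
    by unfold_locales (rule fc(1), erule fc(2), rule fc(3), rule fc(4))
  interpret \<Phi>: unital_ring_hom field_embedding by (rule field_embedding_hom)
  have inj: "inj field_embedding" by (rule division_ring_hom_inverse(3)[OF field_embedding_hom])
  have "carrier (weyl_field_invariants W) = {frac_class x | x. \<forall>g\<in>W. frac_class (act (poly_act g) x) = frac_class x}"
    by (auto simp: weyl_field_invariants_def carrier_weyl_field weyl_field_act_frac_class[OF assms])
  also have "\<dots> = frac_class ` fixed"
    by (auto simp: fixed_def inj_frac_class[THEN inj_eq])
  also have "\<dots> = range (\<lambda>z. frac_class (field_embedding z))"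
    unfolding range_field_embedding[symmetric] by (simp add: image_image)
  finally have carrier: "carrier (weyl_field_invariants W) = range (\<lambda>z. frac_class (field_embedding z))" .
  have ops: "mult (weyl_field_invariants W) = mult weyl_field" "add (weyl_field_invariants W) = add weyl_field"
    "one (weyl_field_invariants W) = one weyl_field" "smult (weyl_field_invariants W) = smult weyl_field"
    by (simp_all add: weyl_field_invariants_def)
  have inj': "inj (\<lambda>z. frac_class (field_embedding z))"
    using inj_compose[OF inj_frac_class inj] by (simp add: o_def)
  \<comment> \<open>The map starts at the invariants, so it inverts the embedding, transported by
    the dictionary \<open>frac_class\<close>.\<close>
  define h where "h X = frac_class (inv_into UNIV (\<lambda>z. frac_class (field_embedding z)) X)" for X
  have h: "h (frac_class (field_embedding z)) = frac_class z" for z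
    unfolding h_def by (simp add: inv_f_f[OF inj'])
  have "h \<in> ring_hom (weyl_field_invariants W) weyl_field"
  proof (rule ring_hom_memI)
    fix X Y assume "X \<in> carrier (weyl_field_invariants W)" "Y \<in> carrier (weyl_field_invariants W)"
    then obtain x y where xy: "X = frac_class (field_embedding x)" "Y = frac_class (field_embedding y)"
      unfolding carrier by blast
    show "h (X \<otimes>\<^bsub>weyl_field_invariants W\<^esub> Y) = h X \<otimes>\<^bsub>weyl_field\<^esub> h Y"
      unfolding xy ops mult_weyl_field h by (simp only: \<Phi>.hom_mult[symmetric] h)
    show "h (X \<oplus>\<^bsub>weyl_field_invariants W\<^esub> Y) = h X \<oplus>\<^bsub>weyl_field\<^esub> h Y"
      unfolding xy ops add_weyl_field h by (simp only: \<Phi>.hom_add[symmetric] h)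
  next
    fix X assume "X \<in> carrier (weyl_field_invariants W)"
    then show "h X \<in> carrier weyl_field" by (auto simp: h_def carrier_weyl_field)
  next
    show "h \<one>\<^bsub>weyl_field_invariants W\<^esub> = \<one>\<^bsub>weyl_field\<^esub>"
      unfolding ops one_weyl_field using h[of 1] by (simp only: \<Phi>.hom_1)
  qed
  moreover have "bij_betw h (carrier (weyl_field_invariants W)) (carrier weyl_field)"
    unfolding bij_betw_def carrier carrier_weyl_field
    by (auto simp: inj_on_def h image_image inj_frac_class[THEN inj_eq])
  ultimately have "h \<in> ring_iso (weyl_field_invariants W) weyl_field" by (simp add: ring_iso_def)
  moreover have "h (k \<odot>\<^bsub>weyl_field_invariants W\<^esub> X) = k \<odot>\<^bsub>weyl_field\<^esub> h X"
    if X: "X \<in> carrier (weyl_field_invariants W)" for k X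
  proof -
    obtain z where z: "X = frac_class (field_embedding z)" using X unfolding carrier by blast
    have "emp (Const k) * field_embedding z = field_embedding (emp (Const k) * z)"
      by (simp only: \<Phi>.hom_mult field_embedding_scalar)
    then show ?thesis unfolding z ops smult_weyl_field h by (simp only: h)
  qed
  ultimately show ?thesis unfolding algebra_isomorphic_def by blast
qed

end
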